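(* Let $\mathbb{A}$ be a 2-category with a strict initial object, let $\mathcal{A}$ denote its underlying category, and let $\mathcal{H} \colon \mathcal{A} \to \mathsf{CAT}$ be the pseudofunctor sending an object $x$ to the lax comma category $\mathbb{A}\Downarrow x$ and a morphism $p \colon x \to y$ to the functor $p_! \colon \mathbb{A}\Downarrow x \to \mathbb{A}\Downarrow y$ given by composing (whiskering) with $p$ on morphisms (2-cells). Then the Grothendieck construction $\int_{\mathcal{A}^{\mathrm{op}}} \mathcal{H} \to \mathcal{A}^{\mathrm{op}}$ of $\mathcal{H}$, regarded as a pseudofunctor $(\mathcal{A}^{\mathrm{op}})^{\mathrm{op}} \to \mathsf{CAT}$, preserves effective descent morphisms.
   Context: The lax comma category $\mathbb{A} \Downarrow x$ is the (1-)category whose objects are morphisms $f \colon a \to x$ of $\mathbb{A}$ with codomain $x$, and whose morphisms from $f \colon a \to x$ to $g \colon b \to x$ are pairs $(h,\pi)$ with $h \colon a \to b$ a morphism of $\mathbb{A}$ and $\pi \colon f \Rightarrow g \cdot h$ a 2-cell; the composite of $(h,\pi) \colon f \to g$ and $(k,\chi)\colon g \to l$ is $(k\cdot h, (\chi\cdot h)\circ\pi)$. The functor $p_!$ sends $f$ to $p\cdot f$ and $(h,\pi)$ to $(h, p\cdot \pi)$. The Grothendieck construction of a pseudofunctor $\mathcal{F} \colon \mathcal{B}^{\mathrm{op}} \to \mathsf{CAT}$ is the projection $\int_{\mathcal{B}}\mathcal{F} \to \mathcal{B}$, $(a,x)\mapsto a$, where objects are the pairs $(a,x)$ with $a\in\mathcal{B}$,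 $x \in \mathcal{F}_a$, and morphisms $(a,x)\to(b,y)$ are pairs $(f,\phi)$ with $f \colon a\to b$ in $\mathcal{B}$ and $\phi \colon x\to \mathcal{F}_f(y)$ in $\mathcal{F}_a$. Here $\mathcal{B} = \mathcal{A}^{\mathrm{op}}$ and $\mathcal{F} = \mathcal{H}$: the objects of $\int_{\mathcal{A}^{\mathrm{op}}}\mathcal{H}$ are the morphisms of $\mathbb{A}$, and a morphism from $g \colon b \to y$ to $f \colon a \to x$ is a triple $(p,h,\pi)$ with $p \colon x \to y$ and $h \colon b \to a$ in $\mathbb{A}$ and $\pi \colon g \Rightarrow p\cdot f\cdot h$ a 2-cell; the projection sends $f \colon a \to x$ to $x$. A strict initial object of a 2-category $\mathbb{A}$ is an object $\mathsf{0}$ such that $\mathbb{A}(\mathsf{0},x)$ is isomorphic to the terminal category for every $x$, and such that every object $a$ admitting a morphism $a \to \mathsf{0}$ is isomorphic to $\mathsf{0}$. A morphism $p \colon a \to b$ in a category $\mathcal{X}$ is an effective descent morphism if all pullbacks along $p$ exist in $\mathcal{X}$ (equivalently, the functor $p_! \colon \mathcal{X} \downarrow a \to \mathcal{X} \downarrow b$, $f \mapsto p \circ f$, between slice categories has a right adjoint $p^*$) and $p^*$ is monadic (its comparison functor into the Eilenberg-Moore category of the monad induced by $p_! \dashv p^*$ is an equivalence). No existence of other pullbacks in $\mathcal{X}$ is assumed. A functor $F$ preserves effective descent morphisms if $F(p)$ is an effective descent morphism whenever $p$ is. *)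

theory Defs
  imports Main
begin

section \<open>Categories, functors, natural transformations\<close>

record ('o, 'm) cat_data =
  Ob :: "'o set"
  Ar :: "'m set"
  Dom :: "'m \<Rightarrow> 'o"
  Cod :: "'m \<Rightarrow> 'o"
  Id :: "'o \<Rightarrow> 'm"
  Comp :: "'m \<Rightarrow> 'm \<Rightarrow> 'm" (infixl "\<cdot>\<index>" 70)

definition Hom :: "('o, 'm) cat_data \<Rightarrow> 'o \<Rightarrow> 'o \<Rightarrow> 'm set" where
  "Hom X a b = {f \<in> Ar X. Dom X f = a \<and> Cod X f = b}"

locale category =
  fixes X :: "('o, 'm) cat_data"
  assumes Dom_Ob: "f \<in> Ar X \<Longrightarrow> Dom X f \<in> Ob X"
    and Cod_Ob: "f \<in> Ar X \<Longrightarrow> Cod X f \<in> Ob X"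
    and Id_Hom: "a \<in> Ob X \<Longrightarrow> Id X a \<in> Hom X a a"
    and Comp_Hom: "f \<in> Hom X a b \<Longrightarrow> g \<in> Hom X b c \<Longrightarrow> g \<cdot>\<^bsub>X\<^esub> f \<in> Hom X a c"
    and Comp_Id: "f \<in> Ar X \<Longrightarrow> f \<cdot>\<^bsub>X\<^esub> Id X (Dom X f) = f"
    and Id_Comp: "f \<in> Ar X \<Longrightarrow> Id X (Cod X f) \<cdot>\<^bsub>X\<^esub> f = f"
    and Comp_assoc: "f \<in> Hom X a b \<Longrightarrow> g \<in> Hom X b c \<Longrightarrow> h \<in> Hom X c d \<Longrightarrow>
      (h \<cdot>\<^bsub>X\<^esub> g) \<cdot>\<^bsub>X\<^esub> f = h \<cdot>\<^bsub>X\<^esub> (g \<cdot>\<^bsub>X\<^esub> f)"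

definition op_cat :: "('o, 'm) cat_data \<Rightarrow> ('o, 'm) cat_data" where
  "op_cat X = \<lparr>Ob = Ob X, Ar = Ar X, Dom = Cod X, Cod = Dom X, Id = Id X,
     Comp = (\<lambda>g f. f \<cdot>\<^bsub>X\<^esub> g)\<rparr>"

definition terminal_cat :: "(unit, unit) cat_data" where
  "terminal_cat = \<lparr>Ob = UNIV, Ar = UNIV, Dom = (\<lambda>_. ()), Cod = (\<lambda>_. ()), Id = (\<lambda>_. ()),
     Comp = (\<lambda>_ _. ())\<rparr>"

definition iso_arrow :: "('o, 'm) cat_data \<Rightarrow> 'm \<Rightarrow> bool" where
  "iso_arrow X f \<longleftrightarrow> f \<in> Ar X \<and>
     (\<exists>g \<in> Hom X (Cod X f) (Dom X f).
        g \<cdot>\<^bsub>X\<^esub> f = Id X (Dom X f) \<and> f \<cdot>\<^bsub>X\<^esub> g = Id X (Cod X f))"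

definition iso_objects :: "('o, 'm) cat_data \<Rightarrow> 'o \<Rightarrow> 'o \<Rightarrow> bool" where
  "iso_objects X a b \<longleftrightarrow> a \<in> Ob X \<and> b \<in> Ob X \<and> (\<exists>f \<in> Hom X a b. iso_arrow X f)"

record ('o, 'm, 'p, 'n) fun_data =
  FOb :: "'o \<Rightarrow> 'p"
  FAr :: "'m \<Rightarrow> 'n"

locale is_functor =
  fixes C :: "('o, 'm) cat_data" and D :: "('p, 'n) cat_data"
    and F :: "('o, 'm, 'p, 'n) fun_data"
  assumes FOb_Ob: "x \<in> Ob C \<Longrightarrow> FOb F x \<in> Ob D"
    and FAr_Hom: "f \<in> Hom C x y \<Longrightarrow> FAr F f \<in> Hom D (FOb F x) (FOb F y)"
    and FAr_Id: "x \<in> Ob C \<Longrightarrow> FAr F (Id C x) = Id D (FOb F x)"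
    and FAr_Comp: "f \<in> Hom C x y \<Longrightarrow> g \<in> Hom C y z \<Longrightarrow>
      FAr F (g \<cdot>\<^bsub>C\<^esub> f) = FAr F g \<cdot>\<^bsub>D\<^esub> FAr F f"

definition id_fun :: "('o, 'm, 'o, 'm) fun_data" where
  "id_fun = \<lparr>FOb = id, FAr = id\<rparr>"

definition comp_fun ::
  "('p, 'n, 'q, 'k) fun_data \<Rightarrow> ('o, 'm, 'p, 'n) fun_data \<Rightarrow> ('o, 'm, 'q, 'k) fun_data"
  where
  "comp_fun G F = \<lparr>FOb = FOb G \<circ> FOb F, FAr = FAr G \<circ> FAr F\<rparr>"

definition nat_trans :: "('o, 'm) cat_data \<Rightarrow> ('p, 'n) cat_data \<Rightarrow> ('o, 'm, 'p, 'n) fun_data \<Rightarrow>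
    ('o, 'm, 'p, 'n) fun_data \<Rightarrow> ('o \<Rightarrow> 'n) \<Rightarrow> bool" where
  "nat_trans C D F G \<tau> \<longleftrightarrow>
     (\<forall>x \<in> Ob C. \<tau> x \<in> Hom D (FOb F x) (FOb G x)) \<and>
     (\<forall>x y. \<forall>f \<in> Hom C x y. \<tau> y \<cdot>\<^bsub>D\<^esub> FAr F f = FAr G f \<cdot>\<^bsub>D\<^esub> \<tau> x)"

definition nat_iso :: "('o, 'm) cat_data \<Rightarrow> ('p, 'n) cat_data \<Rightarrow> ('o, 'm, 'p, 'n) fun_data \<Rightarrow>
    ('o, 'm, 'p, 'n) fun_data \<Rightarrow> ('o \<Rightarrow> 'n) \<Rightarrow> bool" where
  "nat_iso C D F G \<tau> \<longleftrightarrow> nat_trans C D F G \<tau> \<and> (\<forall>x \<in> Ob C. iso_arrow D (\<tau> x))"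

definition is_equivalence ::
  "('o, 'm) cat_data \<Rightarrow> ('p, 'n) cat_data \<Rightarrow> ('o, 'm, 'p, 'n) fun_data \<Rightarrow> bool" where
  "is_equivalence C D K \<longleftrightarrow> is_functor C D K \<and>
     (\<exists>L \<eta> \<epsilon>. is_functor D C L \<and> nat_iso C C id_fun (comp_fun L K) \<eta> \<and>
        nat_iso D D (comp_fun K L) id_fun \<epsilon>)"

definition isomorphic_cats :: "('o, 'm) cat_data \<Rightarrow> ('p, 'n) cat_data \<Rightarrow> bool" where
  "isomorphic_cats C D \<longleftrightarrow> (\<exists>F G. is_functor C D F \<and> is_functor D C G \<and>
     (\<forall>x \<in> Ob C. FOb G (FOb F x) = x) \<and> (\<forall>f \<in> Ar C. FAr G (FAr F f) = f) \<and>
     (\<forall>y \<in> Ob D. FOb F (FOb G y) = y) \<and> (\<forall>g \<in> Ar D. FAr F (FAr G g) = g))"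


section \<open>Adjunctions and monads\<close>

definition adjunction :: "('o, 'm) cat_data \<Rightarrow> ('p, 'n) cat_data \<Rightarrow> ('o, 'm, 'p, 'n) fun_data \<Rightarrow>
    ('p, 'n, 'o, 'm) fun_data \<Rightarrow> ('o \<Rightarrow> 'm) \<Rightarrow> ('p \<Rightarrow> 'n) \<Rightarrow> bool" where
  "adjunction C D F G \<eta> \<epsilon> \<longleftrightarrow>
     is_functor C D F \<and> is_functor D C G \<and>
     nat_trans C C id_fun (comp_fun G F) \<eta> \<and> nat_trans D D (comp_fun F G) id_fun \<epsilon> \<and>
     (\<forall>x \<in> Ob C. \<epsilon> (FOb F x) \<cdot>\<^bsub>D\<^esub> FAr F (\<eta> x) = Id D (FOb F x)) \<and>
     (\<forall>y \<in> Ob D. FAr G (\<epsilon> y) \<cdot>\<^bsub>C\<^esub> \<eta> (FOb G y) = Id C (FOb G y))"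

record ('o, 'm) monad_data =
  Endo :: "('o, 'm, 'o, 'm) fun_data"
  Unit :: "'o \<Rightarrow> 'm"
  Mult :: "'o \<Rightarrow> 'm"

definition induced_monad :: "('o, 'm, 'p, 'n) fun_data \<Rightarrow> ('p, 'n, 'o, 'm) fun_data \<Rightarrow>
    ('o \<Rightarrow> 'm) \<Rightarrow> ('p \<Rightarrow> 'n) \<Rightarrow> ('o, 'm) monad_data" where
  "induced_monad F G \<eta> \<epsilon> =
     \<lparr>Endo = comp_fun G F, Unit = \<eta>, Mult = (\<lambda>x. FAr G (\<epsilon> (FOb F x)))\<rparr>"

text \<open>In categories of structured arrows, a morphism is a triple (source, target, underlying datum).\<close>

definition em_cat :: "('o, 'm) cat_data \<Rightarrow> ('o, 'm) monad_data \<Rightarrow>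
    ('o \<times> 'm, ('o \<times> 'm) \<times> ('o \<times> 'm) \<times> 'm) cat_data" where
  "em_cat C T = (let algebras =
       {(x, \<alpha>). x \<in> Ob C \<and> \<alpha> \<in> Hom C (FOb (Endo T) x) x \<and>
          \<alpha> \<cdot>\<^bsub>C\<^esub> Unit T x = Id C x \<and>
          \<alpha> \<cdot>\<^bsub>C\<^esub> FAr (Endo T) \<alpha> = \<alpha> \<cdot>\<^bsub>C\<^esub> Mult T x}
     in \<lparr>Ob = algebras,
       Ar = {((x, \<alpha>), (y, \<beta>), h). (x, \<alpha>) \<in> algebras \<and> (y, \<beta>) \<in> algebras \<and>
          h \<in> Hom C x y \<and> h \<cdot>\<^bsub>C\<^esub> \<alpha> = \<beta> \<cdot>\<^bsub>C\<^esub> FAr (Endo T) h},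
       Dom = (\<lambda>(a, b, h). a),
       Cod = (\<lambda>(a, b, h). b),
       Id = (\<lambda>(x, \<alpha>). ((x, \<alpha>), (x, \<alpha>), Id C x)),
       Comp = (\<lambda>(b', c, k) (a, b, h). (a, c, k \<cdot>\<^bsub>C\<^esub> h))\<rparr>)"

definition comparison_fun :: "('p, 'n) cat_data \<Rightarrow> ('p, 'n, 'o, 'm) fun_data \<Rightarrow> ('p \<Rightarrow> 'n) \<Rightarrow>
    ('p, 'n, 'o \<times> 'm, ('o \<times> 'm) \<times> ('o \<times> 'm) \<times> 'm) fun_data" where
  "comparison_fun D G \<epsilon> = (let K = (\<lambda>y. (FOb G y, FAr G (\<epsilon> y)))
     in \<lparr>FOb = K, FAr = (\<lambda>h. (K (Dom D h), K (Cod D h), FAr G h))\<rparr>)"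

definition monadic_adjunction :: "('o, 'm) cat_data \<Rightarrow> ('p, 'n) cat_data \<Rightarrow>
    ('o, 'm, 'p, 'n) fun_data \<Rightarrow> ('p, 'n, 'o, 'm) fun_data \<Rightarrow>
    ('o \<Rightarrow> 'm) \<Rightarrow> ('p \<Rightarrow> 'n) \<Rightarrow> bool" where
  "monadic_adjunction C D F G \<eta> \<epsilon> \<longleftrightarrow> adjunction C D F G \<eta> \<epsilon> \<and>
     is_equivalence D (em_cat C (induced_monad F G \<eta> \<epsilon>)) (comparison_fun D G \<epsilon>)"


section \<open>Effective descent morphisms\<close>

definition slice :: "('o, 'm) cat_data \<Rightarrow> 'o \<Rightarrow> ('m, 'm \<times> 'm \<times> 'm) cat_data" where
  "slice X b = \<lparr>Ob = {f \<in> Ar X. Cod X f = b},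
     Ar = {(f, g, h). f \<in> Ar X \<and> Cod X f = b \<and> g \<in> Ar X \<and> Cod X g = b \<and>
        h \<in> Hom X (Dom X f) (Dom X g) \<and> g \<cdot>\<^bsub>X\<^esub> h = f},
     Dom = (\<lambda>(f, g, h). f),
     Cod = (\<lambda>(f, g, h). g),
     Id = (\<lambda>f. (f, f, Id X (Dom X f))),
     Comp = (\<lambda>(g', l, k) (f, g, h). (f, l, k \<cdot>\<^bsub>X\<^esub> h))\<rparr>"

definition slice_postcomp ::
  "('o, 'm) cat_data \<Rightarrow> 'm \<Rightarrow> ('m, 'm \<times> 'm \<times> 'm, 'm, 'm \<times> 'm \<times> 'm) fun_data" where
  "slice_postcomp X p =
     \<lparr>FOb = (\<lambda>f. p \<cdot>\<^bsub>X\<^esub> f), FAr = (\<lambda>(f, g, h). (p \<cdot>\<^bsub>X\<^esub> f, p \<cdot>\<^bsub>X\<^esub> g, h))\<rparr>"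

definition is_pullback :: "('o, 'm) cat_data \<Rightarrow> 'm \<Rightarrow> 'm \<Rightarrow> 'm \<Rightarrow> 'm \<Rightarrow> bool" where
  "is_pullback X p g p' g' \<longleftrightarrow>
     p \<in> Ar X \<and> g \<in> Ar X \<and> Cod X p = Cod X g \<and>
     p' \<in> Ar X \<and> g' \<in> Ar X \<and> Dom X p' = Dom X g' \<and>
     Cod X g' = Dom X p \<and> Cod X p' = Dom X g \<and> p \<cdot>\<^bsub>X\<^esub> g' = g \<cdot>\<^bsub>X\<^esub> p' \<and>
     (\<forall>w. \<forall>u \<in> Hom X w (Dom X p). \<forall>v \<in> Hom X w (Dom X g). p \<cdot>\<^bsub>X\<^esub> u = g \<cdot>\<^bsub>X\<^esub> v \<longrightarrow>
        (\<exists>!t. t \<in> Hom X w (Dom X p') \<and> g' \<cdot>\<^bsub>X\<^esub> t = u \<and> p' \<cdot>\<^bsub>X\<^esub> t = v))"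

text \<open>
  Right adjoints being unique up to isomorphism, whether \<open>p\<^sup>*\<close> is monadic does not depend on
  the chosen right adjoint, unit and counit.
\<close>

definition effective_descent :: "('o, 'm) cat_data \<Rightarrow> 'm \<Rightarrow> bool" where
  "effective_descent X p \<longleftrightarrow> p \<in> Ar X \<and>
     (\<forall>g \<in> Ar X. Cod X g = Cod X p \<longrightarrow> (\<exists>p' g'. is_pullback X p g p' g')) \<and>
     (\<exists>G \<eta> \<epsilon>. monadic_adjunction (slice X (Dom X p)) (slice X (Cod X p))
        (slice_postcomp X p) G \<eta> \<epsilon>)"

definition preserves_effective_descent ::
  "('o, 'm) cat_data \<Rightarrow> ('p, 'n) cat_data \<Rightarrow> ('o, 'm, 'p, 'n) fun_data \<Rightarrow> bool" where
  "preserves_effective_descent X Y F \<longleftrightarrow>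
     (\<forall>p. effective_descent X p \<longrightarrow> effective_descent Y (FAr F p))"


section \<open>Pseudofunctors to CAT and the Grothendieck construction\<close>

text \<open>
  \<open>PComp F g f z\<close> is the component at \<open>z\<close> of the coherence isomorphism
  from the composite of \<open>PAr F g\<close> and \<open>PAr F f\<close> to \<open>PAr F (g \<cdot> f)\<close>, and \<open>PUnit F x z\<close> is the
  component at \<open>z\<close> of the one from the identity to \<open>PAr F (Id x)\<close>.
\<close>

record ('o, 'm, 'p, 'n) pseudofun_data =
  POb :: "'o \<Rightarrow> ('p, 'n) cat_data"
  PAr :: "'m \<Rightarrow> ('p, 'n, 'p, 'n) fun_data"
  PComp :: "'m \<Rightarrow> 'm \<Rightarrow> 'p \<Rightarrow> 'n"
  PUnit :: "'o \<Rightarrow> 'p \<Rightarrow> 'n"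

locale pseudofunctor =
  fixes C :: "('o, 'm) cat_data" and F :: "('o, 'm, 'p, 'n) pseudofun_data"
  assumes POb_category: "x \<in> Ob C \<Longrightarrow> category (POb F x)"
    and PAr_functor: "f \<in> Hom C x y \<Longrightarrow> is_functor (POb F x) (POb F y) (PAr F f)"
    and PComp_iso: "f \<in> Hom C x y \<Longrightarrow> g \<in> Hom C y z \<Longrightarrow>
      nat_iso (POb F x) (POb F z) (comp_fun (PAr F g) (PAr F f)) (PAr F (g \<cdot>\<^bsub>C\<^esub> f)) (PComp F g f)"
    and PUnit_iso: "x \<in> Ob C \<Longrightarrow>
      nat_iso (POb F x) (POb F x) id_fun (PAr F (Id C x)) (PUnit F x)"
    and PComp_assoc: "f \<in> Hom C x y \<Longrightarrow> g \<in> Hom C y z \<Longrightarrow> h \<in> Hom C z w \<Longrightarrow> a \<in> Ob (POb F x) \<Longrightarrow>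
      PComp F (h \<cdot>\<^bsub>C\<^esub> g) f a \<cdot>\<^bsub>POb F w\<^esub> PComp F h g (FOb (PAr F f) a) =
      PComp F h (g \<cdot>\<^bsub>C\<^esub> f) a \<cdot>\<^bsub>POb F w\<^esub> FAr (PAr F h) (PComp F g f a)"
    and PComp_PUnit_right: "f \<in> Hom C x y \<Longrightarrow> a \<in> Ob (POb F x) \<Longrightarrow>
      PComp F f (Id C x) a \<cdot>\<^bsub>POb F y\<^esub> FAr (PAr F f) (PUnit F x a) =
      Id (POb F y) (FOb (PAr F f) a)"
    and PComp_PUnit_left: "f \<in> Hom C x y \<Longrightarrow> a \<in> Ob (POb F x) \<Longrightarrow>
      PComp F (Id C y) f a \<cdot>\<^bsub>POb F y\<^esub> PUnit F y (FOb (PAr F f) a) =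
      Id (POb F y) (FOb (PAr F f) a)"

text \<open>
  Here \<open>F\<close> is a pseudofunctor on \<open>op_cat B\<close>, so that \<open>PAr F f\<close> goes from \<open>POb F (Cod B f)\<close> to
  \<open>POb F (Dom B f)\<close>. The composite of \<open>(f, \<phi>)\<close> and \<open>(g, \<psi>)\<close> has second component
  \<open>x \<rightarrow> F\<^sub>f y \<rightarrow> F\<^sub>f (F\<^sub>g z) \<rightarrow> F\<^sub>g\<^sub>f z\<close>.
\<close>

definition grothendieck :: "('o, 'm) cat_data \<Rightarrow> ('o, 'm, 'p, 'n) pseudofun_data \<Rightarrow>
    ('o \<times> 'p, ('o \<times> 'p) \<times> ('o \<times> 'p) \<times> ('m \<times> 'n)) cat_data" where
  "grothendieck B F = (let objects = {(a, x). a \<in> Ob B \<and> x \<in> Ob (POb F a)}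
     in \<lparr>Ob = objects,
       Ar = {((a, x), (b, y), (f, \<phi>)). (a, x) \<in> objects \<and> (b, y) \<in> objects \<and>
          f \<in> Hom B a b \<and> \<phi> \<in> Hom (POb F a) x (FOb (PAr F f) y)},
       Dom = (\<lambda>(s, t, u). s),
       Cod = (\<lambda>(s, t, u). t),
       Id = (\<lambda>(a, x). ((a, x), (a, x), (Id B a, PUnit F a x))),
       Comp = (\<lambda>(t', (c, z), (g, \<psi>)) ((a, x), t, (f, \<phi>)).
          ((a, x), (c, z), (g \<cdot>\<^bsub>B\<^esub> f,
             PComp F f g z \<cdot>\<^bsub>POb F a\<^esub> (FAr (PAr F f) \<psi> \<cdot>\<^bsub>POb F a\<^esub> \<phi>))))\<rparr>)"

definition grothendieck_proj ::
  "('o \<times> 'p, ('o \<times> 'p) \<times> ('o \<times> 'p) \<times> ('m \<times> 'n), 'o, 'm) fun_data" where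
  "grothendieck_proj = \<lparr>FOb = (\<lambda>(a, x). a), FAr = (\<lambda>(s, t, (f, \<phi>)). f)\<rparr>"


section \<open>2-categories\<close>

text \<open>
  A (strict) 2-category is given by its underlying category \<open>Und\<close> of objects and 1-cells, the
  category \<open>Vert\<close> of 1-cells and 2-cells under vertical composition, and the horizontal
  composition of 2-cells.
\<close>

record ('o, 'm, 'c) two_cat_data =
  Und :: "('o, 'm) cat_data"
  Vert :: "('m, 'c) cat_data"
  HComp :: "'c \<Rightarrow> 'c \<Rightarrow> 'c" (infixl "\<star>\<index>" 70)

definition hcat :: "('o, 'm, 'c) two_cat_data \<Rightarrow> 'o \<Rightarrow> 'o \<Rightarrow> ('m, 'c) cat_data" where
  "hcat A x y = (Vert A)\<lparr>Ob := Hom (Und A) x y,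
     Ar := {\<sigma> \<in> Ar (Vert A). Dom (Vert A) \<sigma> \<in> Hom (Und A) x y \<and> Cod (Vert A) \<sigma> \<in> Hom (Und A) x y}\<rparr>"

locale two_category =
  fixes A :: "('o, 'm, 'c) two_cat_data"
  assumes Und_category: "category (Und A)"
    and Vert_category: "category (Vert A)"
    and Ob_Vert: "Ob (Vert A) = Ar (Und A)"
    and globular: "\<sigma> \<in> Ar (Vert A) \<Longrightarrow>
      \<exists>x y. Dom (Vert A) \<sigma> \<in> Hom (Und A) x y \<and> Cod (Vert A) \<sigma> \<in> Hom (Und A) x y"
    and HComp_Hom: "f \<in> Hom (Und A) x y \<Longrightarrow> g \<in> Hom (Und A) y z \<Longrightarrow>
      \<sigma> \<in> Hom (Vert A) f f' \<Longrightarrow> \<tau> \<in> Hom (Vert A) g g' \<Longrightarrow>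
      \<tau> \<star>\<^bsub>A\<^esub> \<sigma> \<in> Hom (Vert A) (g \<cdot>\<^bsub>Und A\<^esub> f) (g' \<cdot>\<^bsub>Und A\<^esub> f')"
    and HComp_Id: "f \<in> Hom (Und A) x y \<Longrightarrow> g \<in> Hom (Und A) y z \<Longrightarrow>
      Id (Vert A) g \<star>\<^bsub>A\<^esub> Id (Vert A) f = Id (Vert A) (g \<cdot>\<^bsub>Und A\<^esub> f)"
    and interchange: "f \<in> Hom (Und A) x y \<Longrightarrow> g \<in> Hom (Und A) y z \<Longrightarrow>
      \<sigma> \<in> Hom (Vert A) f f' \<Longrightarrow> \<sigma>' \<in> Hom (Vert A) f' f'' \<Longrightarrow>
      \<tau> \<in> Hom (Vert A) g g' \<Longrightarrow> \<tau>' \<in> Hom (Vert A) g' g'' \<Longrightarrow>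
      (\<tau>' \<cdot>\<^bsub>Vert A\<^esub> \<tau>) \<star>\<^bsub>A\<^esub> (\<sigma>' \<cdot>\<^bsub>Vert A\<^esub> \<sigma>) = (\<tau>' \<star>\<^bsub>A\<^esub> \<sigma>') \<cdot>\<^bsub>Vert A\<^esub> (\<tau> \<star>\<^bsub>A\<^esub> \<sigma>)"
    and HComp_assoc: "\<rho> \<in> Ar (hcat A x y) \<Longrightarrow> \<sigma> \<in> Ar (hcat A y z) \<Longrightarrow> \<tau> \<in> Ar (hcat A z w) \<Longrightarrow>
      (\<tau> \<star>\<^bsub>A\<^esub> \<sigma>) \<star>\<^bsub>A\<^esub> \<rho> = \<tau> \<star>\<^bsub>A\<^esub> (\<sigma> \<star>\<^bsub>A\<^esub> \<rho>)"
    and HComp_unit_right: "\<sigma> \<in> Ar (hcat A x y) \<Longrightarrow> \<sigma> \<star>\<^bsub>A\<^esub> Id (Vert A) (Id (Und A) x) = \<sigma>"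
    and HComp_unit_left: "\<sigma> \<in> Ar (hcat A x y) \<Longrightarrow> Id (Vert A) (Id (Und A) y) \<star>\<^bsub>A\<^esub> \<sigma> = \<sigma>"

definition strict_initial :: "('o, 'm, 'c) two_cat_data \<Rightarrow> 'o \<Rightarrow> bool" where
  "strict_initial A z \<longleftrightarrow> z \<in> Ob (Und A) \<and>
     (\<forall>x \<in> Ob (Und A). isomorphic_cats (hcat A z x) terminal_cat) \<and>
     (\<forall>a \<in> Ob (Und A). Hom (Und A) a z \<noteq> {} \<longrightarrow> iso_objects (Und A) a z)"

definition whisker_left :: "('o, 'm, 'c) two_cat_data \<Rightarrow> 'm \<Rightarrow> 'c \<Rightarrow> 'c" where
  "whisker_left A p \<pi> = Id (Vert A) p \<star>\<^bsub>A\<^esub> \<pi>"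

definition whisker_right :: "('o, 'm, 'c) two_cat_data \<Rightarrow> 'c \<Rightarrow> 'm \<Rightarrow> 'c" where
  "whisker_right A \<chi> h = \<chi> \<star>\<^bsub>A\<^esub> Id (Vert A) h"

definition lax_comma :: "('o, 'm, 'c) two_cat_data \<Rightarrow> 'o \<Rightarrow> ('m, 'm \<times> 'm \<times> ('m \<times> 'c)) cat_data" where
  "lax_comma A x = \<lparr>Ob = {f \<in> Ar (Und A). Cod (Und A) f = x},
     Ar = {(f, g, (h, \<pi>)). f \<in> Ar (Und A) \<and> Cod (Und A) f = x \<and> g \<in> Ar (Und A) \<and> Cod (Und A) g = x \<and>
        h \<in> Hom (Und A) (Dom (Und A) f) (Dom (Und A) g) \<and> \<pi> \<in> Hom (Vert A) f (g \<cdot>\<^bsub>Und A\<^esub> h)},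
     Dom = (\<lambda>(f, g, u). f),
     Cod = (\<lambda>(f, g, u). g),
     Id = (\<lambda>f. (f, f, (Id (Und A) (Dom (Und A) f), Id (Vert A) f))),
     Comp = (\<lambda>(g', l, (k, \<chi>)) (f, g, (h, \<pi>)).
        (f, l, (k \<cdot>\<^bsub>Und A\<^esub> h, whisker_right A \<chi> h \<cdot>\<^bsub>Vert A\<^esub> \<pi>)))\<rparr>"

definition lax_comma_postcomp :: "('o, 'm, 'c) two_cat_data \<Rightarrow> 'm \<Rightarrow>
    ('m, 'm \<times> 'm \<times> ('m \<times> 'c), 'm, 'm \<times> 'm \<times> ('m \<times> 'c)) fun_data" where
  "lax_comma_postcomp A p = \<lparr>FOb = (\<lambda>f. p \<cdot>\<^bsub>Und A\<^esub> f),
     FAr = (\<lambda>(f, g, (h, \<pi>)). (p \<cdot>\<^bsub>Und A\<^esub> f, p \<cdot>\<^bsub>Und A\<^esub> g, (h, whisker_left A p \<pi>)))\<rparr>"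

text \<open>
  Composition in \<open>A\<close> being strictly associative and unital, the coherence isomorphisms of
  \<open>x \<mapsto> lax_comma A x\<close> are identities.
\<close>

definition lax_comma_pseudofun :: "('o, 'm, 'c) two_cat_data \<Rightarrow>
    ('o, 'm, 'm, 'm \<times> 'm \<times> ('m \<times> 'c)) pseudofun_data" where
  "lax_comma_pseudofun A = \<lparr>POb = lax_comma A, PAr = lax_comma_postcomp A,
     PComp = (\<lambda>q p f. Id (lax_comma A (Cod (Und A) q)) (q \<cdot>\<^bsub>Und A\<^esub> p \<cdot>\<^bsub>Und A\<^esub> f)),
     PUnit = (\<lambda>x f. Id (lax_comma A x) f)\<rparr>"

end

theory Submission
  imports Defs
begin

text \<open>
  Let \<open>P\<close> be the projection and let \<open>z\<close> be a strict initial object. From \<open>z\<close> to any object there is a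
  single 1-cell and a single 2-cell, so a morphism from \<open>z \<rightarrow> x\<close> to any object of the Grothendieck
  construction is determined by its image under \<open>P\<close>, and every image occurs: \<open>x \<mapsto> (z \<rightarrow> x)\<close> is a fully
  faithful left adjoint of \<open>P\<close>. Moreover, a morphism \<open>(p, h, \<pi>)\<close> into an object \<open>f : a \<rightarrow> x\<close> with \<open>a\<close>
  isomorphic to \<open>z\<close> yields a 1-cell \<open>h\<close> into \<open>a\<close>, so by strictness its source is again of this kind:
  the objects with domain isomorphic to \<open>z\<close> form a sieve. Hence \<open>P p\<close>, seen as a morphism between
  objects of the sieve, is the pullback of \<open>p\<close> along the counit of the adjunction at the codomain of
  \<open>p\<close>. Slices over objects of a sieve lie in the sieve, so the claim is an instance of the stability
  of effective descent morphisms under pullback, in a situation where only pullbacks along \<open>p\<close> are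
  known to exist.

  To avoid comparing two Eilenberg-Moore categories, effective descent is first rewritten without any
  choice of adjunction (\<open>effective_descent_iff_elementwise\<close>). For a right adjoint of \<open>p\<^sub>!\<close>, the
  comparison functor is fully faithful iff every pullback of \<open>p\<close> is a quotient of its kernel pair with
  respect to maps over the codomain of \<open>p\<close>. An algebra on \<open>\<gamma> : C \<rightarrow> E\<close>, where \<open>E\<close> is the domain of
  \<open>p\<close>, is by the Yoneda lemma an operation on generalised elements: it takes \<open>e\<close> in \<open>E\<close> and \<open>c\<close> in
  \<open>C\<close> with \<open>p e = p \<gamma> c\<close> to an element \<open>\<xi> e c\<close> of \<open>C\<close> over \<open>e\<close>. It is in the essential image of the
  comparison functor iff \<open>C\<close> is a pullback along \<open>p\<close> of some object over the codomain, in such a way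
  that \<open>\<xi> e c\<close> and \<open>c\<close> have the same image there. All these conditions are equations between arrows of
  the category and unique factorisations in it. They pass along any functor with a fully faithful left
  adjoint whose image is, up to isomorphism, a sieve (\<open>preserves_elementwise_descent\<close>): all test
  objects that occur can be taken in the sieve, where equations and arrows lift uniquely along \<open>P\<close>.
\<close>

section \<open>Calculating with arrows and slice categories\<close>

context category
begin

lemma Id_simps [simp]:
  "a \<in> Ob X \<Longrightarrow> Id X a \<in> Ar X"
  "a \<in> Ob X \<Longrightarrow> Dom X (Id X a) = a"
  "a \<in> Ob X \<Longrightarrow> Cod X (Id X a) = a"
  using Id_Hom by (auto simp: Hom_def)

lemma Comp_simps [simp]:
  assumes "f \<in> Ar X" "g \<in> Ar X" "Cod X f = Dom X g"
  shows "g \<cdot>\<^bsub>X\<^esub> f \<in> Ar X" "Dom X (g \<cdot>\<^bsub>X\<^esub> f) = Dom X f" "Cod X (g \<cdot>\<^bsub>X\<^esub> f) = Cod X g"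
  using Comp_Hom[of f "Dom X f" "Cod X f" g "Cod X g"] assms by (auto simp: Hom_def)

lemma Comp_assoc_simp [simp]:
  assumes "f \<in> Ar X" "g \<in> Ar X" "h \<in> Ar X" "Cod X f = Dom X g" "Cod X g = Dom X h"
  shows "(h \<cdot>\<^bsub>X\<^esub> g) \<cdot>\<^bsub>X\<^esub> f = h \<cdot>\<^bsub>X\<^esub> (g \<cdot>\<^bsub>X\<^esub> f)"
  using Comp_assoc[of f _ _ g _ h] assms by (auto simp: Hom_def)

lemma Comp_Id_simps [simp]:
  "f \<in> Ar X \<Longrightarrow> Dom X f = a \<Longrightarrow> f \<cdot>\<^bsub>X\<^esub> Id X a = f"
  "f \<in> Ar X \<Longrightarrow> Cod X f = b \<Longrightarrow> Id X b \<cdot>\<^bsub>X\<^esub> f = f"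
  using Comp_Id Id_Comp by auto

lemma Ar_Ob [simp]: "f \<in> Ar X \<Longrightarrow> Dom X f \<in> Ob X" "f \<in> Ar X \<Longrightarrow> Cod X f \<in> Ob X"
  using Dom_Ob Cod_Ob by auto

text \<open>
  With composites bracketed to the right, an equation \<open>g f = k\<close> no longer matches inside
  \<open>g (f t)\<close>; this is the form in which it does.
\<close>

lemma Comp_eq_assoc:
  assumes "g \<cdot>\<^bsub>X\<^esub> f = k" "f \<in> Ar X" "g \<in> Ar X" "Cod X f = Dom X g" "t \<in> Ar X" "Cod X t = Dom X f"
  shows "g \<cdot>\<^bsub>X\<^esub> (f \<cdot>\<^bsub>X\<^esub> t) = k \<cdot>\<^bsub>X\<^esub> t"
  using assms(2-) Comp_assoc_simp[of t f g] unfolding assms(1) by simp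

end

lemma Hom_iff: "f \<in> Hom X a b \<longleftrightarrow> f \<in> Ar X \<and> Dom X f = a \<and> Cod X f = b"
  by (simp add: Hom_def)


lemma slice_simps [simp]:
  "f \<in> Ob (slice X b) \<longleftrightarrow> f \<in> Ar X \<and> Cod X f = b"
  "Dom (slice X b) (f, g, h) = f" "Cod (slice X b) (f, g, h) = g"
  "Id (slice X b) f = (f, f, Id X (Dom X f))"
  "(g', l, k) \<cdot>\<^bsub>slice X b\<^esub> (f, g, h) = (f, l, k \<cdot>\<^bsub>X\<^esub> h)"
  by (simp_all add: slice_def Hom_def)

context category
begin

lemma Ar_slice [simp]:
  "(f, g, h) \<in> Ar (slice X b) \<longleftrightarrow>
     g \<in> Ar X \<and> Cod X g = b \<and> h \<in> Ar X \<and> Cod X h = Dom X g \<and> f = g \<cdot>\<^bsub>X\<^esub> h"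
  by (simp add: slice_def Hom_def) (metis Comp_simps)

lemma Hom_slice:
  "u \<in> Hom (slice X b) f g \<longleftrightarrow> (\<exists>h. u = (f, g, h) \<and>
     g \<in> Ar X \<and> Cod X g = b \<and> h \<in> Ar X \<and> Cod X h = Dom X g \<and> f = g \<cdot>\<^bsub>X\<^esub> h)"
  by (cases u) (auto simp: Hom_def)

lemma Hom_sliceI:
  assumes "g \<in> Ar X" "Cod X g = b" "h \<in> Ar X" "Cod X h = Dom X g" "f = g \<cdot>\<^bsub>X\<^esub> h"
  shows "(f, g, h) \<in> Hom (slice X b) f g"
  unfolding Hom_slice using assms by simp

lemma Hom_slice_elim:
  assumes "u \<in> Hom (slice X b) f g"
  obtains h where "u = (f, g, h)" "g \<in> Ar X" "Cod X g = b" "h \<in> Ar X" "Cod X h = Dom X g"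
    "f = g \<cdot>\<^bsub>X\<^esub> h"
  using assms unfolding Hom_slice by blast

lemma category_slice: "category (slice X b)"
proof unfold_locales
  fix f g h u v assume "u \<in> Hom (slice X b) f g" "v \<in> Hom (slice X b) g h"
  then obtain s t where s: "u = (f, g, s)" "s \<in> Ar X" "Cod X s = Dom X g" "f = g \<cdot>\<^bsub>X\<^esub> s"
    and t: "v = (g, h, t)" "h \<in> Ar X" "Cod X h = b" "t \<in> Ar X" "Cod X t = Dom X h" "g = h \<cdot>\<^bsub>X\<^esub> t"
    using Hom_slice_elim by metis
  have "Dom X g = Dom X t" unfolding t(6) using t(2-5) by simp
  then have "Cod X s = Dom X t" using s(3) by simp
  then show "v \<cdot>\<^bsub>slice X b\<^esub> u \<in> Hom (slice X b) f h"
    unfolding Hom_slice s(1,4) t(1,6) using s(2,3) t(2-5) by simp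
next
  fix f g h k u v w
  assume "u \<in> Hom (slice X b) f g" "v \<in> Hom (slice X b) g h" "w \<in> Hom (slice X b) h k"
  then obtain s t r where s: "u = (f, g, s)" "s \<in> Ar X" "Cod X s = Dom X g"
    and t: "v = (g, h, t)" "t \<in> Ar X" "Cod X t = Dom X h" "h \<in> Ar X" "g = h \<cdot>\<^bsub>X\<^esub> t"
    and r: "w = (h, k, r)" "r \<in> Ar X" "Cod X r = Dom X k" "k \<in> Ar X" "h = k \<cdot>\<^bsub>X\<^esub> r"
    using Hom_slice_elim by metis
  have "Dom X g = Dom X t" "Dom X h = Dom X r"
    using t r Comp_simps(2) by metis+
  then show "(w \<cdot>\<^bsub>slice X b\<^esub> v) \<cdot>\<^bsub>slice X b\<^esub> u = w \<cdot>\<^bsub>slice X b\<^esub> (v \<cdot>\<^bsub>slice X b\<^esub> u)"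
    unfolding s(1) t(1) r(1) using s(2,3) t(2,3) r(2,3) by simp
qed (auto simp: Hom_def)

end

section \<open>Opposite categories\<close>

lemma op_cat_simps [simp]:
  "Ob (op_cat X) = Ob X" "Ar (op_cat X) = Ar X" "Dom (op_cat X) = Cod X" "Cod (op_cat X) = Dom X"
  "Id (op_cat X) = Id X" "g \<cdot>\<^bsub>op_cat X\<^esub> f = f \<cdot>\<^bsub>X\<^esub> g"
  by (simp_all add: op_cat_def)

lemma Hom_op: "f \<in> Hom (op_cat X) x y \<longleftrightarrow> f \<in> Hom X y x"
  by (auto simp: Hom_iff)

lemma (in category) category_op: "category (op_cat X)"
proof
  fix f g h a b c d assume "f \<in> Hom (op_cat X) a b" "g \<in> Hom (op_cat X) b c" "h \<in> Hom (op_cat X) c d"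
  then show "(h \<cdot>\<^bsub>op_cat X\<^esub> g) \<cdot>\<^bsub>op_cat X\<^esub> f = h \<cdot>\<^bsub>op_cat X\<^esub> (g \<cdot>\<^bsub>op_cat X\<^esub> f)"
    unfolding Hom_op by (simp add: Comp_assoc)
qed (auto simp: Hom_op Id_Hom Comp_Hom)

section \<open>Equivalences of categories\<close>

definition fully_faithful ::
  "('o, 'm) cat_data \<Rightarrow> ('p, 'n) cat_data \<Rightarrow> ('o, 'm, 'p, 'n) fun_data \<Rightarrow> bool" where
  "fully_faithful C D K \<longleftrightarrow> (\<forall>x \<in> Ob C. \<forall>y \<in> Ob C.
     bij_betw (FAr K) (Hom C x y) (Hom D (FOb K x) (FOb K y)))"

definition essentially_surjective ::
  "('o, 'm) cat_data \<Rightarrow> ('p, 'n) cat_data \<Rightarrow> ('o, 'm, 'p, 'n) fun_data \<Rightarrow> bool" where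
  "essentially_surjective C D K \<longleftrightarrow> (\<forall>d \<in> Ob D. \<exists>x \<in> Ob C. iso_objects D (FOb K x) d)"

lemma iso_arrowI:
  assumes "f \<in> Hom X a b" "g \<in> Hom X b a" "g \<cdot>\<^bsub>X\<^esub> f = Id X a" "f \<cdot>\<^bsub>X\<^esub> g = Id X b"
  shows "iso_arrow X f"
  using assms unfolding iso_arrow_def by (auto simp: Hom_def)

lemma iso_arrowE:
  assumes "iso_arrow X f" "f \<in> Hom X a b"
  obtains g where "g \<in> Hom X b a" "g \<cdot>\<^bsub>X\<^esub> f = Id X a" "f \<cdot>\<^bsub>X\<^esub> g = Id X b"
  using assms unfolding iso_arrow_def by (auto simp: Hom_def)

lemma (in category) iso_arrow_cancel:
  assumes "iso_arrow X i" "f \<in> Hom X a (Dom X i)" "g \<in> Hom X a (Dom X i)"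
    "i \<cdot>\<^bsub>X\<^esub> f = i \<cdot>\<^bsub>X\<^esub> g"
  shows "f = g"
proof -
  obtain j where j: "i \<in> Ar X" "j \<in> Ar X" "Dom X j = Cod X i" "Cod X j = Dom X i"
    "j \<cdot>\<^bsub>X\<^esub> i = Id X (Dom X i)"
    using assms(1) by (auto simp: iso_arrow_def Hom_def)
  have "j \<cdot>\<^bsub>X\<^esub> (i \<cdot>\<^bsub>X\<^esub> f) = f" "j \<cdot>\<^bsub>X\<^esub> (i \<cdot>\<^bsub>X\<^esub> g) = g"
    using j assms(2,3) by (auto simp: Hom_def Comp_eq_assoc[OF j(5)])
  then show ?thesis using assms(4) by metis
qed

text \<open>
  The unit of an equivalence makes the functor faithful. The inverse of the counit makes the
  quasi-inverse faithful, and fullness of the functor follows from that.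
\<close>

lemma faithful_if_nat_iso_id:
  assumes "category C" "is_functor C D F" "nat_iso C C id_fun (comp_fun G F) \<eta>"
    "f \<in> Hom C x y" "g \<in> Hom C x y" "FAr F f = FAr F g"
  shows "f = g"
proof -
  interpret C: category C by fact
  have "y \<in> Ob C" using assms(4) C.Ar_Ob by (auto simp: Hom_def)
  then have *: "\<eta> y \<in> Hom C y (FOb G (FOb F y))" "iso_arrow C (\<eta> y)"
    using assms(3) by (auto simp: nat_iso_def nat_trans_def id_fun_def comp_fun_def)
  have "\<eta> y \<cdot>\<^bsub>C\<^esub> f = \<eta> y \<cdot>\<^bsub>C\<^esub> g"
    using assms(3-6) by (simp add: nat_iso_def nat_trans_def id_fun_def comp_fun_def)
  with * show ?thesis
    using C.iso_arrow_cancel[of "\<eta> y" f x g] assms(4,5) by (simp add: Hom_def)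
qed

lemma nat_iso_inverse:
  assumes "category D" "is_functor C D F" "is_functor C D G" "nat_iso C D F G \<tau>" "category C"
  shows "\<exists>\<sigma>. nat_iso C D G F \<sigma>"
proof -
  interpret D: category D by fact
  interpret C: category C by fact
  have "\<forall>x \<in> Ob C. \<exists>s. s \<in> Hom D (FOb G x) (FOb F x) \<and> s \<cdot>\<^bsub>D\<^esub> \<tau> x = Id D (FOb F x) \<and>
      \<tau> x \<cdot>\<^bsub>D\<^esub> s = Id D (FOb G x)"
    using assms(4) by (fastforce simp: nat_iso_def nat_trans_def iso_arrow_def Hom_def)
  then obtain \<sigma> where \<sigma>: "\<And>x. x \<in> Ob C \<Longrightarrow> \<sigma> x \<in> Hom D (FOb G x) (FOb F x)"
    "\<And>x. x \<in> Ob C \<Longrightarrow> \<sigma> x \<cdot>\<^bsub>D\<^esub> \<tau> x = Id D (FOb F x)"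
    "\<And>x. x \<in> Ob C \<Longrightarrow> \<tau> x \<cdot>\<^bsub>D\<^esub> \<sigma> x = Id D (FOb G x)"
    by metis
  have \<tau>: "\<And>x. x \<in> Ob C \<Longrightarrow> \<tau> x \<in> Hom D (FOb F x) (FOb G x)"
    using assms(4) by (auto simp: nat_iso_def nat_trans_def)
  have "\<sigma> y \<cdot>\<^bsub>D\<^esub> FAr G f = FAr F f \<cdot>\<^bsub>D\<^esub> \<sigma> x" if f: "f \<in> Hom C x y" for f x y
  proof -
    have xy: "x \<in> Ob C" "y \<in> Ob C" using f by (auto simp: Hom_def)
    have nat: "\<tau> y \<cdot>\<^bsub>D\<^esub> FAr F f = FAr G f \<cdot>\<^bsub>D\<^esub> \<tau> x"
      using assms(4) f by (auto simp: nat_iso_def nat_trans_def)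
    note H = \<sigma>(1)[OF xy(1)] \<sigma>(1)[OF xy(2)] \<tau>[OF xy(1)] \<tau>[OF xy(2)]
      is_functor.FAr_Hom[OF assms(2) f] is_functor.FAr_Hom[OF assms(3) f]
    have "\<sigma> y \<cdot>\<^bsub>D\<^esub> FAr G f = \<sigma> y \<cdot>\<^bsub>D\<^esub> (FAr G f \<cdot>\<^bsub>D\<^esub> (\<tau> x \<cdot>\<^bsub>D\<^esub> \<sigma> x))"
      using H \<sigma>(3)[OF xy(1)] by (simp add: Hom_def)
    also have "\<dots> = \<sigma> y \<cdot>\<^bsub>D\<^esub> ((\<tau> y \<cdot>\<^bsub>D\<^esub> FAr F f) \<cdot>\<^bsub>D\<^esub> \<sigma> x)"
      unfolding nat using H by (simp add: Hom_def)
    also have "\<dots> = (\<sigma> y \<cdot>\<^bsub>D\<^esub> \<tau> y) \<cdot>\<^bsub>D\<^esub> (FAr F f \<cdot>\<^bsub>D\<^esub> \<sigma> x)"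
      using H by (simp add: Hom_def)
    also have "\<dots> = FAr F f \<cdot>\<^bsub>D\<^esub> \<sigma> x"
      unfolding \<sigma>(2)[OF xy(2)] using H by (simp add: Hom_def)
    finally show ?thesis .
  qed
  then have "nat_iso C D G F \<sigma>"
    using \<sigma> \<tau> by (fastforce simp: nat_iso_def nat_trans_def iso_arrow_def Hom_def)
  then show ?thesis by blast
qed

lemma is_functor_comp: "is_functor C D F \<Longrightarrow> is_functor D E G \<Longrightarrow> is_functor C E (comp_fun G F)"
  unfolding is_functor_def comp_fun_def by (simp, metis)

lemma is_functor_id: "is_functor C C id_fun"
  by (auto simp: is_functor_def id_fun_def)

lemma fully_faithful_if_equivalence:
  assumes "category C" "category D" "is_equivalence C D K"
  shows "fully_faithful C D K"
proof -
  interpret C: category C by fact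
  interpret D: category D by fact
  obtain L \<eta> \<epsilon> where K: "is_functor C D K" and L: "is_functor D C L"
    and \<eta>: "nat_iso C C id_fun (comp_fun L K) \<eta>" and \<epsilon>: "nat_iso D D (comp_fun K L) id_fun \<epsilon>"
    using assms(3) unfolding is_equivalence_def by blast
  obtain \<epsilon>' where \<epsilon>': "nat_iso D D id_fun (comp_fun K L) \<epsilon>'"
    using nat_iso_inverse[OF assms(2) is_functor_comp[OF L K] is_functor_id \<epsilon> assms(2)] by blast
  show ?thesis unfolding fully_faithful_def
  proof (intro ballI)
    fix x y assume x: "x \<in> Ob C" and y: "y \<in> Ob C"
    have "inj_on (FAr K) (Hom C x y)"
      using faithful_if_nat_iso_id[OF assms(1) K \<eta>] by (auto intro!: inj_onI)
    moreover have "FAr K ` Hom C x y = Hom D (FOb K x) (FOb K y)"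
    proof
      show "FAr K ` Hom C x y \<subseteq> Hom D (FOb K x) (FOb K y)"
        using is_functor.FAr_Hom[OF K] by blast
    next
      show "Hom D (FOb K x) (FOb K y) \<subseteq> FAr K ` Hom C x y"
      proof
        fix h assume h: "h \<in> Hom D (FOb K x) (FOb K y)"
        have \<eta>x: "\<eta> x \<in> Hom C x (FOb L (FOb K x))" and \<eta>y: "\<eta> y \<in> Hom C y (FOb L (FOb K y))"
          and iso: "iso_arrow C (\<eta> y)" "iso_arrow C (\<eta> x)"
          using \<eta> x y by (auto simp: nat_iso_def nat_trans_def id_fun_def comp_fun_def)
        obtain j where j: "j \<in> Hom C (FOb L (FOb K y)) y" "\<eta> y \<cdot>\<^bsub>C\<^esub> j = Id C (FOb L (FOb K y))"
          using iso(1) \<eta>y by (auto simp: iso_arrow_def Hom_def)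
        obtain i where i: "i \<in> Hom C (FOb L (FOb K x)) x" "\<eta> x \<cdot>\<^bsub>C\<^esub> i = Id C (FOb L (FOb K x))"
          using iso(2) \<eta>x by (auto simp: iso_arrow_def Hom_def)
        have Lh: "FAr L h \<in> Hom C (FOb L (FOb K x)) (FOb L (FOb K y))"
          using is_functor.FAr_Hom[OF L h] .
        \<comment> \<open>The inverse of the unit at \<open>y\<close> carries the image of \<open>h\<close> back to a map \<open>x \<rightarrow> y\<close>;
          that \<open>K f = h\<close> is seen after applying the quasi-inverse, which is faithful.\<close>
        define f where "f = j \<cdot>\<^bsub>C\<^esub> (FAr L h \<cdot>\<^bsub>C\<^esub> \<eta> x)"
        have f: "f \<in> Hom C x y" unfolding f_def using j(1) Lh \<eta>x by (simp add: Hom_def)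
        have "FAr L (FAr K f) \<cdot>\<^bsub>C\<^esub> \<eta> x = \<eta> y \<cdot>\<^bsub>C\<^esub> f"
          using \<eta> f by (simp add: nat_iso_def nat_trans_def id_fun_def comp_fun_def)
        also have "\<dots> = FAr L h \<cdot>\<^bsub>C\<^esub> \<eta> x"
          unfolding f_def using j(1) Lh \<eta>x \<eta>y C.Comp_eq_assoc[OF j(2)] by (simp add: Hom_def)
        finally have eq: "FAr L (FAr K f) \<cdot>\<^bsub>C\<^esub> \<eta> x = FAr L h \<cdot>\<^bsub>C\<^esub> \<eta> x" .
        have Kf: "FAr K f \<in> Hom D (FOb K x) (FOb K y)" using is_functor.FAr_Hom[OF K f] .
        then have LKf: "FAr L (FAr K f) \<in> Hom C (FOb L (FOb K x)) (FOb L (FOb K y))"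
          by (rule is_functor.FAr_Hom[OF L])
        have "FAr L (FAr K f) = (FAr L (FAr K f) \<cdot>\<^bsub>C\<^esub> \<eta> x) \<cdot>\<^bsub>C\<^esub> i"
          using LKf i \<eta>x by (simp add: Hom_def)
        also have "\<dots> = FAr L h"
          unfolding eq using Lh i \<eta>x by (simp add: Hom_def)
        finally have "FAr K f = h"
          using faithful_if_nat_iso_id[OF assms(2) L \<epsilon>' Kf h] by simp
        then show "h \<in> FAr K ` Hom C x y" using f by blast
      qed
    qed
    ultimately show "bij_betw (FAr K) (Hom C x y) (Hom D (FOb K x) (FOb K y))"
      by (simp add: bij_betw_def)
  qed
qed

lemma essentially_surjective_if_equivalence:
  assumes "is_equivalence C D K"
  shows "essentially_surjective C D K"
  unfolding essentially_surjective_def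
proof
  fix d assume d: "d \<in> Ob D"
  obtain L \<epsilon> where K: "is_functor C D K" and L: "is_functor D C L"
    and \<epsilon>: "nat_iso D D (comp_fun K L) id_fun \<epsilon>"
    using assms unfolding is_equivalence_def by blast
  have "FOb L d \<in> Ob C" using d is_functor.FOb_Ob[OF L] by blast
  moreover have "FOb K (FOb L d) \<in> Ob D" using calculation is_functor.FOb_Ob[OF K] by blast
  moreover have "\<epsilon> d \<in> Hom D (FOb K (FOb L d)) d" "iso_arrow D (\<epsilon> d)"
    using \<epsilon> d by (auto simp: nat_iso_def nat_trans_def id_fun_def comp_fun_def)
  ultimately show "\<exists>x \<in> Ob C. iso_objects D (FOb K x) d"
    using d by (auto simp: iso_objects_def)
qed

text \<open>
  The quasi-inverse picks for each \<open>d\<close> an object \<open>L0 d\<close> with mutually inverse arrows \<open>e d\<close> and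
  \<open>e' d\<close> between \<open>K (L0 d)\<close> and \<open>d\<close>; on arrows it is conjugation by these, pulled back along the
  bijections on hom-sets. All equations are checked after applying the faithful \<open>K\<close>.
\<close>

lemma equivalence_if_fully_faithful_essentially_surjective:
  assumes "category C" "category D" "is_functor C D K"
    "fully_faithful C D K" "essentially_surjective C D K"
  shows "is_equivalence C D K"
proof -
  interpret C: category C by fact
  interpret D: category D by fact
  interpret K: is_functor C D K by fact
  have "\<forall>d \<in> Ob D. \<exists>x e e'. x \<in> Ob C \<and> e \<in> Hom D (FOb K x) d \<and> e' \<in> Hom D d (FOb K x) \<and>
      e' \<cdot>\<^bsub>D\<^esub> e = Id D (FOb K x) \<and> e \<cdot>\<^bsub>D\<^esub> e' = Id D d"
    using assms(5) unfolding essentially_surjective_def iso_objects_def iso_arrow_def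
    by (fastforce simp: Hom_def)
  then obtain L0 e e' where L0: "\<And>d. d \<in> Ob D \<Longrightarrow> L0 d \<in> Ob C"
    and e: "\<And>d. d \<in> Ob D \<Longrightarrow> e d \<in> Hom D (FOb K (L0 d)) d"
    and e': "\<And>d. d \<in> Ob D \<Longrightarrow> e' d \<in> Hom D d (FOb K (L0 d))"
    and e'e: "\<And>d. d \<in> Ob D \<Longrightarrow> e' d \<cdot>\<^bsub>D\<^esub> e d = Id D (FOb K (L0 d))"
    and ee': "\<And>d. d \<in> Ob D \<Longrightarrow> e d \<cdot>\<^bsub>D\<^esub> e' d = Id D d"
    by metis
  have inj: "f = g" if "f \<in> Hom C x y" "g \<in> Hom C x y" "FAr K f = FAr K g" for f g x y
  proof -
    have "x \<in> Ob C" "y \<in> Ob C" using that(1) by (auto simp: Hom_def)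
    then have "inj_on (FAr K) (Hom C x y)"
      using assms(4) by (simp add: fully_faithful_def bij_betw_def)
    then show ?thesis using that by (simp add: inj_on_def)
  qed
  have ex: "\<exists>f \<in> Hom C x y. FAr K f = h"
    if "x \<in> Ob C" "y \<in> Ob C" "h \<in> Hom D (FOb K x) (FOb K y)" for x y h
  proof -
    have "FAr K ` Hom C x y = Hom D (FOb K x) (FOb K y)"
      using assms(4) that(1,2) by (simp add: fully_faithful_def bij_betw_def)
    then have "h \<in> FAr K ` Hom C x y" using that(3) by simp
    then show ?thesis by blast
  qed
  define pre where "pre x y h = (SOME f. f \<in> Hom C x y \<and> FAr K f = h)" for x y h
  have pre: "pre x y h \<in> Hom C x y" "FAr K (pre x y h) = h"
    if "x \<in> Ob C" "y \<in> Ob C" "h \<in> Hom D (FOb K x) (FOb K y)" for x y h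
    using someI_ex[of "\<lambda>f. f \<in> Hom C x y \<and> FAr K f = h"] ex[OF that]
    unfolding pre_def by blast+
  define L where "L = \<lparr>FOb = L0, FAr = (\<lambda>h. pre (L0 (Dom D h)) (L0 (Cod D h))
      (e' (Cod D h) \<cdot>\<^bsub>D\<^esub> (h \<cdot>\<^bsub>D\<^esub> e (Dom D h))))\<rparr>"
  have L_Ob: "FOb L = L0" by (simp add: L_def)
  have conj: "e' b \<cdot>\<^bsub>D\<^esub> (h \<cdot>\<^bsub>D\<^esub> e a) \<in> Hom D (FOb K (L0 a)) (FOb K (L0 b))"
    if "h \<in> Hom D a b" for a b h
  proof -
    have "a \<in> Ob D" "b \<in> Ob D" using that by (auto simp: Hom_def)
    then show ?thesis using that e[of a] e'[of b] by (simp add: Hom_def)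
  qed
  have L_Hom: "FAr L h \<in> Hom C (L0 a) (L0 b)"
    and KL: "FAr K (FAr L h) = e' b \<cdot>\<^bsub>D\<^esub> (h \<cdot>\<^bsub>D\<^esub> e a)" if h: "h \<in> Hom D a b" for a b h
  proof -
    have "a \<in> Ob D" "b \<in> Ob D" using h by (auto simp: Hom_def)
    then show "FAr L h \<in> Hom C (L0 a) (L0 b)" "FAr K (FAr L h) = e' b \<cdot>\<^bsub>D\<^esub> (h \<cdot>\<^bsub>D\<^esub> e a)"
      using pre[OF L0 L0 conj[OF h]] h by (auto simp: L_def Hom_def)
  qed
  have L: "is_functor D C L"
  proof
    fix x assume "x \<in> Ob D" then show "FOb L x \<in> Ob C" by (simp add: L_Ob L0)
  next
    fix f x y assume "f \<in> Hom D x y"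
    then show "FAr L f \<in> Hom C (FOb L x) (FOb L y)" using L_Hom by (simp add: L_Ob)
  next
    fix x assume x: "x \<in> Ob D"
    have "FAr K (FAr L (Id D x)) = Id D (FOb K (L0 x))"
      using KL[OF D.Id_Hom[OF x]] e[OF x] e'[OF x] e'e[OF x] by (simp add: Hom_def)
    also have "\<dots> = FAr K (Id C (L0 x))" using K.FAr_Id L0[OF x] by simp
    finally show "FAr L (Id D x) = Id C (FOb L x)"
      using inj[OF L_Hom[OF D.Id_Hom[OF x]] C.Id_Hom[OF L0[OF x]]] by (simp add: L_Ob)
  next
    fix f x y g z assume f: "f \<in> Hom D x y" and g: "g \<in> Hom D y z"
    have ob: "x \<in> Ob D" "y \<in> Ob D" "z \<in> Ob D" using f g by (auto simp: Hom_def)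
    note E = e[OF ob(1)] e[OF ob(2)] e'[OF ob(2)] e'[OF ob(3)]
    have "FAr K (FAr L g \<cdot>\<^bsub>C\<^esub> FAr L f) = FAr K (FAr L g) \<cdot>\<^bsub>D\<^esub> FAr K (FAr L f)"
      using K.FAr_Comp[OF L_Hom[OF f] L_Hom[OF g]] .
    also have "\<dots> = (e' z \<cdot>\<^bsub>D\<^esub> (g \<cdot>\<^bsub>D\<^esub> e y)) \<cdot>\<^bsub>D\<^esub> (e' y \<cdot>\<^bsub>D\<^esub> (f \<cdot>\<^bsub>D\<^esub> e x))"
      by (simp add: KL[OF f] KL[OF g])
    also have "\<dots> = e' z \<cdot>\<^bsub>D\<^esub> (g \<cdot>\<^bsub>D\<^esub> (f \<cdot>\<^bsub>D\<^esub> e x))"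
      using E f g D.Comp_eq_assoc[OF ee'[OF ob(2)]] by (simp add: Hom_def)
    also have "\<dots> = FAr K (FAr L (g \<cdot>\<^bsub>D\<^esub> f))"
      using KL[OF D.Comp_Hom[OF f g]] E f g by (simp add: Hom_def)
    finally show "FAr L (g \<cdot>\<^bsub>D\<^esub> f) = FAr L g \<cdot>\<^bsub>C\<^esub> FAr L f"
      using inj[OF L_Hom[OF D.Comp_Hom[OF f g]] C.Comp_Hom[OF L_Hom[OF f] L_Hom[OF g]]] by simp
  qed
  have \<epsilon>: "nat_iso D D (comp_fun K L) id_fun e"
    unfolding nat_iso_def nat_trans_def
  proof (intro conjI ballI allI)
    fix x assume x: "x \<in> Ob D"
    show "e x \<in> Hom D (FOb (comp_fun K L) x) (FOb id_fun x)"
      using e[OF x] by (simp add: comp_fun_def id_fun_def L_Ob)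
    show "iso_arrow D (e x)" unfolding iso_arrow_def
      using e[OF x] e'[OF x] e'e[OF x] ee'[OF x] by (auto simp: Hom_def)
  next
    fix x y f assume f: "f \<in> Hom D x y"
    then have ob: "x \<in> Ob D" "y \<in> Ob D" by (auto simp: Hom_def)
    show "e y \<cdot>\<^bsub>D\<^esub> FAr (comp_fun K L) f = FAr id_fun f \<cdot>\<^bsub>D\<^esub> e x"
      using e[OF ob(1)] e[OF ob(2)] e'[OF ob(2)] f D.Comp_eq_assoc[OF ee'[OF ob(2)]] KL[OF f]
      by (simp add: comp_fun_def id_fun_def Hom_def)
  qed
  define \<eta> where "\<eta> x = pre x (L0 (FOb K x)) (e' (FOb K x))" for x
  have \<eta>H: "\<eta> x \<in> Hom C x (L0 (FOb K x))" and K\<eta>: "FAr K (\<eta> x) = e' (FOb K x)"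
    if "x \<in> Ob C" for x
    using pre[OF that L0[OF K.FOb_Ob[OF that]] e'[OF K.FOb_Ob[OF that]]] unfolding \<eta>_def by auto
  have \<eta>: "nat_iso C C id_fun (comp_fun L K) \<eta>"
    unfolding nat_iso_def nat_trans_def
  proof (intro conjI ballI allI)
    fix x assume x: "x \<in> Ob C"
    have Kx: "FOb K x \<in> Ob D" using K.FOb_Ob[OF x] .
    show "\<eta> x \<in> Hom C (FOb id_fun x) (FOb (comp_fun L K) x)"
      using \<eta>H[OF x] by (simp add: comp_fun_def id_fun_def L_Ob)
    define \<theta> where "\<theta> = pre (L0 (FOb K x)) x (e (FOb K x))"
    have \<theta>: "\<theta> \<in> Hom C (L0 (FOb K x)) x" "FAr K \<theta> = e (FOb K x)"
      using pre[OF L0[OF Kx] x e[OF Kx]] unfolding \<theta>_def by auto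
    have "FAr K (\<theta> \<cdot>\<^bsub>C\<^esub> \<eta> x) = FAr K (Id C x)"
      using K.FAr_Comp[OF \<eta>H[OF x] \<theta>(1)] \<theta>(2) K\<eta>[OF x] ee'[OF Kx] K.FAr_Id[OF x] by simp
    then have 1: "\<theta> \<cdot>\<^bsub>C\<^esub> \<eta> x = Id C x"
      using inj C.Comp_Hom[OF \<eta>H[OF x] \<theta>(1)] C.Id_Hom[OF x] by blast
    have "FAr K (\<eta> x \<cdot>\<^bsub>C\<^esub> \<theta>) = FAr K (Id C (L0 (FOb K x)))"
      using K.FAr_Comp[OF \<theta>(1) \<eta>H[OF x]] \<theta>(2) K\<eta>[OF x] e'e[OF Kx] K.FAr_Id[OF L0[OF Kx]] by simp
    then have "\<eta> x \<cdot>\<^bsub>C\<^esub> \<theta> = Id C (L0 (FOb K x))"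
      using inj C.Comp_Hom[OF \<theta>(1) \<eta>H[OF x]] C.Id_Hom[OF L0[OF Kx]] by blast
    with 1 show "iso_arrow C (\<eta> x)" unfolding iso_arrow_def
      using \<theta>(1) \<eta>H[OF x] by (auto simp: Hom_def)
  next
    fix x y f assume f: "f \<in> Hom C x y"
    then have ob: "x \<in> Ob C" "y \<in> Ob C" by (auto simp: Hom_def)
    note Kob = K.FOb_Ob[OF ob(1)] K.FOb_Ob[OF ob(2)]
    note Kf = K.FAr_Hom[OF f]
    have "FAr K (\<eta> y \<cdot>\<^bsub>C\<^esub> f) = e' (FOb K y) \<cdot>\<^bsub>D\<^esub> FAr K f"
      using K.FAr_Comp[OF f \<eta>H[OF ob(2)]] K\<eta>[OF ob(2)] by simp
    also have "\<dots> = (e' (FOb K y) \<cdot>\<^bsub>D\<^esub> (FAr K f \<cdot>\<^bsub>D\<^esub> e (FOb K x))) \<cdot>\<^bsub>D\<^esub> e' (FOb K x)"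
      using e[OF Kob(1)] e'[OF Kob(1)] e'[OF Kob(2)] Kf ee'[OF Kob(1)] by (simp add: Hom_def)
    also have "\<dots> = FAr K (FAr L (FAr K f)) \<cdot>\<^bsub>D\<^esub> FAr K (\<eta> x)"
      using KL[OF Kf] K\<eta>[OF ob(1)] by simp
    also have "\<dots> = FAr K (FAr L (FAr K f) \<cdot>\<^bsub>C\<^esub> \<eta> x)"
      using K.FAr_Comp[OF \<eta>H[OF ob(1)] L_Hom[OF Kf]] by simp
    finally show "\<eta> y \<cdot>\<^bsub>C\<^esub> FAr id_fun f = FAr (comp_fun L K) f \<cdot>\<^bsub>C\<^esub> \<eta> x"
      using inj[OF C.Comp_Hom[OF f \<eta>H[OF ob(2)]] C.Comp_Hom[OF \<eta>H[OF ob(1)] L_Hom[OF Kf]]]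
      by (simp add: comp_fun_def id_fun_def)
  qed
  show ?thesis unfolding is_equivalence_def using assms(3) L \<eta> \<epsilon> by blast
qed

section \<open>Algebras and the comparison functor\<close>

lemma em_cat_simps [simp]:
  "(x, \<alpha>) \<in> Ob (em_cat C T) \<longleftrightarrow> x \<in> Ob C \<and> \<alpha> \<in> Hom C (FOb (Endo T) x) x \<and>
     \<alpha> \<cdot>\<^bsub>C\<^esub> Unit T x = Id C x \<and> \<alpha> \<cdot>\<^bsub>C\<^esub> FAr (Endo T) \<alpha> = \<alpha> \<cdot>\<^bsub>C\<^esub> Mult T x"
  "(a, b, h) \<in> Ar (em_cat C T) \<longleftrightarrow> a \<in> Ob (em_cat C T) \<and> b \<in> Ob (em_cat C T) \<and>
     h \<in> Hom C (fst a) (fst b) \<and> h \<cdot>\<^bsub>C\<^esub> snd a = snd b \<cdot>\<^bsub>C\<^esub> FAr (Endo T) h"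
  "Dom (em_cat C T) (a, b, h) = a" "Cod (em_cat C T) (a, b, h) = b"
  "Id (em_cat C T) a = (a, a, Id C (fst a))"
  "(b', c, k) \<cdot>\<^bsub>em_cat C T\<^esub> (a, b, h) = (a, c, k \<cdot>\<^bsub>C\<^esub> h)"
  by (auto simp: em_cat_def Let_def case_prod_beta)

lemma Hom_em_cat:
  "u \<in> Hom (em_cat C T) a b \<longleftrightarrow> (\<exists>h. u = (a, b, h) \<and> a \<in> Ob (em_cat C T) \<and> b \<in> Ob (em_cat C T) \<and>
     h \<in> Hom C (fst a) (fst b) \<and> h \<cdot>\<^bsub>C\<^esub> snd a = snd b \<cdot>\<^bsub>C\<^esub> FAr (Endo T) h)"
  by (cases u) (auto simp: Hom_iff)

lemma category_em_cat:
  assumes "category C" "is_functor C C (Endo T)"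
  shows "category (em_cat C T)"
proof -
  interpret C: category C by fact
  interpret T: is_functor C C "Endo T" by fact
  show ?thesis
  proof
    fix u assume "u \<in> Ar (em_cat C T)"
    then show "Dom (em_cat C T) u \<in> Ob (em_cat C T)" "Cod (em_cat C T) u \<in> Ob (em_cat C T)"
      by (cases u; simp del: em_cat_simps(1))+
  next
    fix a assume a: "a \<in> Ob (em_cat C T)"
    obtain x \<alpha> where x: "a = (x, \<alpha>)" by (cases a)
    have "Id C x \<cdot>\<^bsub>C\<^esub> \<alpha> = \<alpha> \<cdot>\<^bsub>C\<^esub> FAr (Endo T) (Id C x)" "Id C x \<in> Hom C x x"
      using a T.FAr_Id[of x] by (simp_all add: x Hom_def)
    then show "Id (em_cat C T) a \<in> Hom (em_cat C T) a a"
      unfolding Hom_em_cat using a by (simp add: x)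
  next
    fix u v a b c assume u: "u \<in> Hom (em_cat C T) a b" and v: "v \<in> Hom (em_cat C T) b c"
    obtain h where h: "u = (a, b, h)" "h \<in> Hom C (fst a) (fst b)"
      "h \<cdot>\<^bsub>C\<^esub> snd a = snd b \<cdot>\<^bsub>C\<^esub> FAr (Endo T) h" and ob: "a \<in> Ob (em_cat C T)" "b \<in> Ob (em_cat C T)"
      using u unfolding Hom_em_cat by blast
    obtain k where k: "v = (b, c, k)" "k \<in> Hom C (fst b) (fst c)"
      "k \<cdot>\<^bsub>C\<^esub> snd b = snd c \<cdot>\<^bsub>C\<^esub> FAr (Endo T) k" and ob': "c \<in> Ob (em_cat C T)"
      using v unfolding Hom_em_cat by blast
    have str: "snd a \<in> Hom C (FOb (Endo T) (fst a)) (fst a)"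
      "snd b \<in> Hom C (FOb (Endo T) (fst b)) (fst b)" "snd c \<in> Hom C (FOb (Endo T) (fst c)) (fst c)"
      using ob ob' by (cases a, cases b, cases c, simp)+
    note Th = T.FAr_Hom[OF h(2)] and Tk = T.FAr_Hom[OF k(2)]
    have "(k \<cdot>\<^bsub>C\<^esub> h) \<cdot>\<^bsub>C\<^esub> snd a = k \<cdot>\<^bsub>C\<^esub> (snd b \<cdot>\<^bsub>C\<^esub> FAr (Endo T) h)"
      using C.Comp_assoc[OF str(1) h(2) k(2)] h(3) by simp
    also have "\<dots> = (snd c \<cdot>\<^bsub>C\<^esub> FAr (Endo T) k) \<cdot>\<^bsub>C\<^esub> FAr (Endo T) h"
      using C.Comp_assoc[OF Th str(2) k(2)] k(3) by simp
    also have "\<dots> = snd c \<cdot>\<^bsub>C\<^esub> FAr (Endo T) (k \<cdot>\<^bsub>C\<^esub> h)"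
      using C.Comp_assoc[OF Th Tk str(3)] T.FAr_Comp[OF h(2) k(2)] by simp
    finally show "v \<cdot>\<^bsub>em_cat C T\<^esub> u \<in> Hom (em_cat C T) a c"
      unfolding Hom_em_cat using ob ob' C.Comp_Hom[OF h(2) k(2)]
      by (simp del: em_cat_simps(1) add: h(1) k(1))
  next
    fix u assume "u \<in> Ar (em_cat C T)"
    then show "u \<cdot>\<^bsub>em_cat C T\<^esub> Id (em_cat C T) (Dom (em_cat C T) u) = u"
      "Id (em_cat C T) (Cod (em_cat C T) u) \<cdot>\<^bsub>em_cat C T\<^esub> u = u"
      by (cases u; simp del: em_cat_simps(1) add: Hom_def)+
  next
    fix u v w a b c d
    assume "u \<in> Hom (em_cat C T) a b" "v \<in> Hom (em_cat C T) b c" "w \<in> Hom (em_cat C T) c d"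
    then obtain f g h where "u = (a, b, f)" "v = (b, c, g)" "w = (c, d, h)"
      "f \<in> Hom C (fst a) (fst b)" "g \<in> Hom C (fst b) (fst c)" "h \<in> Hom C (fst c) (fst d)"
      unfolding Hom_em_cat by blast
    then show "(w \<cdot>\<^bsub>em_cat C T\<^esub> v) \<cdot>\<^bsub>em_cat C T\<^esub> u = w \<cdot>\<^bsub>em_cat C T\<^esub> (v \<cdot>\<^bsub>em_cat C T\<^esub> u)"
      using C.Comp_assoc by (simp del: em_cat_simps(1))
  qed
qed

lemma comparison_fun_simps [simp]:
  "FOb (comparison_fun D G \<epsilon>) y = (FOb G y, FAr G (\<epsilon> y))"
  "FAr (comparison_fun D G \<epsilon>) h = ((FOb G (Dom D h), FAr G (\<epsilon> (Dom D h))),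
     (FOb G (Cod D h), FAr G (\<epsilon> (Cod D h))), FAr G h)"
  by (simp_all add: comparison_fun_def Let_def)

text \<open>
  The structure map of \<open>G y\<close> is \<open>G (\<epsilon> y)\<close>: its unit law is a triangle identity, while associativity
  and compatibility with arrows are both \<open>G\<close> applied to naturality of \<open>\<epsilon>\<close>.
\<close>

lemma is_functor_comparison:
  assumes "category C" "category D" "adjunction C D F G \<eta> \<epsilon>"
  shows "is_functor D (em_cat C (induced_monad F G \<eta> \<epsilon>)) (comparison_fun D G \<epsilon>)"
    (is "is_functor D ?E ?K")
proof -
  interpret C: category C by fact
  interpret D: category D by fact
  interpret F: is_functor C D F using assms(3) by (simp add: adjunction_def)
  interpret G: is_functor D C G using assms(3) by (simp add: adjunction_def)
  have \<epsilon>: "\<epsilon> y \<in> Hom D (FOb F (FOb G y)) y" if "y \<in> Ob D" for y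
    using assms(3) that by (simp add: adjunction_def nat_trans_def comp_fun_def id_fun_def)
  have G\<epsilon>: "FAr G f \<cdot>\<^bsub>C\<^esub> FAr G (\<epsilon> x) = FAr G (\<epsilon> y) \<cdot>\<^bsub>C\<^esub> FAr G (FAr F (FAr G f))"
    if f: "f \<in> Hom D x y" for f x y
  proof -
    have xy: "x \<in> Ob D" "y \<in> Ob D" using f by (auto simp: Hom_iff)
    have "\<epsilon> y \<cdot>\<^bsub>D\<^esub> FAr F (FAr G f) = f \<cdot>\<^bsub>D\<^esub> \<epsilon> x"
      using assms(3) f by (simp add: adjunction_def nat_trans_def comp_fun_def id_fun_def)
    then show ?thesis
      using G.FAr_Comp[OF F.FAr_Hom[OF G.FAr_Hom[OF f]] \<epsilon>[OF xy(2)]] G.FAr_Comp[OF \<epsilon>[OF xy(1)] f]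
      by simp
  qed
  have Ob: "FOb ?K y \<in> Ob ?E" if y: "y \<in> Ob D" for y
    using G.FOb_Ob[OF y] G.FAr_Hom[OF \<epsilon>[OF y]] G\<epsilon>[OF \<epsilon>[OF y]] assms(3) y
    by (simp add: induced_monad_def comp_fun_def adjunction_def)
  show ?thesis
  proof
    show "FOb ?K y \<in> Ob ?E" if "y \<in> Ob D" for y using Ob[OF that] .
  next
    fix f x y assume f: "f \<in> Hom D x y"
    then have xy: "x \<in> Ob D" "y \<in> Ob D" "Dom D f = x" "Cod D f = y" by (auto simp: Hom_iff)
    show "FAr ?K f \<in> Hom ?E (FOb ?K x) (FOb ?K y)"
      unfolding Hom_em_cat using Ob[OF xy(1)] Ob[OF xy(2)] G.FAr_Hom[OF f] G\<epsilon>[OF f] xy(3,4)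
      by (simp del: em_cat_simps(1) add: induced_monad_def comp_fun_def)
  next
    fix x assume "x \<in> Ob D"
    then show "FAr ?K (Id D x) = Id ?E (FOb ?K x)" by (simp add: G.FAr_Id)
  next
    fix f g x y z assume f: "f \<in> Hom D x y" and g: "g \<in> Hom D y z"
    show "FAr ?K (g \<cdot>\<^bsub>D\<^esub> f) = FAr ?K g \<cdot>\<^bsub>?E\<^esub> FAr ?K f"
      using f g D.Comp_Hom[OF f g] G.FAr_Comp[OF f g] by (simp add: Hom_iff)
  qed
qed

lemma is_functor_induced_monad:
  assumes "adjunction C D F G \<eta> \<epsilon>"
  shows "is_functor C C (Endo (induced_monad F G \<eta> \<epsilon>))"
  using assms is_functor_comp by (fastforce simp: adjunction_def induced_monad_def)

section \<open>Base change along a morphism\<close>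

lemma slice_postcomp_simps [simp]:
  "FOb (slice_postcomp X p) f = p \<cdot>\<^bsub>X\<^esub> f"
  "FAr (slice_postcomp X p) (f, g, h) = (p \<cdot>\<^bsub>X\<^esub> f, p \<cdot>\<^bsub>X\<^esub> g, h)"
  by (simp_all add: slice_postcomp_def)

text \<open>
  An arbitrary right adjoint \<open>G\<close> of \<open>p\<^sub>!\<close>. Arrows of slices are triples that repeat their source and
  target; the definitions in the locale extract the arrows of \<open>X\<close> underlying counit, functor and unit.
  Writing \<open>E \<times> D\<close> for the pullback of \<open>g : D \<rightarrow> B\<close> along \<open>p : E \<rightarrow> B\<close>, the projections are
  \<open>pb g : E \<times> D \<rightarrow> E\<close> and \<open>pr g : E \<times> D \<rightarrow> D\<close>, the arrow \<open>pm f g h\<close> is \<open>E \<times> h\<close>, and \<open>un u\<close> is the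
  section \<open>c \<mapsto> (u c, c)\<close>.
\<close>

locale base_change = category X for X :: "('o, 'm) cat_data" +
  fixes p :: 'm and G :: "('m, 'm \<times> 'm \<times> 'm, 'm, 'm \<times> 'm \<times> 'm) fun_data"
    and \<eta> :: "'m \<Rightarrow> 'm \<times> 'm \<times> 'm" and \<epsilon> :: "'m \<Rightarrow> 'm \<times> 'm \<times> 'm"
  assumes p_Ar [simp]: "p \<in> Ar X"
    and adj: "adjunction (slice X (Dom X p)) (slice X (Cod X p)) (slice_postcomp X p) G \<eta> \<epsilon>"
begin

abbreviation "pb \<equiv> FOb G"
definition "pr g = snd (snd (\<epsilon> g))"
definition "pm f g h = snd (snd (FAr G (f, g, h)))"
definition "un u = snd (snd (\<eta> u))"

sublocale G: is_functor "slice X (Cod X p)" "slice X (Dom X p)" G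
  using adj by (simp add: adjunction_def)

lemma pb_Ar [simp]:
  assumes "g \<in> Ar X" "Cod X g = Cod X p"
  shows "pb g \<in> Ar X" "Cod X (pb g) = Dom X p"
  using G.FOb_Ob[of g] assms by auto

lemma pr_props:
  assumes "g \<in> Ar X" "Cod X g = Cod X p"
  shows pr_Ar [simp]: "pr g \<in> Ar X" and Cod_pr [simp]: "Cod X (pr g) = Dom X g"
    and counit_eq: "\<epsilon> g = (p \<cdot>\<^bsub>X\<^esub> pb g, g, pr g)" and square: "g \<cdot>\<^bsub>X\<^esub> pr g = p \<cdot>\<^bsub>X\<^esub> pb g"
proof -
  have "\<epsilon> g \<in> Hom (slice X (Cod X p)) (p \<cdot>\<^bsub>X\<^esub> pb g) g"
    using adj assms by (simp add: adjunction_def nat_trans_def comp_fun_def id_fun_def)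
  then show "pr g \<in> Ar X" "Cod X (pr g) = Dom X g" "\<epsilon> g = (p \<cdot>\<^bsub>X\<^esub> pb g, g, pr g)"
    "g \<cdot>\<^bsub>X\<^esub> pr g = p \<cdot>\<^bsub>X\<^esub> pb g"
    by (auto simp: Hom_slice pr_def)
qed

lemma Dom_pr [simp]:
  assumes "g \<in> Ar X" "Cod X g = Cod X p"
  shows "Dom X (pr g) = Dom X (pb g)"
  using pr_props[OF assms] pb_Ar[OF assms] assms by (metis Comp_simps(2) p_Ar)

lemma pm_props:
  assumes "g \<in> Ar X" "Cod X g = Cod X p" "h \<in> Ar X" "Cod X h = Dom X g" "f = g \<cdot>\<^bsub>X\<^esub> h"
  shows "pm f g h \<in> Hom X (Dom X (pb f)) (Dom X (pb g))"
    and "pb g \<cdot>\<^bsub>X\<^esub> pm f g h = pb f" and "FAr G (f, g, h) = (pb f, pb g, pm f g h)"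
    and "pr g \<cdot>\<^bsub>X\<^esub> pm f g h = h \<cdot>\<^bsub>X\<^esub> pr f"
proof -
  have u: "(f, g, h) \<in> Hom (slice X (Cod X p)) f g"
    using assms by (auto simp: Hom_slice)
  have f: "f \<in> Ar X" "Cod X f = Cod X p" "Dom X f = Dom X h" using assms by simp_all
  from G.FAr_Hom[OF u] obtain k where k: "FAr G (f, g, h) = (pb f, pb g, k)" "k \<in> Ar X"
    "Cod X k = Dom X (pb g)" "pb f = pb g \<cdot>\<^bsub>X\<^esub> k"
    by (auto simp: Hom_slice)
  then have "pm f g h = k" by (simp add: pm_def)
  then show "pm f g h \<in> Hom X (Dom X (pb f)) (Dom X (pb g))"
    "pb g \<cdot>\<^bsub>X\<^esub> pm f g h = pb f" "FAr G (f, g, h) = (pb f, pb g, pm f g h)"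
    using k assms(1,2) by (simp_all add: Hom_iff)
  have "\<epsilon> g \<cdot>\<^bsub>slice X (Cod X p)\<^esub> FAr (slice_postcomp X p) (FAr G (f, g, h)) =
    (f, g, h) \<cdot>\<^bsub>slice X (Cod X p)\<^esub> \<epsilon> f"
    using adj u by (simp add: adjunction_def nat_trans_def comp_fun_def id_fun_def)
  then show "pr g \<cdot>\<^bsub>X\<^esub> pm f g h = h \<cdot>\<^bsub>X\<^esub> pr f"
    using k assms(1,2) f \<open>pm f g h = k\<close> by (simp add: counit_eq)
qed

lemma un_props:
  assumes "u \<in> Ar X" "Cod X u = Dom X p"
  shows "un u \<in> Hom X (Dom X u) (Dom X (pb (p \<cdot>\<^bsub>X\<^esub> u)))"
    and "pb (p \<cdot>\<^bsub>X\<^esub> u) \<cdot>\<^bsub>X\<^esub> un u = u" and "\<eta> u = (u, pb (p \<cdot>\<^bsub>X\<^esub> u), un u)"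
    and "pr (p \<cdot>\<^bsub>X\<^esub> u) \<cdot>\<^bsub>X\<^esub> un u = Id X (Dom X u)"
proof -
  have pu: "p \<cdot>\<^bsub>X\<^esub> u \<in> Ar X" "Cod X (p \<cdot>\<^bsub>X\<^esub> u) = Cod X p" using assms by simp_all
  have "\<eta> u \<in> Hom (slice X (Dom X p)) u (pb (p \<cdot>\<^bsub>X\<^esub> u))"
    using adj assms by (simp add: adjunction_def nat_trans_def comp_fun_def id_fun_def)
  then obtain n where n: "\<eta> u = (u, pb (p \<cdot>\<^bsub>X\<^esub> u), n)" "n \<in> Ar X"
    "Cod X n = Dom X (pb (p \<cdot>\<^bsub>X\<^esub> u))" "u = pb (p \<cdot>\<^bsub>X\<^esub> u) \<cdot>\<^bsub>X\<^esub> n"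
    by (auto simp: Hom_slice)
  then have un_n: "un u = n" by (simp add: un_def)
  have "Dom X u = Dom X n" using n(2,3) pb_Ar[OF pu] by (subst n(4)) simp
  then show "un u \<in> Hom X (Dom X u) (Dom X (pb (p \<cdot>\<^bsub>X\<^esub> u)))"
    "pb (p \<cdot>\<^bsub>X\<^esub> u) \<cdot>\<^bsub>X\<^esub> un u = u" "\<eta> u = (u, pb (p \<cdot>\<^bsub>X\<^esub> u), un u)"
    using n un_n by (simp_all add: Hom_iff)
  have "\<epsilon> (p \<cdot>\<^bsub>X\<^esub> u) \<cdot>\<^bsub>slice X (Cod X p)\<^esub> FAr (slice_postcomp X p) (\<eta> u)
      = Id (slice X (Cod X p)) (p \<cdot>\<^bsub>X\<^esub> u)"
    using adj assms by (simp add: adjunction_def)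
  then show "pr (p \<cdot>\<^bsub>X\<^esub> u) \<cdot>\<^bsub>X\<^esub> un u = Id X (Dom X u)"
    using n un_n assms by (simp add: counit_eq[OF pu])
qed

text \<open>
  A commutative square with vertex \<open>w\<close> is an arrow \<open>p\<^sub>! u \<rightarrow> g\<close> of the slice, and its transpose
  \<open>G v \<cdot> \<eta> u\<close> is the induced arrow into the pullback. Uniqueness is the other half of the bijection
  of hom-sets given by the adjunction, spelled out through naturality of \<open>\<eta>\<close> and a triangle identity.
\<close>

lemma pb_is_pullback:
  assumes g: "g \<in> Ar X" "Cod X g = Cod X p"
  shows "is_pullback X p g (pr g) (pb g)"
proof -
  have "\<exists>!t. t \<in> Hom X w (Dom X (pr g)) \<and> pb g \<cdot>\<^bsub>X\<^esub> t = u \<and> pr g \<cdot>\<^bsub>X\<^esub> t = v"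
    if u: "u \<in> Hom X w (Dom X p)" and v: "v \<in> Hom X w (Dom X g)" and eq: "p \<cdot>\<^bsub>X\<^esub> u = g \<cdot>\<^bsub>X\<^esub> v"
    for w u v
  proof -
    have uv: "u \<in> Ar X" "Dom X u = w" "Cod X u = Dom X p" "v \<in> Ar X" "Dom X v = w" "Cod X v = Dom X g"
      using u v by (auto simp: Hom_iff)
    have pu: "p \<cdot>\<^bsub>X\<^esub> u \<in> Ar X" "Cod X (p \<cdot>\<^bsub>X\<^esub> u) = Cod X p" "Dom X (p \<cdot>\<^bsub>X\<^esub> u) = w" using uv by simp_all
    note m = pm_props[OF g uv(4,6) eq] and n = un_props[OF uv(1,3)]
    define t where "t = pm (p \<cdot>\<^bsub>X\<^esub> u) g v \<cdot>\<^bsub>X\<^esub> un u"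
    note arr = m(1)[unfolded Hom_iff] n(1)[unfolded Hom_iff]
    show ?thesis
    proof (rule ex1I[of _ t], intro conjI)
      show "t \<in> Hom X w (Dom X (pr g))"
        using arr uv g by (simp add: t_def Hom_iff)
      show "pb g \<cdot>\<^bsub>X\<^esub> t = u"
        unfolding t_def using arr g n(2) by (simp add: Comp_eq_assoc[OF m(2)])
      show "pr g \<cdot>\<^bsub>X\<^esub> t = v"
        unfolding t_def using arr g n(4) uv pu by (simp add: Comp_eq_assoc[OF m(4)])
    next
      fix s assume s: "s \<in> Hom X w (Dom X (pr g)) \<and> pb g \<cdot>\<^bsub>X\<^esub> s = u \<and> pr g \<cdot>\<^bsub>X\<^esub> s = v"
      then have sA: "s \<in> Ar X" "Dom X s = w" "Cod X s = Dom X (pb g)" using g by (auto simp: Hom_iff)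
      have s': "(u, pb g, s) \<in> Hom (slice X (Dom X p)) u (pb g)"
        using s sA g by (auto simp: Hom_slice)
      have pg: "p \<cdot>\<^bsub>X\<^esub> pb g \<in> Ar X" "Cod X (p \<cdot>\<^bsub>X\<^esub> pb g) = Cod X p" "Dom X (p \<cdot>\<^bsub>X\<^esub> pb g) = Dom X (pb g)"
        using g by simp_all
      have ps: "p \<cdot>\<^bsub>X\<^esub> u = (p \<cdot>\<^bsub>X\<^esub> pb g) \<cdot>\<^bsub>X\<^esub> s" using s sA g by simp
      have Ps: "(p \<cdot>\<^bsub>X\<^esub> u, p \<cdot>\<^bsub>X\<^esub> pb g, s) \<in> Hom (slice X (Cod X p)) (p \<cdot>\<^bsub>X\<^esub> u) (p \<cdot>\<^bsub>X\<^esub> pb g)"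
        using Hom_sliceI[OF pg(1,2) sA(1) _ ps] pg(3) sA(3) by simp
      have E: "(p \<cdot>\<^bsub>X\<^esub> pb g, g, pr g) \<in> Hom (slice X (Cod X p)) (p \<cdot>\<^bsub>X\<^esub> pb g) g"
        using Hom_sliceI[OF g pr_Ar[OF g] Cod_pr[OF g] square[OF g, symmetric]] .
      have "FAr G (\<epsilon> g) \<cdot>\<^bsub>slice X (Dom X p)\<^esub> \<eta> (pb g) = Id (slice X (Dom X p)) (pb g)"
        using adj g by (simp add: adjunction_def)
      then have tri: "pm (p \<cdot>\<^bsub>X\<^esub> pb g) g (pr g) \<cdot>\<^bsub>X\<^esub> un (pb g) = Id X (Dom X (pb g))"
        using pm_props(3)[OF g, of "pr g"] g square[OF g] un_props(3)[of "pb g"] counit_eq[OF g] by simp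
      have "\<eta> (pb g) \<cdot>\<^bsub>slice X (Dom X p)\<^esub> (u, pb g, s) =
          FAr G (p \<cdot>\<^bsub>X\<^esub> u, p \<cdot>\<^bsub>X\<^esub> pb g, s) \<cdot>\<^bsub>slice X (Dom X p)\<^esub> \<eta> u"
        using adj s' by (simp add: adjunction_def nat_trans_def comp_fun_def id_fun_def)
      then have nat: "un (pb g) \<cdot>\<^bsub>X\<^esub> s = pm (p \<cdot>\<^bsub>X\<^esub> u) (p \<cdot>\<^bsub>X\<^esub> pb g) s \<cdot>\<^bsub>X\<^esub> un u"
        using un_props(3)[of "pb g"] n(3) pm_props(3)[OF pg(1,2) sA(1) _ ps] sA(3) pg g by simp
      have "FAr G (p \<cdot>\<^bsub>X\<^esub> u, g, v) = FAr G (p \<cdot>\<^bsub>X\<^esub> pb g, g, pr g) \<cdot>\<^bsub>slice X (Dom X p)\<^esub>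
          FAr G (p \<cdot>\<^bsub>X\<^esub> u, p \<cdot>\<^bsub>X\<^esub> pb g, s)"
        using G.FAr_Comp[OF Ps E] s by simp
      then have mm: "pm (p \<cdot>\<^bsub>X\<^esub> u) g v = pm (p \<cdot>\<^bsub>X\<^esub> pb g) g (pr g) \<cdot>\<^bsub>X\<^esub> pm (p \<cdot>\<^bsub>X\<^esub> u) (p \<cdot>\<^bsub>X\<^esub> pb g) s"
        using m(3) pm_props(3)[OF pg(1,2) sA(1) _ ps] pm_props(3)[OF g, of "pr g"] square[OF g] sA pg g by simp
      note M1 = pm_props(1)[OF g pr_Ar[OF g] Cod_pr[OF g] square[OF g, symmetric], unfolded Hom_iff]
      note M2 = pm_props(1)[OF pg(1,2) sA(1) _ ps, unfolded Hom_iff]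
      have N: "un (pb g) \<in> Ar X" "Dom X (un (pb g)) = Dom X (pb g)"
        "Cod X (un (pb g)) = Dom X (pb (p \<cdot>\<^bsub>X\<^esub> pb g))"
        using un_props(1)[of "pb g"] g by (simp_all add: Hom_iff)
      have "t = pm (p \<cdot>\<^bsub>X\<^esub> pb g) g (pr g) \<cdot>\<^bsub>X\<^esub> (un (pb g) \<cdot>\<^bsub>X\<^esub> s)"
        unfolding t_def mm nat using M1 M2 arr sA pg by simp
      also have "\<dots> = s"
        using M1 N sA by (simp add: Comp_eq_assoc[OF tri])
      finally show "s = t" by simp
    qed
  qed
  then show ?thesis unfolding is_pullback_def using g square[OF g] by simp
qed

end

section \<open>Descent conditions on generalised elements\<close>

text \<open>
  Equality of the two composites of \<open>h\<close> with the kernel pair of \<open>q\<close>, in terms of the generalised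
  elements of the kernel pair, which need not exist as an object.
\<close>

definition kernel_invariant :: "('o, 'm) cat_data \<Rightarrow> 'm \<Rightarrow> 'm \<Rightarrow> bool" where
  "kernel_invariant X q h \<longleftrightarrow> (\<forall>w. \<forall>u \<in> Hom X w (Dom X q). \<forall>v \<in> Hom X w (Dom X q).
     q \<cdot>\<^bsub>X\<^esub> u = q \<cdot>\<^bsub>X\<^esub> v \<longrightarrow> h \<cdot>\<^bsub>X\<^esub> u = h \<cdot>\<^bsub>X\<^esub> v)"

text \<open>
  For \<open>q\<close> over \<open>g\<close>, this says that \<open>q\<close> is the coequaliser of its kernel pair in the slice over the
  codomain of \<open>g\<close>.
\<close>

definition quotient_over :: "('o, 'm) cat_data \<Rightarrow> 'm \<Rightarrow> 'm \<Rightarrow> bool" where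
  "quotient_over X g q \<longleftrightarrow> (\<forall>g' h. g' \<in> Ar X \<and> Cod X g' = Cod X g \<and> h \<in> Hom X (Dom X q) (Dom X g') \<and>
     g' \<cdot>\<^bsub>X\<^esub> h = g \<cdot>\<^bsub>X\<^esub> q \<and>
     kernel_invariant X q h \<longrightarrow>
     (\<exists>!k. k \<in> Hom X (Dom X g) (Dom X g') \<and> g' \<cdot>\<^bsub>X\<^esub> k = g \<and> k \<cdot>\<^bsub>X\<^esub> q = h))"

text \<open>
  Descent data with respect to \<open>p : E \<rightarrow> B\<close> on \<open>\<gamma> : C \<rightarrow> E\<close>, as an action on generalised elements:
  \<open>\<xi> e c\<close> moves \<open>c\<close> from the fibre over \<open>\<gamma> c\<close> to the fibre over \<open>e\<close>, naturally in the stage of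
  definition, without effect if \<open>e = \<gamma> c\<close>, and so that moving twice is the same as moving once.
  By the Yoneda lemma this is an algebra structure \<open>E \<times> C \<rightarrow> C\<close> once the pullback exists.
\<close>

definition descent_datum :: "('o, 'm) cat_data \<Rightarrow> 'm \<Rightarrow> 'm \<Rightarrow> ('m \<Rightarrow> 'm \<Rightarrow> 'm) \<Rightarrow> bool" where
  "descent_datum X p \<gamma> \<xi> \<longleftrightarrow> \<gamma> \<in> Ar X \<and> Cod X \<gamma> = Dom X p \<and>
     (\<forall>c \<in> Ar X. Cod X c = Dom X \<gamma> \<longrightarrow> \<xi> (\<gamma> \<cdot>\<^bsub>X\<^esub> c) c = c) \<and>
     (\<forall>e \<in> Ar X. \<forall>c \<in> Ar X. Cod X e = Dom X p \<and> Cod X c = Dom X \<gamma> \<and> p \<cdot>\<^bsub>X\<^esub> e = (p \<cdot>\<^bsub>X\<^esub> \<gamma>) \<cdot>\<^bsub>X\<^esub> c \<longrightarrow>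
        \<xi> e c \<in> Hom X (Dom X e) (Dom X \<gamma>) \<and> \<gamma> \<cdot>\<^bsub>X\<^esub> \<xi> e c = e \<and>
        (\<forall>t \<in> Ar X. Cod X t = Dom X e \<longrightarrow> \<xi> (e \<cdot>\<^bsub>X\<^esub> t) (c \<cdot>\<^bsub>X\<^esub> t) = \<xi> e c \<cdot>\<^bsub>X\<^esub> t) \<and>
        (\<forall>e' \<in> Ar X. Cod X e' = Dom X p \<and> p \<cdot>\<^bsub>X\<^esub> e' = p \<cdot>\<^bsub>X\<^esub> e \<longrightarrow> \<xi> e' (\<xi> e c) = \<xi> e' c))"

lemma descent_datumD:
  assumes "descent_datum X p \<gamma> \<xi>" "e \<in> Ar X" "c \<in> Ar X" "Cod X e = Dom X p" "Cod X c = Dom X \<gamma>"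
    "p \<cdot>\<^bsub>X\<^esub> e = (p \<cdot>\<^bsub>X\<^esub> \<gamma>) \<cdot>\<^bsub>X\<^esub> c"
  shows "\<xi> e c \<in> Hom X (Dom X e) (Dom X \<gamma>)" "\<gamma> \<cdot>\<^bsub>X\<^esub> \<xi> e c = e"
    "t \<in> Ar X \<Longrightarrow> Cod X t = Dom X e \<Longrightarrow> \<xi> (e \<cdot>\<^bsub>X\<^esub> t) (c \<cdot>\<^bsub>X\<^esub> t) = \<xi> e c \<cdot>\<^bsub>X\<^esub> t"
    "e' \<in> Ar X \<Longrightarrow> Cod X e' = Dom X p \<Longrightarrow> p \<cdot>\<^bsub>X\<^esub> e' = p \<cdot>\<^bsub>X\<^esub> e \<Longrightarrow> \<xi> e' (\<xi> e c) = \<xi> e' c"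
  using assms unfolding descent_datum_def by blast+

lemma descent_datum_unit:
  "descent_datum X p \<gamma> \<xi> \<Longrightarrow> c \<in> Ar X \<Longrightarrow> Cod X c = Dom X \<gamma> \<Longrightarrow> \<xi> (\<gamma> \<cdot>\<^bsub>X\<^esub> c) c = c"
  unfolding descent_datum_def by blast

text \<open>
  The datum comes from \<open>g : D \<rightarrow> B\<close>: with \<open>C\<close> identified with \<open>E \<times> D\<close>, the equation on \<open>\<kappa>\<close> says that
  \<open>\<xi> e (e', d) = (e, d)\<close>, the canonical action on a pullback.
\<close>

definition effective_datum :: "('o, 'm) cat_data \<Rightarrow> 'm \<Rightarrow> 'm \<Rightarrow> ('m \<Rightarrow> 'm \<Rightarrow> 'm) \<Rightarrow> bool" where
  "effective_datum X p \<gamma> \<xi> \<longleftrightarrow> (\<exists>g \<kappa>. is_pullback X p g \<kappa> \<gamma> \<and>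
     (\<forall>e \<in> Ar X. \<forall>c \<in> Ar X. Cod X e = Dom X p \<and> Cod X c = Dom X \<gamma> \<and> p \<cdot>\<^bsub>X\<^esub> e = (p \<cdot>\<^bsub>X\<^esub> \<gamma>) \<cdot>\<^bsub>X\<^esub> c \<longrightarrow>
        \<kappa> \<cdot>\<^bsub>X\<^esub> \<xi> e c = \<kappa> \<cdot>\<^bsub>X\<^esub> c))"

definition elementwise_descent :: "('o, 'm) cat_data \<Rightarrow> 'm \<Rightarrow> bool" where
  "elementwise_descent X p \<longleftrightarrow> p \<in> Ar X \<and>
     (\<forall>g \<in> Ar X. Cod X g = Cod X p \<longrightarrow> (\<exists>p' g'. is_pullback X p g p' g' \<and> quotient_over X g p')) \<and>
     (\<forall>\<gamma> \<xi>. descent_datum X p \<gamma> \<xi> \<longrightarrow> effective_datum X p \<gamma> \<xi>)"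

context category
begin

lemma pullback_arrows:
  assumes "is_pullback X p g p' g'"
  shows "p \<in> Ar X" "g \<in> Ar X" "p' \<in> Ar X" "g' \<in> Ar X" "Dom X g' = Dom X p'" "Cod X g' = Dom X p"
    "Cod X p' = Dom X g" "p \<cdot>\<^bsub>X\<^esub> g' = g \<cdot>\<^bsub>X\<^esub> p'" "Cod X p = Cod X g"
  using assms by (simp_all add: is_pullback_def)

lemma pullback_eqI:
  assumes "is_pullback X p g p' g'" "s \<in> Ar X" "t \<in> Ar X" "Cod X s = Dom X p'" "Cod X t = Dom X p'"
    "g' \<cdot>\<^bsub>X\<^esub> s = g' \<cdot>\<^bsub>X\<^esub> t" "p' \<cdot>\<^bsub>X\<^esub> s = p' \<cdot>\<^bsub>X\<^esub> t"
  shows "s = t"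
proof -
  note P = pullback_arrows[OF assms(1)]
  have "Dom X s = Dom X t" using assms P Comp_simps(2) by metis
  moreover have "p \<cdot>\<^bsub>X\<^esub> (g' \<cdot>\<^bsub>X\<^esub> s) = g \<cdot>\<^bsub>X\<^esub> (p' \<cdot>\<^bsub>X\<^esub> s)"
    using P assms(2,4) Comp_assoc_simp by metis
  moreover have "g' \<cdot>\<^bsub>X\<^esub> s \<in> Hom X (Dom X s) (Dom X p)" "p' \<cdot>\<^bsub>X\<^esub> s \<in> Hom X (Dom X s) (Dom X g)"
    using P assms(2,4) by (simp_all add: Hom_iff)
  ultimately have "\<exists>!r. r \<in> Hom X (Dom X s) (Dom X p') \<and> g' \<cdot>\<^bsub>X\<^esub> r = g' \<cdot>\<^bsub>X\<^esub> s \<and> p' \<cdot>\<^bsub>X\<^esub> r = p' \<cdot>\<^bsub>X\<^esub> s"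
    using assms(1) unfolding is_pullback_def by blast
  moreover have "s \<in> Hom X (Dom X s) (Dom X p')" "t \<in> Hom X (Dom X s) (Dom X p')"
    using assms(2-5) \<open>Dom X s = Dom X t\<close> by (simp_all add: Hom_iff)
  ultimately show ?thesis using assms(6,7) by metis
qed

lemma pullback_pair:
  assumes "is_pullback X p g p' g'" "u \<in> Ar X" "v \<in> Ar X" "Cod X u = Dom X p" "Cod X v = Dom X g"
    "p \<cdot>\<^bsub>X\<^esub> u = g \<cdot>\<^bsub>X\<^esub> v"
  obtains t where "t \<in> Ar X" "Dom X t = Dom X u" "Cod X t = Dom X p'"
    "g' \<cdot>\<^bsub>X\<^esub> t = u" "p' \<cdot>\<^bsub>X\<^esub> t = v"
proof -
  have "Dom X v = Dom X u"
    using assms Comp_simps(2) unfolding is_pullback_def by metis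
  then have "u \<in> Hom X (Dom X u) (Dom X p)" "v \<in> Hom X (Dom X u) (Dom X g)"
    using assms by (simp_all add: Hom_iff)
  then show ?thesis
    using assms(1,6) that unfolding is_pullback_def by (metis (no_types, lifting) Hom_iff)
qed

lemma is_pullback_iso:
  assumes "is_pullback X p g p' g'" and i: "i \<in> Ar X" "Cod X i = Dom X p'"
    and j: "j \<in> Hom X (Dom X p') (Dom X i)" "i \<cdot>\<^bsub>X\<^esub> j = Id X (Dom X p')" "j \<cdot>\<^bsub>X\<^esub> i = Id X (Dom X i)"
  shows "is_pullback X p g (p' \<cdot>\<^bsub>X\<^esub> i) (g' \<cdot>\<^bsub>X\<^esub> i)"
proof -
  note P = pullback_arrows[OF assms(1)]
  have J: "j \<in> Ar X" "Dom X j = Dom X p'" "Cod X j = Dom X i" using j by (auto simp: Hom_iff)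
  have "\<exists>!t. t \<in> Hom X w (Dom X (p' \<cdot>\<^bsub>X\<^esub> i)) \<and> (g' \<cdot>\<^bsub>X\<^esub> i) \<cdot>\<^bsub>X\<^esub> t = u \<and> (p' \<cdot>\<^bsub>X\<^esub> i) \<cdot>\<^bsub>X\<^esub> t = v"
    if u: "u \<in> Hom X w (Dom X p)" and v: "v \<in> Hom X w (Dom X g)" and eq: "p \<cdot>\<^bsub>X\<^esub> u = g \<cdot>\<^bsub>X\<^esub> v" for w u v
  proof -
    obtain t where t: "t \<in> Ar X" "Dom X t = Dom X u" "Cod X t = Dom X p'" "g' \<cdot>\<^bsub>X\<^esub> t = u" "p' \<cdot>\<^bsub>X\<^esub> t = v"
      using pullback_pair[OF assms(1)] u v eq by (metis Hom_iff)
    show ?thesis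
    proof (rule ex1I[of _ "j \<cdot>\<^bsub>X\<^esub> t"], intro conjI)
      show "j \<cdot>\<^bsub>X\<^esub> t \<in> Hom X w (Dom X (p' \<cdot>\<^bsub>X\<^esub> i))" using J t u P i by (simp add: Hom_iff)
      have "i \<cdot>\<^bsub>X\<^esub> (j \<cdot>\<^bsub>X\<^esub> t) = t" using J t i by (simp add: Comp_eq_assoc[OF j(2)])
      then show "(g' \<cdot>\<^bsub>X\<^esub> i) \<cdot>\<^bsub>X\<^esub> (j \<cdot>\<^bsub>X\<^esub> t) = u" "(p' \<cdot>\<^bsub>X\<^esub> i) \<cdot>\<^bsub>X\<^esub> (j \<cdot>\<^bsub>X\<^esub> t) = v"
        using J t i P by simp_all
    next
      fix s assume s: "s \<in> Hom X w (Dom X (p' \<cdot>\<^bsub>X\<^esub> i)) \<and> (g' \<cdot>\<^bsub>X\<^esub> i) \<cdot>\<^bsub>X\<^esub> s = u \<and> (p' \<cdot>\<^bsub>X\<^esub> i) \<cdot>\<^bsub>X\<^esub> s = v"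
      then have sA: "s \<in> Ar X" "Cod X s = Dom X i" using P i by (auto simp: Hom_iff)
      have "i \<cdot>\<^bsub>X\<^esub> s = t"
      proof (rule pullback_eqI[OF assms(1)])
        show "g' \<cdot>\<^bsub>X\<^esub> (i \<cdot>\<^bsub>X\<^esub> s) = g' \<cdot>\<^bsub>X\<^esub> t" "p' \<cdot>\<^bsub>X\<^esub> (i \<cdot>\<^bsub>X\<^esub> s) = p' \<cdot>\<^bsub>X\<^esub> t"
          using s sA i P t(4,5) by simp_all
      qed (use sA i t in simp_all)
      then have "j \<cdot>\<^bsub>X\<^esub> (i \<cdot>\<^bsub>X\<^esub> s) = j \<cdot>\<^bsub>X\<^esub> t" by simp
      then show "s = j \<cdot>\<^bsub>X\<^esub> t" using sA i J by (simp add: Comp_eq_assoc[OF j(3)])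
    qed
  qed
  moreover have "p \<cdot>\<^bsub>X\<^esub> (g' \<cdot>\<^bsub>X\<^esub> i) = g \<cdot>\<^bsub>X\<^esub> (p' \<cdot>\<^bsub>X\<^esub> i)"
    using P i Comp_assoc_simp by metis
  ultimately show ?thesis unfolding is_pullback_def using P i by simp
qed

end

section \<open>The comparison functor of a base change\<close>

context base_change
begin

lemma pb_eqI:
  assumes "g \<in> Ar X" "Cod X g = Cod X p" "s \<in> Ar X" "t \<in> Ar X"
    "Cod X s = Dom X (pb g)" "Cod X t = Dom X (pb g)"
    "pb g \<cdot>\<^bsub>X\<^esub> s = pb g \<cdot>\<^bsub>X\<^esub> t" "pr g \<cdot>\<^bsub>X\<^esub> s = pr g \<cdot>\<^bsub>X\<^esub> t"
  shows "s = t"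
  using pullback_eqI[OF pb_is_pullback[OF assms(1,2)] assms(3,4)] assms by simp

definition "pair g u v = (SOME t. t \<in> Ar X \<and> Dom X t = Dom X u \<and> Cod X t = Dom X (pb g) \<and>
  pb g \<cdot>\<^bsub>X\<^esub> t = u \<and> pr g \<cdot>\<^bsub>X\<^esub> t = v)"

lemma pair_props:
  assumes "g \<in> Ar X" "Cod X g = Cod X p" "u \<in> Ar X" "v \<in> Ar X" "Cod X u = Dom X p"
    "Cod X v = Dom X g" "p \<cdot>\<^bsub>X\<^esub> u = g \<cdot>\<^bsub>X\<^esub> v"
  shows "pair g u v \<in> Ar X" "Dom X (pair g u v) = Dom X u" "Cod X (pair g u v) = Dom X (pb g)"
    "pb g \<cdot>\<^bsub>X\<^esub> pair g u v = u" "pr g \<cdot>\<^bsub>X\<^esub> pair g u v = v"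
proof -
  obtain t where "t \<in> Ar X" "Dom X t = Dom X u" "Cod X t = Dom X (pb g)"
    "pb g \<cdot>\<^bsub>X\<^esub> t = u" "pr g \<cdot>\<^bsub>X\<^esub> t = v"
    using pullback_pair[OF pb_is_pullback[OF assms(1,2)] assms(3-7)] assms(1,2) Dom_pr by metis
  then have "\<exists>t. t \<in> Ar X \<and> Dom X t = Dom X u \<and> Cod X t = Dom X (pb g) \<and>
    pb g \<cdot>\<^bsub>X\<^esub> t = u \<and> pr g \<cdot>\<^bsub>X\<^esub> t = v" by blast
  from someI_ex[OF this, folded pair_def]
  show "pair g u v \<in> Ar X" "Dom X (pair g u v) = Dom X u" "Cod X (pair g u v) = Dom X (pb g)"
    "pb g \<cdot>\<^bsub>X\<^esub> pair g u v = u" "pr g \<cdot>\<^bsub>X\<^esub> pair g u v = v" by simp_all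
qed

abbreviation "EM \<equiv> em_cat (slice X (Dom X p)) (induced_monad (slice_postcomp X p) G \<eta> \<epsilon>)"
abbreviation "K \<equiv> comparison_fun (slice X (Cod X p)) G \<epsilon>"

text \<open>
  The structure map of the algebra \<open>K g\<close>; on generalised elements it is
  \<open>(e, (e', d)) \<mapsto> (e, d)\<close>.
\<close>

definition "str g = pm (p \<cdot>\<^bsub>X\<^esub> pb g) g (pr g)"

lemma str_props:
  assumes "g \<in> Ar X" "Cod X g = Cod X p"
  shows "str g \<in> Ar X" "Dom X (str g) = Dom X (pb (p \<cdot>\<^bsub>X\<^esub> pb g))" "Cod X (str g) = Dom X (pb g)"
    "pb g \<cdot>\<^bsub>X\<^esub> str g = pb (p \<cdot>\<^bsub>X\<^esub> pb g)" "pr g \<cdot>\<^bsub>X\<^esub> str g = pr g \<cdot>\<^bsub>X\<^esub> pr (p \<cdot>\<^bsub>X\<^esub> pb g)"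
    "FAr G (\<epsilon> g) = (pb (p \<cdot>\<^bsub>X\<^esub> pb g), pb g, str g)"
  using pm_props[OF assms pr_Ar[OF assms] Cod_pr[OF assms] square[OF assms, symmetric]]
  unfolding str_def[symmetric] counit_eq[OF assms] by (simp_all add: Hom_iff)

lemma K_Ob: "g \<in> Ar X \<Longrightarrow> Cod X g = Cod X p \<Longrightarrow> FOb K g = (pb g, (pb (p \<cdot>\<^bsub>X\<^esub> pb g), pb g, str g))"
  by (simp add: str_props)

text \<open>The action on arrows of the monad induced on the slice over the domain of \<open>p\<close>.\<close>

lemma pm_postcomp_props:
  assumes "\<delta> \<in> Ar X" "Cod X \<delta> = Dom X p" "t \<in> Ar X" "Cod X t = Dom X \<delta>" "\<gamma> = \<delta> \<cdot>\<^bsub>X\<^esub> t"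
  shows "pm (p \<cdot>\<^bsub>X\<^esub> \<gamma>) (p \<cdot>\<^bsub>X\<^esub> \<delta>) t \<in> Ar X"
    "Dom X (pm (p \<cdot>\<^bsub>X\<^esub> \<gamma>) (p \<cdot>\<^bsub>X\<^esub> \<delta>) t) = Dom X (pb (p \<cdot>\<^bsub>X\<^esub> \<gamma>))"
    "Cod X (pm (p \<cdot>\<^bsub>X\<^esub> \<gamma>) (p \<cdot>\<^bsub>X\<^esub> \<delta>) t) = Dom X (pb (p \<cdot>\<^bsub>X\<^esub> \<delta>))"
    "pb (p \<cdot>\<^bsub>X\<^esub> \<delta>) \<cdot>\<^bsub>X\<^esub> pm (p \<cdot>\<^bsub>X\<^esub> \<gamma>) (p \<cdot>\<^bsub>X\<^esub> \<delta>) t = pb (p \<cdot>\<^bsub>X\<^esub> \<gamma>)"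
    "pr (p \<cdot>\<^bsub>X\<^esub> \<delta>) \<cdot>\<^bsub>X\<^esub> pm (p \<cdot>\<^bsub>X\<^esub> \<gamma>) (p \<cdot>\<^bsub>X\<^esub> \<delta>) t = t \<cdot>\<^bsub>X\<^esub> pr (p \<cdot>\<^bsub>X\<^esub> \<gamma>)"
    "FAr G (p \<cdot>\<^bsub>X\<^esub> \<gamma>, p \<cdot>\<^bsub>X\<^esub> \<delta>, t) = (pb (p \<cdot>\<^bsub>X\<^esub> \<gamma>), pb (p \<cdot>\<^bsub>X\<^esub> \<delta>), pm (p \<cdot>\<^bsub>X\<^esub> \<gamma>) (p \<cdot>\<^bsub>X\<^esub> \<delta>) t)"
  using pm_props[of "p \<cdot>\<^bsub>X\<^esub> \<delta>" t "p \<cdot>\<^bsub>X\<^esub> \<gamma>"] assms by (simp_all add: Hom_iff)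

text \<open>
  Eilenberg-Moore algebras stripped of the redundant sources and targets of arrows in slices:
  \<open>a\<close> is the structure map \<open>E \<times> C \<rightarrow> C\<close>.
\<close>

definition "algebra \<gamma> a \<longleftrightarrow> \<gamma> \<in> Ar X \<and> Cod X \<gamma> = Dom X p \<and>
  a \<in> Hom X (Dom X (pb (p \<cdot>\<^bsub>X\<^esub> \<gamma>))) (Dom X \<gamma>) \<and> \<gamma> \<cdot>\<^bsub>X\<^esub> a = pb (p \<cdot>\<^bsub>X\<^esub> \<gamma>) \<and>
  a \<cdot>\<^bsub>X\<^esub> un \<gamma> = Id X (Dom X \<gamma>) \<and>
  a \<cdot>\<^bsub>X\<^esub> pm (p \<cdot>\<^bsub>X\<^esub> pb (p \<cdot>\<^bsub>X\<^esub> \<gamma>)) (p \<cdot>\<^bsub>X\<^esub> \<gamma>) a = a \<cdot>\<^bsub>X\<^esub> str (p \<cdot>\<^bsub>X\<^esub> \<gamma>)"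

lemma Ob_EM: "A \<in> Ob EM \<longleftrightarrow> (\<exists>\<gamma> a. A = (\<gamma>, (pb (p \<cdot>\<^bsub>X\<^esub> \<gamma>), \<gamma>, a)) \<and> algebra \<gamma> a)"
proof -
  obtain \<gamma> s t a where A: "A = (\<gamma>, (s, t, a))" by (metis surj_pair)
  show ?thesis
  proof (cases "\<gamma> \<in> Ar X \<and> Cod X \<gamma> = Dom X p \<and> s = pb (p \<cdot>\<^bsub>X\<^esub> \<gamma>) \<and> t = \<gamma> \<and> a \<in> Ar X \<and>
      Cod X a = Dom X \<gamma> \<and> pb (p \<cdot>\<^bsub>X\<^esub> \<gamma>) = \<gamma> \<cdot>\<^bsub>X\<^esub> a")
    case False
    then show ?thesis unfolding A
      by (auto simp: induced_monad_def comp_fun_def Hom_slice algebra_def Hom_iff)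
  next
    case True
    then have "Dom X a = Dom X (pb (p \<cdot>\<^bsub>X\<^esub> \<gamma>))" by (metis Comp_simps(2))
    then show ?thesis unfolding A
      using True un_props(3)[of \<gamma>] pm_postcomp_props(6)[of \<gamma> a "pb (p \<cdot>\<^bsub>X\<^esub> \<gamma>)"] str_props(6)[of "p \<cdot>\<^bsub>X\<^esub> \<gamma>"]
      by (simp add: induced_monad_def comp_fun_def Hom_slice algebra_def Hom_iff)
  qed
qed

lemma Hom_EM:
  assumes "algebra \<gamma> a" "algebra \<delta> b"
  shows "m \<in> Hom EM (\<gamma>, (pb (p \<cdot>\<^bsub>X\<^esub> \<gamma>), \<gamma>, a)) (\<delta>, (pb (p \<cdot>\<^bsub>X\<^esub> \<delta>), \<delta>, b)) \<longleftrightarrow>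
    (\<exists>t. m = ((\<gamma>, (pb (p \<cdot>\<^bsub>X\<^esub> \<gamma>), \<gamma>, a)), (\<delta>, (pb (p \<cdot>\<^bsub>X\<^esub> \<delta>), \<delta>, b)), (\<gamma>, \<delta>, t)) \<and>
       t \<in> Hom X (Dom X \<gamma>) (Dom X \<delta>) \<and> \<delta> \<cdot>\<^bsub>X\<^esub> t = \<gamma> \<and>
       t \<cdot>\<^bsub>X\<^esub> a = b \<cdot>\<^bsub>X\<^esub> pm (p \<cdot>\<^bsub>X\<^esub> \<gamma>) (p \<cdot>\<^bsub>X\<^esub> \<delta>) t)"
proof -
  have ob: "(\<gamma>, (pb (p \<cdot>\<^bsub>X\<^esub> \<gamma>), \<gamma>, a)) \<in> Ob EM" "(\<delta>, (pb (p \<cdot>\<^bsub>X\<^esub> \<delta>), \<delta>, b)) \<in> Ob EM"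
    using assms Ob_EM by blast+
  have ar: "\<gamma> \<in> Ar X" "\<delta> \<in> Ar X" "Cod X \<gamma> = Dom X p" "Cod X \<delta> = Dom X p"
    using assms by (simp_all add: algebra_def)
  have h: "h \<in> Hom (slice X (Dom X p)) \<gamma> \<delta> \<longleftrightarrow>
      (\<exists>t. h = (\<gamma>, \<delta>, t) \<and> t \<in> Hom X (Dom X \<gamma>) (Dom X \<delta>) \<and> \<delta> \<cdot>\<^bsub>X\<^esub> t = \<gamma>)" for h
  proof -
    have "Dom X (\<delta> \<cdot>\<^bsub>X\<^esub> t) = Dom X t" if "t \<in> Ar X" "Cod X t = Dom X \<delta>" for t
      using Comp_simps(2)[OF that(1) ar(2) that(2)] .
    then show ?thesis unfolding Hom_slice unfolding Hom_iff using ar(2,4) by metis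
  qed
  have T: "FAr (Endo (induced_monad (slice_postcomp X p) G \<eta> \<epsilon>)) (\<gamma>, \<delta>, t) =
      (pb (p \<cdot>\<^bsub>X\<^esub> \<gamma>), pb (p \<cdot>\<^bsub>X\<^esub> \<delta>), pm (p \<cdot>\<^bsub>X\<^esub> \<gamma>) (p \<cdot>\<^bsub>X\<^esub> \<delta>) t)"
    if "t \<in> Hom X (Dom X \<gamma>) (Dom X \<delta>)" "\<delta> \<cdot>\<^bsub>X\<^esub> t = \<gamma>" for t
    using pm_postcomp_props(6)[OF ar(2,4), of t \<gamma>] that by (simp add: induced_monad_def comp_fun_def Hom_iff)
  have eq: "(\<gamma>, \<delta>, t) \<cdot>\<^bsub>slice X (Dom X p)\<^esub> (pb (p \<cdot>\<^bsub>X\<^esub> \<gamma>), \<gamma>, a) =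
        (pb (p \<cdot>\<^bsub>X\<^esub> \<delta>), \<delta>, b) \<cdot>\<^bsub>slice X (Dom X p)\<^esub>
          FAr (Endo (induced_monad (slice_postcomp X p) G \<eta> \<epsilon>)) (\<gamma>, \<delta>, t) \<longleftrightarrow>
      t \<cdot>\<^bsub>X\<^esub> a = b \<cdot>\<^bsub>X\<^esub> pm (p \<cdot>\<^bsub>X\<^esub> \<gamma>) (p \<cdot>\<^bsub>X\<^esub> \<delta>) t"
    if "t \<in> Hom X (Dom X \<gamma>) (Dom X \<delta>)" "\<delta> \<cdot>\<^bsub>X\<^esub> t = \<gamma>" for t
    by (simp add: T[OF that])
  show ?thesis
    unfolding Hom_em_cat fst_conv snd_conv h using ob eq by blast
qed

lemma algebra_K:
  assumes "g \<in> Ar X" "Cod X g = Cod X p"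
  shows "algebra (pb g) (str g)"
proof -
  interpret K: is_functor "slice X (Cod X p)" EM K
    using is_functor_comparison[OF category_slice category_slice adj] .
  have "FOb K g \<in> Ob EM" using K.FOb_Ob[of g] assms by (simp del: comparison_fun_simps em_cat_simps)
  then show ?thesis unfolding K_Ob[OF assms] Ob_EM by blast
qed

text \<open>
  The algebra equation for \<open>t : E \<times> D \<rightarrow> E \<times> D'\<close> compares \<open>t (e, d)\<close> with \<open>(e, pr (t (e', d)))\<close> for
  elements \<open>(e, (e', d))\<close>. The first components always agree since \<open>t\<close> lies over \<open>E\<close>; equality of
  the second ones says that the second component of \<open>t (e, d)\<close> does not depend on \<open>e\<close>.
\<close>

lemma algebra_hom_K_iff:
  assumes g: "g \<in> Ar X" "Cod X g = Cod X p" and g': "g' \<in> Ar X" "Cod X g' = Cod X p"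
    and t: "t \<in> Hom X (Dom X (pb g)) (Dom X (pb g'))" "pb g' \<cdot>\<^bsub>X\<^esub> t = pb g"
  shows "t \<cdot>\<^bsub>X\<^esub> str g = str g' \<cdot>\<^bsub>X\<^esub> pm (p \<cdot>\<^bsub>X\<^esub> pb g) (p \<cdot>\<^bsub>X\<^esub> pb g') t \<longleftrightarrow>
    kernel_invariant X (pr g) (pr g' \<cdot>\<^bsub>X\<^esub> t)"
proof -
  define T where "T = pm (p \<cdot>\<^bsub>X\<^esub> pb g) (p \<cdot>\<^bsub>X\<^esub> pb g') t"
  have tA: "t \<in> Ar X" "Dom X t = Dom X (pb g)" "Cod X t = Dom X (pb g')"
    using t by (auto simp: Hom_iff)
  have pg: "p \<cdot>\<^bsub>X\<^esub> pb g \<in> Ar X" "Cod X (p \<cdot>\<^bsub>X\<^esub> pb g) = Cod X p" "Dom X (p \<cdot>\<^bsub>X\<^esub> pb g) = Dom X (pb g)"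
    using g by simp_all
  have pg': "p \<cdot>\<^bsub>X\<^esub> pb g' \<in> Ar X" "Cod X (p \<cdot>\<^bsub>X\<^esub> pb g') = Cod X p" "Dom X (p \<cdot>\<^bsub>X\<^esub> pb g') = Dom X (pb g')"
    using g' by simp_all
  note T = pm_postcomp_props[OF pb_Ar[OF g'] tA(1,3) t(2)[symmetric], folded T_def]
  note S = str_props[OF g] and S' = str_props[OF g']
  have prT: "pr g' \<cdot>\<^bsub>X\<^esub> (str g' \<cdot>\<^bsub>X\<^esub> T) = pr g' \<cdot>\<^bsub>X\<^esub> (t \<cdot>\<^bsub>X\<^esub> pr (p \<cdot>\<^bsub>X\<^esub> pb g))"
  proof -
    have "pr g' \<cdot>\<^bsub>X\<^esub> (str g' \<cdot>\<^bsub>X\<^esub> T) = (pr g' \<cdot>\<^bsub>X\<^esub> pr (p \<cdot>\<^bsub>X\<^esub> pb g')) \<cdot>\<^bsub>X\<^esub> T"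
      using Comp_eq_assoc[OF S'(5)] S' T(1-3) g' by simp
    then show ?thesis using T(1-3,5) g' pg' by simp
  qed
  have pbT: "pb g' \<cdot>\<^bsub>X\<^esub> (str g' \<cdot>\<^bsub>X\<^esub> T) = pb (p \<cdot>\<^bsub>X\<^esub> pb g)"
    using Comp_eq_assoc[OF S'(4)] S' T g' by simp
  have pbt: "pb g' \<cdot>\<^bsub>X\<^esub> (t \<cdot>\<^bsub>X\<^esub> str g) = pb (p \<cdot>\<^bsub>X\<^esub> pb g)"
    using Comp_eq_assoc[OF t(2)] S tA g' by simp
  show ?thesis unfolding T_def[symmetric] kernel_invariant_def
  proof (intro iffI allI ballI impI)
    fix w u v
    assume hom: "t \<cdot>\<^bsub>X\<^esub> str g = str g' \<cdot>\<^bsub>X\<^esub> T" and "u \<in> Hom X w (Dom X (pr g))" "v \<in> Hom X w (Dom X (pr g))"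
      and eq: "pr g \<cdot>\<^bsub>X\<^esub> u = pr g \<cdot>\<^bsub>X\<^esub> v"
    then have uv: "u \<in> Ar X" "v \<in> Ar X" "Cod X u = Dom X (pb g)" "Cod X v = Dom X (pb g)"
      using g by (auto simp: Hom_iff)
    have "p \<cdot>\<^bsub>X\<^esub> (pb g \<cdot>\<^bsub>X\<^esub> u) = g \<cdot>\<^bsub>X\<^esub> (pr g \<cdot>\<^bsub>X\<^esub> u)"
      using Comp_eq_assoc[OF square[OF g]] uv g by simp
    also have "\<dots> = (p \<cdot>\<^bsub>X\<^esub> pb g) \<cdot>\<^bsub>X\<^esub> v"
      unfolding eq using Comp_eq_assoc[OF square[OF g]] uv g by simp
    finally have "p \<cdot>\<^bsub>X\<^esub> (pb g \<cdot>\<^bsub>X\<^esub> u) = (p \<cdot>\<^bsub>X\<^esub> pb g) \<cdot>\<^bsub>X\<^esub> v" .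
    moreover have "pb g \<cdot>\<^bsub>X\<^esub> u \<in> Ar X" "Cod X (pb g \<cdot>\<^bsub>X\<^esub> u) = Dom X p"
      using g uv by simp_all
    ultimately have ex: "\<exists>s. s \<in> Ar X \<and> Cod X s = Dom X (pb (p \<cdot>\<^bsub>X\<^esub> pb g)) \<and>
        pb (p \<cdot>\<^bsub>X\<^esub> pb g) \<cdot>\<^bsub>X\<^esub> s = pb g \<cdot>\<^bsub>X\<^esub> u \<and> pr (p \<cdot>\<^bsub>X\<^esub> pb g) \<cdot>\<^bsub>X\<^esub> s = v"
      using pair_props[OF pg(1,2), of "pb g \<cdot>\<^bsub>X\<^esub> u" v] uv pg(3) by auto
    \<comment> \<open>\<open>u\<close> and \<open>v\<close> differ only in their component in \<open>E\<close>, so \<open>u\<close> is the result of moving \<open>v\<close>: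
      it is \<open>str g\<close> applied to \<open>s = (pb g u, v)\<close>.\<close>
    then obtain s where s: "s \<in> Ar X" "Cod X s = Dom X (pb (p \<cdot>\<^bsub>X\<^esub> pb g))"
        "pb (p \<cdot>\<^bsub>X\<^esub> pb g) \<cdot>\<^bsub>X\<^esub> s = pb g \<cdot>\<^bsub>X\<^esub> u" "pr (p \<cdot>\<^bsub>X\<^esub> pb g) \<cdot>\<^bsub>X\<^esub> s = v" by blast
    have "pr g \<cdot>\<^bsub>X\<^esub> (str g \<cdot>\<^bsub>X\<^esub> s) = pr g \<cdot>\<^bsub>X\<^esub> v"
      using Comp_eq_assoc[OF S(5)] S s g pg by simp
    then have pru: "pr g \<cdot>\<^bsub>X\<^esub> (str g \<cdot>\<^bsub>X\<^esub> s) = pr g \<cdot>\<^bsub>X\<^esub> u" unfolding eq .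
    have pbu: "pb g \<cdot>\<^bsub>X\<^esub> (str g \<cdot>\<^bsub>X\<^esub> s) = pb g \<cdot>\<^bsub>X\<^esub> u"
      using S s(1,2) g unfolding s(3)[symmetric] by (simp add: Comp_eq_assoc[OF S(4)])
    have u: "str g \<cdot>\<^bsub>X\<^esub> s = u"
      using S(1-3) s(1,2) uv pbu pru by - (rule pb_eqI[OF g], simp_all)
    have "(pr g' \<cdot>\<^bsub>X\<^esub> t) \<cdot>\<^bsub>X\<^esub> u = (pr g' \<cdot>\<^bsub>X\<^esub> (str g' \<cdot>\<^bsub>X\<^esub> T)) \<cdot>\<^bsub>X\<^esub> s"
      unfolding hom[symmetric] u[symmetric] using S s tA g' by simp
    also have "\<dots> = (pr g' \<cdot>\<^bsub>X\<^esub> t) \<cdot>\<^bsub>X\<^esub> v"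
      unfolding prT s(4)[symmetric] using s(1,2) tA g' pg by simp
    finally show "(pr g' \<cdot>\<^bsub>X\<^esub> t) \<cdot>\<^bsub>X\<^esub> u = (pr g' \<cdot>\<^bsub>X\<^esub> t) \<cdot>\<^bsub>X\<^esub> v" .
  next
    assume ker: "\<forall>w. \<forall>u \<in> Hom X w (Dom X (pr g)). \<forall>v \<in> Hom X w (Dom X (pr g)).
       pr g \<cdot>\<^bsub>X\<^esub> u = pr g \<cdot>\<^bsub>X\<^esub> v \<longrightarrow> (pr g' \<cdot>\<^bsub>X\<^esub> t) \<cdot>\<^bsub>X\<^esub> u = (pr g' \<cdot>\<^bsub>X\<^esub> t) \<cdot>\<^bsub>X\<^esub> v"
    have "str g \<in> Hom X (Dom X (pb (p \<cdot>\<^bsub>X\<^esub> pb g))) (Dom X (pr g))"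
      "pr (p \<cdot>\<^bsub>X\<^esub> pb g) \<in> Hom X (Dom X (pb (p \<cdot>\<^bsub>X\<^esub> pb g))) (Dom X (pr g))"
      using S g pg by (simp_all add: Hom_iff)
    then have "(pr g' \<cdot>\<^bsub>X\<^esub> t) \<cdot>\<^bsub>X\<^esub> str g = (pr g' \<cdot>\<^bsub>X\<^esub> t) \<cdot>\<^bsub>X\<^esub> pr (p \<cdot>\<^bsub>X\<^esub> pb g)"
      using ker S(5) by blast
    then show "t \<cdot>\<^bsub>X\<^esub> str g = str g' \<cdot>\<^bsub>X\<^esub> T"
      using S S' T tA g' pg by - (rule pb_eqI[OF g'], simp_all add: pbT pbt prT)
  qed
qed

text \<open>
  Arrows \<open>t : E \<times> D \<rightarrow> E \<times> D'\<close> over \<open>E\<close> correspond to arrows \<open>h : E \<times> D \<rightarrow> D'\<close> over \<open>B\<close>, algebra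
  morphisms among them to those \<open>h\<close> that coequalise the kernel pair of \<open>pr g\<close>, and the images under
  \<open>K\<close> of \<open>k : D \<rightarrow> D'\<close> to the composites \<open>k (pr g)\<close>. So bijectivity of \<open>K\<close> on hom-sets out of \<open>g\<close>
  is the quotient property of \<open>pr g\<close>.
\<close>

lemma quotient_if_fully_faithful:
  assumes ff: "fully_faithful (slice X (Cod X p)) EM K" and g: "g \<in> Ar X" "Cod X g = Cod X p"
  shows "quotient_over X g (pr g)"
  unfolding quotient_over_def
proof (intro allI impI, elim conjE)
  fix g' h
  assume g'0: "g' \<in> Ar X" "Cod X g' = Cod X g" and h: "h \<in> Hom X (Dom X (pr g)) (Dom X g')"
    and eq: "g' \<cdot>\<^bsub>X\<^esub> h = g \<cdot>\<^bsub>X\<^esub> pr g"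
    and ker: "kernel_invariant X (pr g) h"
  have g': "g' \<in> Ar X" "Cod X g' = Cod X p" using g'0 g by simp_all
  have hA: "h \<in> Ar X" "Cod X h = Dom X g'" using h by (simp_all add: Hom_iff)
  define t where "t = pair g' (pb g) h"
  have "p \<cdot>\<^bsub>X\<^esub> pb g = g' \<cdot>\<^bsub>X\<^esub> h" using eq square[OF g] by simp
  note t = pair_props[OF g' pb_Ar(1)[OF g] hA(1) pb_Ar(2)[OF g] hA(2) this, folded t_def]
  have tH: "t \<in> Hom X (Dom X (pb g)) (Dom X (pb g'))" using t by (simp add: Hom_iff)
  have hom: "t \<cdot>\<^bsub>X\<^esub> str g = str g' \<cdot>\<^bsub>X\<^esub> pm (p \<cdot>\<^bsub>X\<^esub> pb g) (p \<cdot>\<^bsub>X\<^esub> pb g') t"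
    using ker unfolding algebra_hom_K_iff[OF g g' tH t(4)] t(5) .
  have bij: "bij_betw (FAr K) (Hom (slice X (Cod X p)) g g') (Hom EM (FOb K g) (FOb K g'))"
    using ff g g' by (simp add: fully_faithful_def)
  have FK: "FAr K (g, g', k) = (FOb K g, FOb K g', (pb g, pb g', pm g g' k))"
    if "k \<in> Ar X" "Cod X k = Dom X g'" "g = g' \<cdot>\<^bsub>X\<^esub> k" for k
    using pm_props(3)[OF g' that] by simp
  have "(FOb K g, FOb K g', (pb g, pb g', t)) \<in> Hom EM (FOb K g) (FOb K g')"
    using Hom_EM[OF algebra_K[OF g] algebra_K[OF g']] tH t(4) hom unfolding K_Ob[OF g] K_Ob[OF g'] by blast
  then have "(FOb K g, FOb K g', (pb g, pb g', t)) \<in> FAr K ` Hom (slice X (Cod X p)) g g'"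
    using bij by (simp add: bij_betw_def del: comparison_fun_simps)
  then obtain m where m: "m \<in> Hom (slice X (Cod X p)) g g'" "(FOb K g, FOb K g', (pb g, pb g', t)) = FAr K m"
    by blast
  then obtain k where k: "m = (g, g', k)" "k \<in> Ar X" "Cod X k = Dom X g'" "g = g' \<cdot>\<^bsub>X\<^esub> k"
    using Hom_slice_elim by metis
  have pmk: "pm g g' k = t" using m(2) FK[OF k(2-4)] unfolding k(1) by simp
  have Domk: "Dom X k = Dom X g" using Comp_simps(2)[OF k(2) g'(1) k(3)] k(4) by simp
  show "\<exists>!k. k \<in> Hom X (Dom X g) (Dom X g') \<and> g' \<cdot>\<^bsub>X\<^esub> k = g \<and> k \<cdot>\<^bsub>X\<^esub> pr g = h"
  proof (rule ex1I[of _ k], intro conjI)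
    show "k \<in> Hom X (Dom X g) (Dom X g')" using k(2,3) Domk by (simp add: Hom_iff)
    show "g' \<cdot>\<^bsub>X\<^esub> k = g" using k(4) by simp
    show "k \<cdot>\<^bsub>X\<^esub> pr g = h" using pm_props(4)[OF g' k(2-4)] t(5) unfolding pmk by simp
  next
    fix l assume l: "l \<in> Hom X (Dom X g) (Dom X g') \<and> g' \<cdot>\<^bsub>X\<^esub> l = g \<and> l \<cdot>\<^bsub>X\<^esub> pr g = h"
    then have lA: "l \<in> Ar X" "Cod X l = Dom X g'" "g = g' \<cdot>\<^bsub>X\<^esub> l" by (auto simp: Hom_iff)
    have "pm g g' l = t"
    proof (rule pb_eqI[OF g'])
      show "pr g' \<cdot>\<^bsub>X\<^esub> pm g g' l = pr g' \<cdot>\<^bsub>X\<^esub> t" using pm_props(4)[OF g' lA] l t(5) by simp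
      show "pb g' \<cdot>\<^bsub>X\<^esub> pm g g' l = pb g' \<cdot>\<^bsub>X\<^esub> t" using pm_props(2)[OF g' lA] t(4) by simp
    qed (use pm_props(1)[OF g' lA] t in \<open>simp_all add: Hom_iff\<close>)
    then have "FAr K (g, g', l) = FAr K (g, g', k)"
      using FK[OF lA] FK[OF k(2-4)] pmk by metis
    moreover have "(g, g', l) \<in> Hom (slice X (Cod X p)) g g'" "(g, g', k) \<in> Hom (slice X (Cod X p)) g g'"
      using Hom_sliceI[OF g' lA] Hom_sliceI[OF g' k(2-4)] .
    ultimately have "(g, g', l) = (g, g', k)"
      using bij unfolding bij_betw_def inj_on_def by blast
    then show "l = k" by simp
  qed
qed

lemma fully_faithful_if_quotient:
  assumes q: "\<And>g. g \<in> Ar X \<Longrightarrow> Cod X g = Cod X p \<Longrightarrow> quotient_over X g (pr g)"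
  shows "fully_faithful (slice X (Cod X p)) EM K"
  unfolding fully_faithful_def
proof (intro ballI)
  fix g g' assume "g \<in> Ob (slice X (Cod X p))" "g' \<in> Ob (slice X (Cod X p))"
  then have g: "g \<in> Ar X" "Cod X g = Cod X p" and g': "g' \<in> Ar X" "Cod X g' = Cod X p" by simp_all
  interpret K: is_functor "slice X (Cod X p)" EM K
    using is_functor_comparison[OF category_slice category_slice adj] .
  have FK: "FAr K (g, g', k) = (FOb K g, FOb K g', (pb g, pb g', pm g g' k))"
    if "k \<in> Ar X" "Cod X k = Dom X g'" "g = g' \<cdot>\<^bsub>X\<^esub> k" for k
    using pm_props(3)[OF g' that] by simp
  have uniq: "\<exists>!k. k \<in> Hom X (Dom X g) (Dom X g') \<and> g' \<cdot>\<^bsub>X\<^esub> k = g \<and> k \<cdot>\<^bsub>X\<^esub> pr g = h"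
    if "h \<in> Hom X (Dom X (pr g)) (Dom X g')" "g' \<cdot>\<^bsub>X\<^esub> h = g \<cdot>\<^bsub>X\<^esub> pr g"
      "kernel_invariant X (pr g) h" for h
  proof -
    have "Cod X g' = Cod X g" using g(2) g'(2) by simp
    then show ?thesis
      using q[OF g, unfolded quotient_over_def, rule_format, of g' h] g'(1) that by blast
  qed
  show "bij_betw (FAr K) (Hom (slice X (Cod X p)) g g') (Hom EM (FOb K g) (FOb K g'))"
    unfolding bij_betw_def
  proof
    show "inj_on (FAr K) (Hom (slice X (Cod X p)) g g')"
    proof (rule inj_onI)
      fix m n assume m: "m \<in> Hom (slice X (Cod X p)) g g'" and n: "n \<in> Hom (slice X (Cod X p)) g g'"
        and eq: "FAr K m = FAr K n"
      obtain k where k: "m = (g, g', k)" "k \<in> Ar X" "Cod X k = Dom X g'" "g = g' \<cdot>\<^bsub>X\<^esub> k"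
        using Hom_slice_elim[OF m] .
      obtain l where l: "n = (g, g', l)" "l \<in> Ar X" "Cod X l = Dom X g'" "g = g' \<cdot>\<^bsub>X\<^esub> l"
        using Hom_slice_elim[OF n] .
      have Domk: "Dom X k = Dom X g" using Comp_simps(2)[OF k(2) g'(1) k(3)] k(4) by simp
      have Doml: "Dom X l = Dom X g" using Comp_simps(2)[OF l(2) g'(1) l(3)] l(4) by simp
      have "pm g g' k = pm g g' l" using eq FK[OF k(2-4)] FK[OF l(2-4)] unfolding k(1) l(1) by simp
      then have kl: "k \<cdot>\<^bsub>X\<^esub> pr g = l \<cdot>\<^bsub>X\<^esub> pr g" using pm_props(4)[OF g' k(2-4)] pm_props(4)[OF g' l(2-4)] by simp
      have "\<exists>!r. r \<in> Hom X (Dom X g) (Dom X g') \<and> g' \<cdot>\<^bsub>X\<^esub> r = g \<and> r \<cdot>\<^bsub>X\<^esub> pr g = k \<cdot>\<^bsub>X\<^esub> pr g"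
      proof (rule uniq)
        show "k \<cdot>\<^bsub>X\<^esub> pr g \<in> Hom X (Dom X (pr g)) (Dom X g')" using k(2,3) Domk g by (simp add: Hom_iff)
        show "g' \<cdot>\<^bsub>X\<^esub> (k \<cdot>\<^bsub>X\<^esub> pr g) = g \<cdot>\<^bsub>X\<^esub> pr g"
          using Comp_eq_assoc[OF k(4)[symmetric]] k(2,3) Domk g g' by simp
        show "kernel_invariant X (pr g) (k \<cdot>\<^bsub>X\<^esub> pr g)"
          using k(2,3) Domk g by (simp add: kernel_invariant_def Hom_iff)
      qed
      moreover have "k \<in> Hom X (Dom X g) (Dom X g')" "l \<in> Hom X (Dom X g) (Dom X g')"
        using k l Domk Doml by (simp_all add: Hom_iff)
      ultimately have "k = l" using kl k(4) l(4) by metis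
      then show "m = n" using k(1) l(1) by simp
    qed
    show "FAr K ` Hom (slice X (Cod X p)) g g' = Hom EM (FOb K g) (FOb K g')"
    proof
      show "FAr K ` Hom (slice X (Cod X p)) g g' \<subseteq> Hom EM (FOb K g) (FOb K g')"
        using K.FAr_Hom by blast
      show "Hom EM (FOb K g) (FOb K g') \<subseteq> FAr K ` Hom (slice X (Cod X p)) g g'"
      proof
        fix m assume "m \<in> Hom EM (FOb K g) (FOb K g')"
        then obtain t where m: "m = (FOb K g, FOb K g', (pb g, pb g', t))"
          and tH: "t \<in> Hom X (Dom X (pb g)) (Dom X (pb g'))" and pbt: "pb g' \<cdot>\<^bsub>X\<^esub> t = pb g"
          and hom: "t \<cdot>\<^bsub>X\<^esub> str g = str g' \<cdot>\<^bsub>X\<^esub> pm (p \<cdot>\<^bsub>X\<^esub> pb g) (p \<cdot>\<^bsub>X\<^esub> pb g') t"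
          unfolding K_Ob[OF g] K_Ob[OF g'] Hom_EM[OF algebra_K[OF g] algebra_K[OF g']] by blast
        have tA: "t \<in> Ar X" "Dom X t = Dom X (pb g)" "Cod X t = Dom X (pb g')" using tH by (auto simp: Hom_iff)
        have "\<exists>!k. k \<in> Hom X (Dom X g) (Dom X g') \<and> g' \<cdot>\<^bsub>X\<^esub> k = g \<and> k \<cdot>\<^bsub>X\<^esub> pr g = pr g' \<cdot>\<^bsub>X\<^esub> t"
        proof (rule uniq)
          show "pr g' \<cdot>\<^bsub>X\<^esub> t \<in> Hom X (Dom X (pr g)) (Dom X g')" using tA g g' by (simp add: Hom_iff)
          show "g' \<cdot>\<^bsub>X\<^esub> (pr g' \<cdot>\<^bsub>X\<^esub> t) = g \<cdot>\<^bsub>X\<^esub> pr g"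
            using tA g g' pbt by (simp add: Comp_eq_assoc[OF square[OF g']] square[OF g])
        next
          show "kernel_invariant X (pr g) (pr g' \<cdot>\<^bsub>X\<^esub> t)"
            using hom unfolding algebra_hom_K_iff[OF g g' tH pbt] .
        qed
        then obtain k where kH: "k \<in> Hom X (Dom X g) (Dom X g')" and k: "g' \<cdot>\<^bsub>X\<^esub> k = g"
          "k \<cdot>\<^bsub>X\<^esub> pr g = pr g' \<cdot>\<^bsub>X\<^esub> t" by blast
        have kA: "k \<in> Ar X" "Cod X k = Dom X g'" "g = g' \<cdot>\<^bsub>X\<^esub> k" using kH k by (auto simp: Hom_iff)
        have "pm g g' k = t"
        proof (rule pb_eqI[OF g'])
          show "pr g' \<cdot>\<^bsub>X\<^esub> pm g g' k = pr g' \<cdot>\<^bsub>X\<^esub> t" using pm_props(4)[OF g' kA] k by simp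
          show "pb g' \<cdot>\<^bsub>X\<^esub> pm g g' k = pb g' \<cdot>\<^bsub>X\<^esub> t" using pm_props(2)[OF g' kA] pbt by simp
        qed (use pm_props(1)[OF g' kA] tA in \<open>simp_all add: Hom_iff\<close>)
        then have "m = FAr K (g, g', k)" using m FK[OF kA] by simp
        then show "m \<in> FAr K ` Hom (slice X (Cod X p)) g g'"
          using Hom_sliceI[OF g' kA] by blast
      qed
    qed
  qed
qed

text \<open>
  The structure map is the action on the universal pair \<open>(pb h, pr h)\<close>, where \<open>h = p \<gamma>\<close>; by
  naturality it determines the action on every other pair.
\<close>

lemma algebra_if_descent_datum:
  assumes "descent_datum X p \<gamma> \<xi>"
  shows "algebra \<gamma> (\<xi> (pb (p \<cdot>\<^bsub>X\<^esub> \<gamma>)) (pr (p \<cdot>\<^bsub>X\<^esub> \<gamma>)))"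
proof -
  have \<gamma>: "\<gamma> \<in> Ar X" "Cod X \<gamma> = Dom X p" using assms by (simp_all add: descent_datum_def)
  define h where "h = p \<cdot>\<^bsub>X\<^esub> \<gamma>"
  have h: "h \<in> Ar X" "Cod X h = Cod X p" "Dom X h = Dom X \<gamma>" using \<gamma> by (simp_all add: h_def)
  have ph: "p \<cdot>\<^bsub>X\<^esub> pb h \<in> Ar X" "Cod X (p \<cdot>\<^bsub>X\<^esub> pb h) = Cod X p" "Dom X (p \<cdot>\<^bsub>X\<^esub> pb h) = Dom X (pb h)"
    using h by simp_all
  note act = descent_datumD[OF assms, folded h_def]
  define a where "a = \<xi> (pb h) (pr h)"
  note gen = pb_Ar(1)[OF h(1,2)] pr_Ar[OF h(1,2)] pb_Ar(2)[OF h(1,2)]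
    Cod_pr[OF h(1,2), unfolded h(3)] square[OF h(1,2), symmetric]
  have a: "a \<in> Ar X" "Dom X a = Dom X (pb h)" "Cod X a = Dom X \<gamma>" "\<gamma> \<cdot>\<^bsub>X\<^esub> a = pb h"
    using act(1,2)[OF gen] by (simp_all add: a_def Hom_iff)
  have nata: "\<xi> (pb h \<cdot>\<^bsub>X\<^esub> t) (pr h \<cdot>\<^bsub>X\<^esub> t) = a \<cdot>\<^bsub>X\<^esub> t" if "t \<in> Ar X" "Cod X t = Dom X (pb h)" for t
    using act(3)[OF gen that] by (simp add: a_def)
  note n = un_props[OF \<gamma>, folded h_def, unfolded Hom_iff]
  have "a \<cdot>\<^bsub>X\<^esub> un \<gamma> = Id X (Dom X \<gamma>)"
    using nata[of "un \<gamma>"] n descent_datum_unit[OF assms, of "Id X (Dom X \<gamma>)"] \<gamma> by simp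
  moreover have "a \<cdot>\<^bsub>X\<^esub> pm (p \<cdot>\<^bsub>X\<^esub> pb h) h a = a \<cdot>\<^bsub>X\<^esub> str h"
  proof -
    note T = pm_postcomp_props[OF \<gamma> a(1,3) a(4)[symmetric], folded h_def]
    note S = str_props[OF h(1,2)]
    let ?e = "pb (p \<cdot>\<^bsub>X\<^esub> pb h)" and ?c = "pr (p \<cdot>\<^bsub>X\<^esub> pb h)"
    have e: "?e \<in> Ar X" "Cod X ?e = Dom X p" and c: "?c \<in> Ar X" "Cod X ?c = Dom X (pb h)"
      "Dom X ?c = Dom X ?e" using ph by simp_all
    have "a \<cdot>\<^bsub>X\<^esub> pm (p \<cdot>\<^bsub>X\<^esub> pb h) h a = \<xi> ?e (\<xi> (pb h \<cdot>\<^bsub>X\<^esub> ?c) (pr h \<cdot>\<^bsub>X\<^esub> ?c))"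
      using nata[of "pm (p \<cdot>\<^bsub>X\<^esub> pb h) h a"] T nata[OF c(1,2)] by simp
    also have "\<dots> = \<xi> ?e (pr h \<cdot>\<^bsub>X\<^esub> ?c)"
    proof (rule act(4))
      show "p \<cdot>\<^bsub>X\<^esub> (pb h \<cdot>\<^bsub>X\<^esub> ?c) = h \<cdot>\<^bsub>X\<^esub> (pr h \<cdot>\<^bsub>X\<^esub> ?c)"
        using Comp_eq_assoc[OF square[OF h(1,2)]] c h(1,2) by simp
      show "p \<cdot>\<^bsub>X\<^esub> ?e = p \<cdot>\<^bsub>X\<^esub> (pb h \<cdot>\<^bsub>X\<^esub> ?c)"
        using square[OF ph(1,2)] c h(1,2) by simp
    qed (use c e h(1,2) gen in simp_all)
    also have "\<dots> = a \<cdot>\<^bsub>X\<^esub> str h"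
      using nata[of "str h"] S by simp
    finally show ?thesis .
  qed
  ultimately show ?thesis
    unfolding algebra_def using \<gamma> a by (fold h_def) (fold a_def, simp add: Hom_iff)
qed

text \<open>
  An isomorphism of algebras between \<open>K g\<close> and the algebra of the datum transports the pullback square
  of \<open>g\<close> to one with vertex the domain of \<open>\<gamma>\<close>. With \<open>i\<close> the component into \<open>K g\<close>, the arrow \<open>pr g \<cdot> i\<close>
  is invariant under the action because \<open>i\<close> is an algebra morphism and \<open>pr g\<close> is invariant under the
  action on \<open>K g\<close>.
\<close>

lemma effective_if_essentially_surjective:
  assumes eso: "essentially_surjective (slice X (Cod X p)) EM K" and datum: "descent_datum X p \<gamma> \<xi>"
  shows "effective_datum X p \<gamma> \<xi>"
proof -
  have \<gamma>: "\<gamma> \<in> Ar X" "Cod X \<gamma> = Dom X p" using datum by (simp_all add: descent_datum_def)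
  define h where "h = p \<cdot>\<^bsub>X\<^esub> \<gamma>"
  have h: "h \<in> Ar X" "Cod X h = Cod X p" "Dom X h = Dom X \<gamma>" using \<gamma> by (simp_all add: h_def)
  define a where "a = \<xi> (pb h) (pr h)"
  have alg: "algebra \<gamma> a" using algebra_if_descent_datum[OF datum] by (simp add: a_def h_def)
  have aA: "a \<in> Ar X" "Dom X a = Dom X (pb h)" "Cod X a = Dom X \<gamma>"
    using alg by (simp_all add: algebra_def Hom_iff h_def)
  have "(\<gamma>, (pb h, \<gamma>, a)) \<in> Ob EM" using alg unfolding Ob_EM h_def by blast
  then obtain g where g: "g \<in> Ar X" "Cod X g = Cod X p" and iso: "iso_objects EM (FOb K g) (\<gamma>, (pb h, \<gamma>, a))"
    using eso unfolding essentially_surjective_def by (metis slice_simps(1))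
  obtain m where m: "m \<in> Hom EM (FOb K g) (\<gamma>, (pb h, \<gamma>, a))" "iso_arrow EM m"
    using iso unfolding iso_objects_def by blast
  obtain m' where m': "m' \<in> Hom EM (\<gamma>, (pb h, \<gamma>, a)) (FOb K g)"
    "m' \<cdot>\<^bsub>EM\<^esub> m = Id EM (FOb K g)" "m \<cdot>\<^bsub>EM\<^esub> m' = Id EM (\<gamma>, (pb h, \<gamma>, a))"
    using iso_arrowE[OF m(2,1)] .
  obtain j where j: "m = (FOb K g, (\<gamma>, (pb h, \<gamma>, a)), (pb g, \<gamma>, j))" "j \<in> Hom X (Dom X (pb g)) (Dom X \<gamma>)"
    using m(1) Hom_EM[OF algebra_K[OF g] alg] unfolding K_Ob[OF g] h_def by blast
  obtain i where i: "m' = ((\<gamma>, (pb h, \<gamma>, a)), FOb K g, (\<gamma>, pb g, i))" "i \<in> Hom X (Dom X \<gamma>) (Dom X (pb g))"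
    "pb g \<cdot>\<^bsub>X\<^esub> i = \<gamma>" "i \<cdot>\<^bsub>X\<^esub> a = str g \<cdot>\<^bsub>X\<^esub> pm h (p \<cdot>\<^bsub>X\<^esub> pb g) i"
    using m'(1) Hom_EM[OF alg algebra_K[OF g]] unfolding K_Ob[OF g] h_def by blast
  have iA: "i \<in> Ar X" "Dom X i = Dom X \<gamma>" "Cod X i = Dom X (pb g)" using i(2) by (auto simp: Hom_iff)
  have "i \<cdot>\<^bsub>X\<^esub> j = Id X (Dom X (pb g))" "j \<cdot>\<^bsub>X\<^esub> i = Id X (Dom X \<gamma>)"
    using m'(2,3) unfolding j(1) i(1) K_Ob[OF g] by simp_all
  then have "is_pullback X p g (pr g \<cdot>\<^bsub>X\<^esub> i) (pb g \<cdot>\<^bsub>X\<^esub> i)"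
    using g iA j(2) by (intro is_pullback_iso[OF pb_is_pullback[OF g]]) simp_all
  then have pullback: "is_pullback X p g (pr g \<cdot>\<^bsub>X\<^esub> i) \<gamma>" using i(3) by simp
  note T = pm_postcomp_props[OF pb_Ar[OF g] iA(1,3) i(3)[symmetric], folded h_def]
  have pg: "p \<cdot>\<^bsub>X\<^esub> pb g \<in> Ar X" "Cod X (p \<cdot>\<^bsub>X\<^esub> pb g) = Cod X p" "Dom X (p \<cdot>\<^bsub>X\<^esub> pb g) = Dom X (pb g)"
    using g by simp_all
  have "(pr g \<cdot>\<^bsub>X\<^esub> i) \<cdot>\<^bsub>X\<^esub> a = pr g \<cdot>\<^bsub>X\<^esub> (str g \<cdot>\<^bsub>X\<^esub> pm h (p \<cdot>\<^bsub>X\<^esub> pb g) i)"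
    using g iA aA i(4) by simp
  also have "\<dots> = pr g \<cdot>\<^bsub>X\<^esub> (i \<cdot>\<^bsub>X\<^esub> pr h)"
    using g T pg str_props[OF g] by (simp add: Comp_eq_assoc[OF str_props(5)[OF g]])
  finally have \<kappa>a: "(pr g \<cdot>\<^bsub>X\<^esub> i) \<cdot>\<^bsub>X\<^esub> a = (pr g \<cdot>\<^bsub>X\<^esub> i) \<cdot>\<^bsub>X\<^esub> pr h"
    using g iA h by simp
  have "(pr g \<cdot>\<^bsub>X\<^esub> i) \<cdot>\<^bsub>X\<^esub> \<xi> e c = (pr g \<cdot>\<^bsub>X\<^esub> i) \<cdot>\<^bsub>X\<^esub> c"
    if e: "e \<in> Ar X" "Cod X e = Dom X p" and c: "c \<in> Ar X" "Cod X c = Dom X \<gamma>"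
      and eq: "p \<cdot>\<^bsub>X\<^esub> e = (p \<cdot>\<^bsub>X\<^esub> \<gamma>) \<cdot>\<^bsub>X\<^esub> c" for e c
  proof -
    have eq': "p \<cdot>\<^bsub>X\<^esub> e = h \<cdot>\<^bsub>X\<^esub> c" using eq unfolding h_def .
    note t = pair_props[OF h(1,2) e(1) c(1) e(2) c(2)[folded h(3)] eq']
    have "\<xi> (pb h \<cdot>\<^bsub>X\<^esub> pair h e c) (pr h \<cdot>\<^bsub>X\<^esub> pair h e c) = \<xi> (pb h) (pr h) \<cdot>\<^bsub>X\<^esub> pair h e c"
      using descent_datumD(3)[OF datum, folded h_def, of "pb h" "pr h" "pair h e c"] t h square[OF h(1,2)]
      by simp
    then have \<xi>: "\<xi> e c = a \<cdot>\<^bsub>X\<^esub> pair h e c" using t by (simp add: a_def)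
    have "(pr g \<cdot>\<^bsub>X\<^esub> i) \<cdot>\<^bsub>X\<^esub> \<xi> e c = ((pr g \<cdot>\<^bsub>X\<^esub> i) \<cdot>\<^bsub>X\<^esub> a) \<cdot>\<^bsub>X\<^esub> pair h e c"
      unfolding \<xi> using g iA aA t by simp
    also have "\<dots> = (pr g \<cdot>\<^bsub>X\<^esub> i) \<cdot>\<^bsub>X\<^esub> c"
      unfolding \<kappa>a using g iA h t c by simp
    finally show ?thesis .
  qed
  then show ?thesis unfolding effective_datum_def using pullback by blast
qed

text \<open>
  The two elements \<open>pair h e' (a s)\<close> and \<open>pair h e' c\<close> that occur in the law for moving twice are the
  two images of \<open>r = (e', (e, c))\<close> that the associativity law of \<open>a\<close> compares.
\<close>

lemma descent_datum_if_algebra: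
  assumes alg: "algebra \<gamma> a"
  shows "descent_datum X p \<gamma> (\<lambda>e c. a \<cdot>\<^bsub>X\<^esub> pair (p \<cdot>\<^bsub>X\<^esub> \<gamma>) e c)"
proof -
  have \<gamma>: "\<gamma> \<in> Ar X" "Cod X \<gamma> = Dom X p" using alg by (simp_all add: algebra_def)
  define h where "h = p \<cdot>\<^bsub>X\<^esub> \<gamma>"
  have h: "h \<in> Ar X" "Cod X h = Cod X p" "Dom X h = Dom X \<gamma>" using \<gamma> by (simp_all add: h_def)
  have ph: "p \<cdot>\<^bsub>X\<^esub> pb h \<in> Ar X" "Cod X (p \<cdot>\<^bsub>X\<^esub> pb h) = Cod X p" "Dom X (p \<cdot>\<^bsub>X\<^esub> pb h) = Dom X (pb h)"
    using h by simp_all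
  have aA: "a \<in> Ar X" "Dom X a = Dom X (pb h)" "Cod X a = Dom X \<gamma>" and \<gamma>a: "\<gamma> \<cdot>\<^bsub>X\<^esub> a = pb h"
    and aun: "a \<cdot>\<^bsub>X\<^esub> un \<gamma> = Id X (Dom X \<gamma>)"
    and aa: "a \<cdot>\<^bsub>X\<^esub> pm (p \<cdot>\<^bsub>X\<^esub> pb h) h a = a \<cdot>\<^bsub>X\<^esub> str h"
    using alg by (simp_all add: algebra_def Hom_iff h_def)
  note n = un_props[OF \<gamma>, folded h_def, unfolded Hom_iff]
  note T = pm_postcomp_props[OF \<gamma> aA(1,3) \<gamma>a[symmetric], folded h_def]
  note S = str_props[OF h(1,2)]
  have "a \<cdot>\<^bsub>X\<^esub> pair h (\<gamma> \<cdot>\<^bsub>X\<^esub> c) c = c" if c: "c \<in> Ar X" "Cod X c = Dom X \<gamma>" for c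
  proof -
    have "p \<cdot>\<^bsub>X\<^esub> (\<gamma> \<cdot>\<^bsub>X\<^esub> c) = h \<cdot>\<^bsub>X\<^esub> c" using c \<gamma> by (simp add: h_def)
    note t = pair_props[OF h(1,2) _ c(1) _ c(2)[folded h(3)] this]
    have tA: "pair h (\<gamma> \<cdot>\<^bsub>X\<^esub> c) c \<in> Ar X" "Cod X (pair h (\<gamma> \<cdot>\<^bsub>X\<^esub> c) c) = Dom X (pb h)"
      "pb h \<cdot>\<^bsub>X\<^esub> pair h (\<gamma> \<cdot>\<^bsub>X\<^esub> c) c = \<gamma> \<cdot>\<^bsub>X\<^esub> c" "pr h \<cdot>\<^bsub>X\<^esub> pair h (\<gamma> \<cdot>\<^bsub>X\<^esub> c) c = c"
      using t c \<gamma> by simp_all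
    have "pair h (\<gamma> \<cdot>\<^bsub>X\<^esub> c) c = un \<gamma> \<cdot>\<^bsub>X\<^esub> c"
    proof (rule pb_eqI[OF h(1,2)])
      show "pb h \<cdot>\<^bsub>X\<^esub> pair h (\<gamma> \<cdot>\<^bsub>X\<^esub> c) c = pb h \<cdot>\<^bsub>X\<^esub> (un \<gamma> \<cdot>\<^bsub>X\<^esub> c)"
        unfolding tA(3) using n c h by (simp add: Comp_eq_assoc[OF n(2)])
      show "pr h \<cdot>\<^bsub>X\<^esub> pair h (\<gamma> \<cdot>\<^bsub>X\<^esub> c) c = pr h \<cdot>\<^bsub>X\<^esub> (un \<gamma> \<cdot>\<^bsub>X\<^esub> c)"
        unfolding tA(4) using n c h by (simp add: Comp_eq_assoc[OF n(4)])
    qed (use tA n c in simp_all)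
    then show ?thesis using n c aA by (simp add: Comp_eq_assoc[OF aun])
  qed
  moreover have "a \<cdot>\<^bsub>X\<^esub> pair h e c \<in> Hom X (Dom X e) (Dom X \<gamma>) \<and> \<gamma> \<cdot>\<^bsub>X\<^esub> (a \<cdot>\<^bsub>X\<^esub> pair h e c) = e \<and>
      (\<forall>t \<in> Ar X. Cod X t = Dom X e \<longrightarrow> a \<cdot>\<^bsub>X\<^esub> pair h (e \<cdot>\<^bsub>X\<^esub> t) (c \<cdot>\<^bsub>X\<^esub> t) = (a \<cdot>\<^bsub>X\<^esub> pair h e c) \<cdot>\<^bsub>X\<^esub> t) \<and>
      (\<forall>e' \<in> Ar X. Cod X e' = Dom X p \<and> p \<cdot>\<^bsub>X\<^esub> e' = p \<cdot>\<^bsub>X\<^esub> e \<longrightarrow>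
        a \<cdot>\<^bsub>X\<^esub> pair h e' (a \<cdot>\<^bsub>X\<^esub> pair h e c) = a \<cdot>\<^bsub>X\<^esub> pair h e' c)"
    if e: "e \<in> Ar X" "Cod X e = Dom X p" and c: "c \<in> Ar X" "Cod X c = Dom X \<gamma>"
      and eq: "p \<cdot>\<^bsub>X\<^esub> e = h \<cdot>\<^bsub>X\<^esub> c" for e c
  proof (intro conjI ballI impI)
    note s = pair_props[OF h(1,2) e(1) c(1) e(2) c(2)[folded h(3)] eq]
    have Dc: "Dom X c = Dom X e"
      using eq Comp_simps(2)[OF e(1) p_Ar e(2)] Comp_simps(2)[OF c(1) h(1)] c(2) h(3) by simp
    show "a \<cdot>\<^bsub>X\<^esub> pair h e c \<in> Hom X (Dom X e) (Dom X \<gamma>)" using s aA by (simp add: Hom_iff)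
    show over: "\<gamma> \<cdot>\<^bsub>X\<^esub> (a \<cdot>\<^bsub>X\<^esub> pair h e c) = e" using s aA \<gamma> by (simp add: Comp_eq_assoc[OF \<gamma>a])
    {
      fix t assume t: "t \<in> Ar X" "Cod X t = Dom X e"
      have et: "e \<cdot>\<^bsub>X\<^esub> t \<in> Ar X" "Cod X (e \<cdot>\<^bsub>X\<^esub> t) = Dom X p" and ct: "c \<cdot>\<^bsub>X\<^esub> t \<in> Ar X" "Cod X (c \<cdot>\<^bsub>X\<^esub> t) = Dom X h"
        and "p \<cdot>\<^bsub>X\<^esub> (e \<cdot>\<^bsub>X\<^esub> t) = h \<cdot>\<^bsub>X\<^esub> (c \<cdot>\<^bsub>X\<^esub> t)"
        using e c t Dc h by (simp_all add: Comp_eq_assoc[OF eq])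
      note r = pair_props[OF h(1,2) et(1) ct(1) et(2) ct(2) this(5)]
      have "pair h (e \<cdot>\<^bsub>X\<^esub> t) (c \<cdot>\<^bsub>X\<^esub> t) = pair h e c \<cdot>\<^bsub>X\<^esub> t"
      proof (rule pb_eqI[OF h(1,2)])
        show "pb h \<cdot>\<^bsub>X\<^esub> pair h (e \<cdot>\<^bsub>X\<^esub> t) (c \<cdot>\<^bsub>X\<^esub> t) = pb h \<cdot>\<^bsub>X\<^esub> (pair h e c \<cdot>\<^bsub>X\<^esub> t)"
          unfolding r(4) using s t h by (simp add: Comp_eq_assoc[OF s(4)])
        show "pr h \<cdot>\<^bsub>X\<^esub> pair h (e \<cdot>\<^bsub>X\<^esub> t) (c \<cdot>\<^bsub>X\<^esub> t) = pr h \<cdot>\<^bsub>X\<^esub> (pair h e c \<cdot>\<^bsub>X\<^esub> t)"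
          unfolding r(5) using s t h by (simp add: Comp_eq_assoc[OF s(5)])
      qed (use r s t in simp_all)
      then show "a \<cdot>\<^bsub>X\<^esub> pair h (e \<cdot>\<^bsub>X\<^esub> t) (c \<cdot>\<^bsub>X\<^esub> t) = (a \<cdot>\<^bsub>X\<^esub> pair h e c) \<cdot>\<^bsub>X\<^esub> t"
        using aA s t by simp
    }
    fix e' assume e': "e' \<in> Ar X" and e'p: "Cod X e' = Dom X p \<and> p \<cdot>\<^bsub>X\<^esub> e' = p \<cdot>\<^bsub>X\<^esub> e"
    define s where "s = pair h e c"
    note s = s[folded s_def]
    have "p \<cdot>\<^bsub>X\<^esub> e' = (p \<cdot>\<^bsub>X\<^esub> pb h) \<cdot>\<^bsub>X\<^esub> s" using e'p s h(1,2) by simp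
    note r = pair_props[OF ph(1,2) e' s(1) _ _ this]
    define r where "r = pair (p \<cdot>\<^bsub>X\<^esub> pb h) e' s"
    have r: "r \<in> Ar X" "Dom X r = Dom X e'" "Cod X r = Dom X (pb (p \<cdot>\<^bsub>X\<^esub> pb h))"
      "pb (p \<cdot>\<^bsub>X\<^esub> pb h) \<cdot>\<^bsub>X\<^esub> r = e'" "pr (p \<cdot>\<^bsub>X\<^esub> pb h) \<cdot>\<^bsub>X\<^esub> r = s"
      using r e'p s ph(3) unfolding r_def by simp_all
    have as: "a \<cdot>\<^bsub>X\<^esub> s \<in> Ar X" "Cod X (a \<cdot>\<^bsub>X\<^esub> s) = Dom X h" using aA s h by simp_all
    have over': "p \<cdot>\<^bsub>X\<^esub> e' = h \<cdot>\<^bsub>X\<^esub> (a \<cdot>\<^bsub>X\<^esub> s)"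
      using e'p over[folded s_def] as \<gamma> h(3) unfolding h_def by simp
    note x = pair_props[OF h(1,2) e' as(1) _ as(2) over']
    have 1: "pair h e' (a \<cdot>\<^bsub>X\<^esub> s) = pm (p \<cdot>\<^bsub>X\<^esub> pb h) h a \<cdot>\<^bsub>X\<^esub> r"
    proof (rule pb_eqI[OF h(1,2)])
      show "pb h \<cdot>\<^bsub>X\<^esub> pair h e' (a \<cdot>\<^bsub>X\<^esub> s) = pb h \<cdot>\<^bsub>X\<^esub> (pm (p \<cdot>\<^bsub>X\<^esub> pb h) h a \<cdot>\<^bsub>X\<^esub> r)"
        using x(4) e'p r T(1-3) h(1,2) by (simp add: Comp_eq_assoc[OF T(4)])
      have "(a \<cdot>\<^bsub>X\<^esub> pr (p \<cdot>\<^bsub>X\<^esub> pb h)) \<cdot>\<^bsub>X\<^esub> r = a \<cdot>\<^bsub>X\<^esub> s"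
        using r(1,3,5) aA ph by simp
      then show "pr h \<cdot>\<^bsub>X\<^esub> pair h e' (a \<cdot>\<^bsub>X\<^esub> s) = pr h \<cdot>\<^bsub>X\<^esub> (pm (p \<cdot>\<^bsub>X\<^esub> pb h) h a \<cdot>\<^bsub>X\<^esub> r)"
        using x(5) e'p r(1,3) T(1-3) h(1,2) Comp_eq_assoc[OF T(5), of r] by simp
    qed (use x e'p r(1-3) T(1-3) in simp_all)
    have "p \<cdot>\<^bsub>X\<^esub> e' = h \<cdot>\<^bsub>X\<^esub> c" using e'p eq by simp
    note y = pair_props[OF h(1,2) e' c(1) _ c(2)[folded h(3)] this]
    have 2: "pair h e' c = str h \<cdot>\<^bsub>X\<^esub> r"
    proof (rule pb_eqI[OF h(1,2)])
      show "pb h \<cdot>\<^bsub>X\<^esub> pair h e' c = pb h \<cdot>\<^bsub>X\<^esub> (str h \<cdot>\<^bsub>X\<^esub> r)"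
        using y(4) e'p r S(1-3) h(1,2) by (simp add: Comp_eq_assoc[OF S(4)])
      have "(pr h \<cdot>\<^bsub>X\<^esub> pr (p \<cdot>\<^bsub>X\<^esub> pb h)) \<cdot>\<^bsub>X\<^esub> r = c"
        using r(1,3,5) s(5) h(1,2) ph by simp
      then show "pr h \<cdot>\<^bsub>X\<^esub> pair h e' c = pr h \<cdot>\<^bsub>X\<^esub> (str h \<cdot>\<^bsub>X\<^esub> r)"
        using y(5) e'p r(1,3) S(1-3) h(1,2) Comp_eq_assoc[OF S(5), of r] by simp
    qed (use y e'p r(1-3) S(1-3) in simp_all)
    have "a \<cdot>\<^bsub>X\<^esub> (pm (p \<cdot>\<^bsub>X\<^esub> pb h) h a \<cdot>\<^bsub>X\<^esub> r) = (a \<cdot>\<^bsub>X\<^esub> str h) \<cdot>\<^bsub>X\<^esub> r"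
      using Comp_eq_assoc[OF aa] T(1-3) aA r(1,3) by simp
    then show "a \<cdot>\<^bsub>X\<^esub> pair h e' (a \<cdot>\<^bsub>X\<^esub> pair h e c) = a \<cdot>\<^bsub>X\<^esub> pair h e' c"
      unfolding s_def[symmetric] 1 2 using S(1-3) aA r(1,3) by simp
  qed
  ultimately show ?thesis
    unfolding descent_datum_def h_def[symmetric] using \<gamma> by blast
qed

text \<open>
  If the datum of the algebra is effective via \<open>g\<close> and \<open>\<kappa>\<close>, then \<open>\<gamma>\<close> and \<open>pb g\<close> belong to two pullbacks
  of the same pair of arrows. The canonical isomorphism between them and its inverse are algebra
  morphisms, since both structure maps leave the projection to the domain of \<open>g\<close> unchanged.
\<close>

lemma essentially_surjective_if_effective:
  assumes eff: "\<And>\<gamma> \<xi>. descent_datum X p \<gamma> \<xi> \<Longrightarrow> effective_datum X p \<gamma> \<xi>"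
  shows "essentially_surjective (slice X (Cod X p)) EM K"
  unfolding essentially_surjective_def
proof
  fix A assume "A \<in> Ob EM"
  then obtain \<gamma> a where A: "A = (\<gamma>, (pb (p \<cdot>\<^bsub>X\<^esub> \<gamma>), \<gamma>, a))" and alg: "algebra \<gamma> a"
    unfolding Ob_EM by blast
  have \<gamma>: "\<gamma> \<in> Ar X" "Cod X \<gamma> = Dom X p" using alg by (simp_all add: algebra_def)
  define h where "h = p \<cdot>\<^bsub>X\<^esub> \<gamma>"
  have h: "h \<in> Ar X" "Cod X h = Cod X p" "Dom X h = Dom X \<gamma>" using \<gamma> by (simp_all add: h_def)
  have aA: "a \<in> Ar X" "Dom X a = Dom X (pb h)" "Cod X a = Dom X \<gamma>" and \<gamma>a: "\<gamma> \<cdot>\<^bsub>X\<^esub> a = pb h"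
    using alg by (simp_all add: algebra_def Hom_iff h_def)
  obtain g \<kappa> where pull: "is_pullback X p g \<kappa> \<gamma>"
    and \<kappa>\<xi>: "\<And>e c. \<lbrakk>e \<in> Ar X; c \<in> Ar X; Cod X e = Dom X p; Cod X c = Dom X \<gamma>; p \<cdot>\<^bsub>X\<^esub> e = h \<cdot>\<^bsub>X\<^esub> c\<rbrakk> \<Longrightarrow>
      \<kappa> \<cdot>\<^bsub>X\<^esub> (a \<cdot>\<^bsub>X\<^esub> pair h e c) = \<kappa> \<cdot>\<^bsub>X\<^esub> c"
    using eff[OF descent_datum_if_algebra[OF alg]] unfolding effective_datum_def h_def by blast
  have g: "g \<in> Ar X" "Cod X g = Cod X p" and \<kappa>: "\<kappa> \<in> Ar X" "Dom X \<kappa> = Dom X \<gamma>" "Cod X \<kappa> = Dom X g"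
    "p \<cdot>\<^bsub>X\<^esub> \<gamma> = g \<cdot>\<^bsub>X\<^esub> \<kappa>" using pull by (simp_all add: is_pullback_def)
  note gen = pb_Ar(1)[OF h(1,2)] pr_Ar[OF h(1,2)] pb_Ar(2)[OF h(1,2)]
    Cod_pr[OF h(1,2), unfolded h(3)] square[OF h(1,2), symmetric]
  have "pair h (pb h) (pr h) = Id X (Dom X (pb h))"
    using pair_props[OF h(1,2) gen(1-3) Cod_pr[OF h(1,2)] gen(5)] h(1,2)
    by - (rule pb_eqI[OF h(1,2)], simp_all)
  then have \<kappa>a: "\<kappa> \<cdot>\<^bsub>X\<^esub> a = \<kappa> \<cdot>\<^bsub>X\<^esub> pr h" using \<kappa>\<xi>[OF gen] aA by simp
  define i where "i = pair g \<gamma> \<kappa>"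
  note i = pair_props[OF g \<gamma>(1) \<kappa>(1) \<gamma>(2) \<kappa>(3,4), folded i_def]
  obtain j where j: "j \<in> Ar X" "Dom X j = Dom X (pb g)" "Cod X j = Dom X \<gamma>"
    "\<gamma> \<cdot>\<^bsub>X\<^esub> j = pb g" "\<kappa> \<cdot>\<^bsub>X\<^esub> j = pr g"
    using pullback_pair[OF pull pb_Ar(1)[OF g] pr_Ar[OF g] pb_Ar(2)[OF g] Cod_pr[OF g] square[OF g, symmetric]]
      \<kappa>(2) by metis
  have ij: "i \<cdot>\<^bsub>X\<^esub> j = Id X (Dom X (pb g))"
  proof (rule pb_eqI[OF g])
    show "pb g \<cdot>\<^bsub>X\<^esub> (i \<cdot>\<^bsub>X\<^esub> j) = pb g \<cdot>\<^bsub>X\<^esub> Id X (Dom X (pb g))"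
      using i j g by (simp add: Comp_eq_assoc[OF i(4)])
    show "pr g \<cdot>\<^bsub>X\<^esub> (i \<cdot>\<^bsub>X\<^esub> j) = pr g \<cdot>\<^bsub>X\<^esub> Id X (Dom X (pb g))"
      using i j g by (simp add: Comp_eq_assoc[OF i(5)])
  qed (use i j g in simp_all)
  have ji: "j \<cdot>\<^bsub>X\<^esub> i = Id X (Dom X \<gamma>)"
  proof (rule pullback_eqI[OF pull])
    show "\<gamma> \<cdot>\<^bsub>X\<^esub> (j \<cdot>\<^bsub>X\<^esub> i) = \<gamma> \<cdot>\<^bsub>X\<^esub> Id X (Dom X \<gamma>)"
      using i j \<gamma> by (simp add: Comp_eq_assoc[OF j(4)])
    show "\<kappa> \<cdot>\<^bsub>X\<^esub> (j \<cdot>\<^bsub>X\<^esub> i) = \<kappa> \<cdot>\<^bsub>X\<^esub> Id X (Dom X \<gamma>)"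
      using i j \<kappa> by (simp add: Comp_eq_assoc[OF j(5)])
  qed (use i j \<gamma> \<kappa> in simp_all)
  have pg: "p \<cdot>\<^bsub>X\<^esub> pb g \<in> Ar X" "Cod X (p \<cdot>\<^bsub>X\<^esub> pb g) = Cod X p" "Dom X (p \<cdot>\<^bsub>X\<^esub> pb g) = Dom X (pb g)"
    using g by simp_all
  note S = str_props[OF g]
  have i_hom: "i \<cdot>\<^bsub>X\<^esub> a = str g \<cdot>\<^bsub>X\<^esub> pm h (p \<cdot>\<^bsub>X\<^esub> pb g) i"
  proof (rule pb_eqI[OF g])
    note T = pm_postcomp_props[OF pb_Ar[OF g] i(1,3) i(4)[symmetric], folded h_def]
    show "pb g \<cdot>\<^bsub>X\<^esub> (i \<cdot>\<^bsub>X\<^esub> a) = pb g \<cdot>\<^bsub>X\<^esub> (str g \<cdot>\<^bsub>X\<^esub> pm h (p \<cdot>\<^bsub>X\<^esub> pb g) i)"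
      using Comp_eq_assoc[OF i(4), of a] Comp_eq_assoc[OF S(4), of "pm h (p \<cdot>\<^bsub>X\<^esub> pb g) i"]
        i(1-3) aA \<gamma>a S(1-3) T(1-4) g by simp
    have "pr g \<cdot>\<^bsub>X\<^esub> (str g \<cdot>\<^bsub>X\<^esub> pm h (p \<cdot>\<^bsub>X\<^esub> pb g) i) = pr g \<cdot>\<^bsub>X\<^esub> (i \<cdot>\<^bsub>X\<^esub> pr h)"
      using Comp_eq_assoc[OF S(5), of "pm h (p \<cdot>\<^bsub>X\<^esub> pb g) i"] S(1-3) T(1-3,5) g pg by simp
    then show "pr g \<cdot>\<^bsub>X\<^esub> (i \<cdot>\<^bsub>X\<^esub> a) = pr g \<cdot>\<^bsub>X\<^esub> (str g \<cdot>\<^bsub>X\<^esub> pm h (p \<cdot>\<^bsub>X\<^esub> pb g) i)"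
      using Comp_eq_assoc[OF i(5), of a] Comp_eq_assoc[OF i(5), of "pr h"] i(1-3) aA \<kappa>a g h by simp
    show "i \<cdot>\<^bsub>X\<^esub> a \<in> Ar X" "Cod X (i \<cdot>\<^bsub>X\<^esub> a) = Dom X (pb g)" using i aA by simp_all
    show "str g \<cdot>\<^bsub>X\<^esub> pm h (p \<cdot>\<^bsub>X\<^esub> pb g) i \<in> Ar X"
      "Cod X (str g \<cdot>\<^bsub>X\<^esub> pm h (p \<cdot>\<^bsub>X\<^esub> pb g) i) = Dom X (pb g)"
      using S(1-3) T(1-3) by simp_all
  qed
  have j_hom: "j \<cdot>\<^bsub>X\<^esub> str g = a \<cdot>\<^bsub>X\<^esub> pm (p \<cdot>\<^bsub>X\<^esub> pb g) h j"
  proof (rule pullback_eqI[OF pull])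
    note T = pm_postcomp_props[OF \<gamma> j(1,3) j(4)[symmetric], folded h_def]
    show "\<gamma> \<cdot>\<^bsub>X\<^esub> (j \<cdot>\<^bsub>X\<^esub> str g) = \<gamma> \<cdot>\<^bsub>X\<^esub> (a \<cdot>\<^bsub>X\<^esub> pm (p \<cdot>\<^bsub>X\<^esub> pb g) h j)"
      using Comp_eq_assoc[OF j(4), of "str g"] Comp_eq_assoc[OF \<gamma>a, of "pm (p \<cdot>\<^bsub>X\<^esub> pb g) h j"]
        j(1-3) aA S(1-4) T(1-4) \<gamma> by simp
    have "\<kappa> \<cdot>\<^bsub>X\<^esub> (a \<cdot>\<^bsub>X\<^esub> pm (p \<cdot>\<^bsub>X\<^esub> pb g) h j) = \<kappa> \<cdot>\<^bsub>X\<^esub> (j \<cdot>\<^bsub>X\<^esub> pr (p \<cdot>\<^bsub>X\<^esub> pb g))"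
      using Comp_eq_assoc[OF \<kappa>a, of "pm (p \<cdot>\<^bsub>X\<^esub> pb g) h j"] aA T(1-3,5) \<kappa> h by simp
    also have "\<dots> = pr g \<cdot>\<^bsub>X\<^esub> pr (p \<cdot>\<^bsub>X\<^esub> pb g)"
      using Comp_eq_assoc[OF j(5), of "pr (p \<cdot>\<^bsub>X\<^esub> pb g)"] j(1-3) \<kappa> pg by simp
    also have "\<dots> = \<kappa> \<cdot>\<^bsub>X\<^esub> (j \<cdot>\<^bsub>X\<^esub> str g)"
      using Comp_eq_assoc[OF j(5), of "str g"] j(1-3) \<kappa> S(1-3,5) by simp
    finally show "\<kappa> \<cdot>\<^bsub>X\<^esub> (j \<cdot>\<^bsub>X\<^esub> str g) = \<kappa> \<cdot>\<^bsub>X\<^esub> (a \<cdot>\<^bsub>X\<^esub> pm (p \<cdot>\<^bsub>X\<^esub> pb g) h j)" by simp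
    show "j \<cdot>\<^bsub>X\<^esub> str g \<in> Ar X" "Cod X (j \<cdot>\<^bsub>X\<^esub> str g) = Dom X \<kappa>" using j S \<kappa> by simp_all
    show "a \<cdot>\<^bsub>X\<^esub> pm (p \<cdot>\<^bsub>X\<^esub> pb g) h j \<in> Ar X"
      "Cod X (a \<cdot>\<^bsub>X\<^esub> pm (p \<cdot>\<^bsub>X\<^esub> pb g) h j) = Dom X \<kappa>"
      using aA T(1-3) \<kappa> by simp_all
  qed
  define m where "m = (FOb K g, A, (pb g, \<gamma>, j))"
  define m' where "m' = (A, FOb K g, (\<gamma>, pb g, i))"
  have m: "m \<in> Hom EM (FOb K g) A"
    unfolding m_def A K_Ob[OF g] Hom_EM[OF algebra_K[OF g] alg] using j j_hom by (simp add: Hom_iff h_def)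
  have m': "m' \<in> Hom EM A (FOb K g)"
    unfolding m'_def A K_Ob[OF g] Hom_EM[OF alg algebra_K[OF g]] using i i_hom by (simp add: Hom_iff h_def)
  have "m' \<cdot>\<^bsub>EM\<^esub> m = Id EM (FOb K g)" "m \<cdot>\<^bsub>EM\<^esub> m' = Id EM A"
    unfolding m_def m'_def A K_Ob[OF g] using ij ji by simp_all
  then have "iso_arrow EM m" using iso_arrowI[OF m m'] by blast
  moreover have "FOb K g \<in> Ob EM" "A \<in> Ob EM"
    using algebra_K[OF g] alg unfolding Ob_EM K_Ob[OF g] A by blast+
  ultimately have "iso_objects EM (FOb K g) A" unfolding iso_objects_def using m by blast
  then show "\<exists>g \<in> Ob (slice X (Cod X p)). iso_objects EM (FOb K g) A"
    using g by (intro bexI[of _ g]) simp_all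
qed

lemma monadic_iff:
  "monadic_adjunction (slice X (Dom X p)) (slice X (Cod X p)) (slice_postcomp X p) G \<eta> \<epsilon> \<longleftrightarrow>
    (\<forall>g \<in> Ar X. Cod X g = Cod X p \<longrightarrow> quotient_over X g (pr g)) \<and>
    (\<forall>\<gamma> \<xi>. descent_datum X p \<gamma> \<xi> \<longrightarrow> effective_datum X p \<gamma> \<xi>)"
proof -
  note cats = category_slice[of "Cod X p"] category_em_cat[OF category_slice is_functor_induced_monad[OF adj]]
  have "is_equivalence (slice X (Cod X p)) EM K \<longleftrightarrow>
      fully_faithful (slice X (Cod X p)) EM K \<and> essentially_surjective (slice X (Cod X p)) EM K"
    using fully_faithful_if_equivalence[OF cats] essentially_surjective_if_equivalence
      equivalence_if_fully_faithful_essentially_surjective[OF cats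
        is_functor_comparison[OF category_slice category_slice adj]] by blast
  then show ?thesis
    unfolding monadic_adjunction_def
    using adj quotient_if_fully_faithful fully_faithful_if_quotient
      effective_if_essentially_surjective essentially_surjective_if_effective by blast
qed

end

section \<open>Effective descent as elementwise descent\<close>

text \<open>
  The right adjoint sends \<open>g\<close> to its chosen pullback. In the proof, \<open>q g u v\<close> is the arrow into that
  pullback with components \<open>u\<close> and \<open>v\<close>, and every equation is checked on the two components. The
  counit is prescribed, so that the projections of the chosen pullbacks can be recovered from it.
\<close>

lemma (in category) adjunction_if_pullbacks:
  assumes p: "p \<in> Ar X"
    and pull: "\<And>g. g \<in> Ar X \<Longrightarrow> Cod X g = Cod X p \<Longrightarrow> is_pullback X p g (\<pi> g) (b g)"
  obtains G \<eta> \<epsilon> where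
    "adjunction (slice X (Dom X p)) (slice X (Cod X p)) (slice_postcomp X p) G \<eta> \<epsilon>"
    "\<And>g. \<epsilon> g = (p \<cdot>\<^bsub>X\<^esub> b g, g, \<pi> g)"
proof -
  have P: "\<pi> g \<in> Ar X" "b g \<in> Ar X" "Dom X (\<pi> g) = Dom X (b g)" "Cod X (b g) = Dom X p"
    "Cod X (\<pi> g) = Dom X g" "g \<cdot>\<^bsub>X\<^esub> \<pi> g = p \<cdot>\<^bsub>X\<^esub> b g"
    if "g \<in> Ar X" "Cod X g = Cod X p" for g
    using pull[OF that] by (simp_all add: is_pullback_def)
  define q where "q g u v = (SOME t. t \<in> Ar X \<and> Dom X t = Dom X u \<and> Cod X t = Dom X (b g) \<and>
    b g \<cdot>\<^bsub>X\<^esub> t = u \<and> \<pi> g \<cdot>\<^bsub>X\<^esub> t = v)" for g u v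
  have q: "q g u v \<in> Ar X \<and> Dom X (q g u v) = Dom X u \<and> Cod X (q g u v) = Dom X (b g) \<and>
      b g \<cdot>\<^bsub>X\<^esub> q g u v = u \<and> \<pi> g \<cdot>\<^bsub>X\<^esub> q g u v = v"
    if H: "g \<in> Ar X" "Cod X g = Cod X p" "u \<in> Ar X" "v \<in> Ar X" "Cod X u = Dom X p" "Cod X v = Dom X g"
      "p \<cdot>\<^bsub>X\<^esub> u = g \<cdot>\<^bsub>X\<^esub> v" for g u v
  proof -
    obtain t where "t \<in> Ar X \<and> Dom X t = Dom X u \<and> Cod X t = Dom X (b g) \<and>
        b g \<cdot>\<^bsub>X\<^esub> t = u \<and> \<pi> g \<cdot>\<^bsub>X\<^esub> t = v"
      using pullback_pair[OF pull[OF H(1,2)] H(3-7)] P(3)[OF H(1,2)] by metis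
    then show ?thesis unfolding q_def by (rule someI)
  qed
  have eqI: "s = t" if "g \<in> Ar X" "Cod X g = Cod X p" "s \<in> Ar X" "t \<in> Ar X" "Cod X s = Dom X (b g)"
    "Cod X t = Dom X (b g)" "b g \<cdot>\<^bsub>X\<^esub> s = b g \<cdot>\<^bsub>X\<^esub> t" "\<pi> g \<cdot>\<^bsub>X\<^esub> s = \<pi> g \<cdot>\<^bsub>X\<^esub> t" for g s t
    using pullback_eqI[OF pull[OF that(1,2)] that(3,4)] that P(3)[OF that(1,2)] by simp
  define m where "m f g h = q g (b f) (h \<cdot>\<^bsub>X\<^esub> \<pi> f)" for f g h
  have m: "m f g h \<in> Ar X" "Dom X (m f g h) = Dom X (b f)" "Cod X (m f g h) = Dom X (b g)"
    "b g \<cdot>\<^bsub>X\<^esub> m f g h = b f" "\<pi> g \<cdot>\<^bsub>X\<^esub> m f g h = h \<cdot>\<^bsub>X\<^esub> \<pi> f"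
    if g: "g \<in> Ar X" "Cod X g = Cod X p" and h: "h \<in> Ar X" "Cod X h = Dom X g" and f: "f = g \<cdot>\<^bsub>X\<^esub> h" for f g h
  proof -
    have fA: "f \<in> Ar X" "Cod X f = Cod X p" "Dom X f = Dom X h" unfolding f using g h by simp_all
    have "p \<cdot>\<^bsub>X\<^esub> b f = g \<cdot>\<^bsub>X\<^esub> (h \<cdot>\<^bsub>X\<^esub> \<pi> f)"
      using P(6)[OF fA(1,2)] Comp_eq_assoc[OF f[symmetric] h(1) g(1) h(2) P(1)[OF fA(1,2)]]
        P(5)[OF fA(1,2)] fA(3) by simp
    then show "m f g h \<in> Ar X" "Dom X (m f g h) = Dom X (b f)" "Cod X (m f g h) = Dom X (b g)"
      "b g \<cdot>\<^bsub>X\<^esub> m f g h = b f" "\<pi> g \<cdot>\<^bsub>X\<^esub> m f g h = h \<cdot>\<^bsub>X\<^esub> \<pi> f"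
      using q[OF g, of "b f" "h \<cdot>\<^bsub>X\<^esub> \<pi> f"] P[OF fA(1,2)] fA h unfolding m_def by simp_all
  qed
  define n where "n u = q (p \<cdot>\<^bsub>X\<^esub> u) u (Id X (Dom X u))" for u
  have n: "n u \<in> Ar X" "Dom X (n u) = Dom X u" "Cod X (n u) = Dom X (b (p \<cdot>\<^bsub>X\<^esub> u))"
    "b (p \<cdot>\<^bsub>X\<^esub> u) \<cdot>\<^bsub>X\<^esub> n u = u" "\<pi> (p \<cdot>\<^bsub>X\<^esub> u) \<cdot>\<^bsub>X\<^esub> n u = Id X (Dom X u)"
    if u: "u \<in> Ar X" "Cod X u = Dom X p" for u
    using q[of "p \<cdot>\<^bsub>X\<^esub> u" u "Id X (Dom X u)"] u p unfolding n_def by simp_all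
  define G where "G = \<lparr>FOb = b, FAr = (\<lambda>(f, g, h). (b f, b g, m f g h))\<rparr>"
  define \<eta> where "\<eta> u = (u, b (p \<cdot>\<^bsub>X\<^esub> u), n u)" for u
  define \<epsilon> where "\<epsilon> g = (p \<cdot>\<^bsub>X\<^esub> b g, g, \<pi> g)" for g
  have G [simp]: "FOb G = b" "FAr G (f, g, h) = (b f, b g, m f g h)" for f g h
    by (simp_all add: G_def)
  have functor_F: "is_functor (slice X (Dom X p)) (slice X (Cod X p)) (slice_postcomp X p)"
  proof
    fix k f g assume "k \<in> Hom (slice X (Dom X p)) f g"
    then obtain h where h: "k = (f, g, h)" "g \<in> Ar X" "Cod X g = Dom X p" "h \<in> Ar X" "Cod X h = Dom X g"
      "f = g \<cdot>\<^bsub>X\<^esub> h" by (rule Hom_slice_elim)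
    then have "p \<cdot>\<^bsub>X\<^esub> f = (p \<cdot>\<^bsub>X\<^esub> g) \<cdot>\<^bsub>X\<^esub> h" using p by simp
    then show "FAr (slice_postcomp X p) k \<in> Hom (slice X (Cod X p)) (FOb (slice_postcomp X p) f)
        (FOb (slice_postcomp X p) g)"
      unfolding h(1) using Hom_sliceI[of "p \<cdot>\<^bsub>X\<^esub> g" "Cod X p" h "p \<cdot>\<^bsub>X\<^esub> f"] p h(2-5) by simp
  next
    fix k l f g h assume "k \<in> Hom (slice X (Dom X p)) f g" "l \<in> Hom (slice X (Dom X p)) g h"
    then obtain s t where "k = (f, g, s)" "l = (g, h, t)" using Hom_slice_elim by metis
    then show "FAr (slice_postcomp X p) (l \<cdot>\<^bsub>slice X (Dom X p)\<^esub> k) =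
        FAr (slice_postcomp X p) l \<cdot>\<^bsub>slice X (Cod X p)\<^esub> FAr (slice_postcomp X p) k" by simp
  qed (use p in simp_all)
  have functor_G: "is_functor (slice X (Cod X p)) (slice X (Dom X p)) G"
  proof
    fix g assume "g \<in> Ob (slice X (Cod X p))"
    then have g: "g \<in> Ar X" "Cod X g = Cod X p" by simp_all
    show "FOb G g \<in> Ob (slice X (Dom X p))" using P[OF g] by simp
    have "m g g (Id X (Dom X g)) = Id X (Dom X (b g))"
    proof (rule eqI[OF g])
      note M = m[OF g, of "Id X (Dom X g)" g]
      show "m g g (Id X (Dom X g)) \<in> Ar X" "Cod X (m g g (Id X (Dom X g))) = Dom X (b g)"
        "b g \<cdot>\<^bsub>X\<^esub> m g g (Id X (Dom X g)) = b g \<cdot>\<^bsub>X\<^esub> Id X (Dom X (b g))"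
        "\<pi> g \<cdot>\<^bsub>X\<^esub> m g g (Id X (Dom X g)) = \<pi> g \<cdot>\<^bsub>X\<^esub> Id X (Dom X (b g))"
        using M g P[OF g] by simp_all
    qed (use P[OF g] in simp_all)
    then show "FAr G (Id (slice X (Cod X p)) g) = Id (slice X (Dom X p)) (FOb G g)" by simp
  next
    fix k f g assume "k \<in> Hom (slice X (Cod X p)) f g"
    then obtain h where h: "k = (f, g, h)" "g \<in> Ar X" "Cod X g = Cod X p" "h \<in> Ar X" "Cod X h = Dom X g"
      "f = g \<cdot>\<^bsub>X\<^esub> h" by (rule Hom_slice_elim)
    then show "FAr G k \<in> Hom (slice X (Dom X p)) (FOb G f) (FOb G g)"
      unfolding h(1) using Hom_sliceI[of "b g" "Dom X p" "m f g h" "b f"] m[OF h(2-6)] P[OF h(2,3)] by simp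
  next
    fix k l f g h assume k: "k \<in> Hom (slice X (Cod X p)) f g" and l: "l \<in> Hom (slice X (Cod X p)) g h"
    obtain s where s: "k = (f, g, s)" "g \<in> Ar X" "Cod X g = Cod X p" "s \<in> Ar X" "Cod X s = Dom X g"
      "f = g \<cdot>\<^bsub>X\<^esub> s" using k by (rule Hom_slice_elim)
    obtain t where t: "l = (g, h, t)" "h \<in> Ar X" "Cod X h = Cod X p" "t \<in> Ar X" "Cod X t = Dom X h"
      "g = h \<cdot>\<^bsub>X\<^esub> t" using l by (rule Hom_slice_elim)
    have Dg: "Dom X g = Dom X t" unfolding t(6) using t(2-5) by simp
    have f: "f = h \<cdot>\<^bsub>X\<^esub> (t \<cdot>\<^bsub>X\<^esub> s)" using s(4,5) Dg t(2-5) unfolding s(6) t(6) by simp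
    have fA: "f \<in> Ar X" "Cod X f = Cod X p" "Dom X f = Dom X s"
      unfolding s(6) using s(2-5) by simp_all
    have ts: "t \<cdot>\<^bsub>X\<^esub> s \<in> Ar X" "Cod X (t \<cdot>\<^bsub>X\<^esub> s) = Dom X h" using s(4,5) Dg t(2-5) by simp_all
    note M = m[OF t(2,3) ts f] and Ms = m[OF s(2-6)] and Mt = m[OF t(2-6)]
    have "m f h (t \<cdot>\<^bsub>X\<^esub> s) = m g h t \<cdot>\<^bsub>X\<^esub> m f g s"
    proof (rule eqI[OF t(2,3)])
      show "b h \<cdot>\<^bsub>X\<^esub> m f h (t \<cdot>\<^bsub>X\<^esub> s) = b h \<cdot>\<^bsub>X\<^esub> (m g h t \<cdot>\<^bsub>X\<^esub> m f g s)"
        using M(4) Comp_eq_assoc[OF Mt(4), of "m f g s"] Mt(1-3) Ms(1-4) P[OF t(2,3)] by simp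
      have "(t \<cdot>\<^bsub>X\<^esub> \<pi> g) \<cdot>\<^bsub>X\<^esub> m f g s = t \<cdot>\<^bsub>X\<^esub> (s \<cdot>\<^bsub>X\<^esub> \<pi> f)"
        using Ms(1-3,5) P[OF s(2,3)] t(4,5) Dg by simp
      then show "\<pi> h \<cdot>\<^bsub>X\<^esub> m f h (t \<cdot>\<^bsub>X\<^esub> s) = \<pi> h \<cdot>\<^bsub>X\<^esub> (m g h t \<cdot>\<^bsub>X\<^esub> m f g s)"
        using M(5) Comp_eq_assoc[OF Mt(5), of "m f g s"] Mt(1-3) Ms(1-3) P(1-5)[OF t(2,3)]
          P(1-5)[OF fA(1,2)] s(4,5) t(4,5) Dg fA(3) by simp
    qed (use M Ms Mt in simp_all)
    then show "FAr G (l \<cdot>\<^bsub>slice X (Cod X p)\<^esub> k) = FAr G l \<cdot>\<^bsub>slice X (Dom X p)\<^esub> FAr G k"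
      unfolding s(1) t(1) by simp
  qed
  have nat_\<eta>: "nat_trans (slice X (Dom X p)) (slice X (Dom X p)) id_fun (comp_fun G (slice_postcomp X p)) \<eta>"
    unfolding nat_trans_def
  proof (intro conjI ballI allI)
    fix u assume "u \<in> Ob (slice X (Dom X p))"
    then have u: "u \<in> Ar X" "Cod X u = Dom X p" by simp_all
    then have pu: "p \<cdot>\<^bsub>X\<^esub> u \<in> Ar X" "Cod X (p \<cdot>\<^bsub>X\<^esub> u) = Cod X p" using p by simp_all
    show "\<eta> u \<in> Hom (slice X (Dom X p)) (FOb id_fun u) (FOb (comp_fun G (slice_postcomp X p)) u)"
      using Hom_sliceI[OF P(2,4)[OF pu] n(1,3)[OF u] n(4)[OF u, symmetric]]
      by (simp add: \<eta>_def id_fun_def comp_fun_def)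
  next
    fix u v k assume "k \<in> Hom (slice X (Dom X p)) u v"
    then obtain h where h: "k = (u, v, h)" "v \<in> Ar X" "Cod X v = Dom X p" "h \<in> Ar X" "Cod X h = Dom X v"
      "u = v \<cdot>\<^bsub>X\<^esub> h" by (rule Hom_slice_elim)
    have u: "u \<in> Ar X" "Cod X u = Dom X p" "Dom X u = Dom X h" unfolding h(6) using h(2-5) by simp_all
    have pu: "p \<cdot>\<^bsub>X\<^esub> u \<in> Ar X" "Cod X (p \<cdot>\<^bsub>X\<^esub> u) = Cod X p" "Dom X (p \<cdot>\<^bsub>X\<^esub> u) = Dom X h" using p u by simp_all
    have pv: "p \<cdot>\<^bsub>X\<^esub> v \<in> Ar X" "Cod X (p \<cdot>\<^bsub>X\<^esub> v) = Cod X p" "Dom X (p \<cdot>\<^bsub>X\<^esub> v) = Dom X v" using p h by simp_all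
    have puv: "p \<cdot>\<^bsub>X\<^esub> u = (p \<cdot>\<^bsub>X\<^esub> v) \<cdot>\<^bsub>X\<^esub> h" unfolding h(6) using p h(2-5) by simp
    note M = m[OF pv(1,2) h(4) h(5)[folded pv(3)] puv] and N = n[OF u(1,2)] and N' = n[OF h(2,3)]
    have "n v \<cdot>\<^bsub>X\<^esub> h = m (p \<cdot>\<^bsub>X\<^esub> u) (p \<cdot>\<^bsub>X\<^esub> v) h \<cdot>\<^bsub>X\<^esub> n u"
    proof (rule eqI[OF pv(1,2)])
      show "b (p \<cdot>\<^bsub>X\<^esub> v) \<cdot>\<^bsub>X\<^esub> (n v \<cdot>\<^bsub>X\<^esub> h) = b (p \<cdot>\<^bsub>X\<^esub> v) \<cdot>\<^bsub>X\<^esub> (m (p \<cdot>\<^bsub>X\<^esub> u) (p \<cdot>\<^bsub>X\<^esub> v) h \<cdot>\<^bsub>X\<^esub> n u)"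
        using Comp_eq_assoc[OF N'(4), of h] Comp_eq_assoc[OF M(4), of "n u"] N'(1-3) M(1-3) N(1-4)
          h(4,5) h(6)[symmetric] P[OF pv(1,2)] by simp
      have "(h \<cdot>\<^bsub>X\<^esub> \<pi> (p \<cdot>\<^bsub>X\<^esub> u)) \<cdot>\<^bsub>X\<^esub> n u = h"
        using N(1-3,5) P[OF pu(1,2)] pu(3) u(3) h(4) by simp
      then show "\<pi> (p \<cdot>\<^bsub>X\<^esub> v) \<cdot>\<^bsub>X\<^esub> (n v \<cdot>\<^bsub>X\<^esub> h) = \<pi> (p \<cdot>\<^bsub>X\<^esub> v) \<cdot>\<^bsub>X\<^esub> (m (p \<cdot>\<^bsub>X\<^esub> u) (p \<cdot>\<^bsub>X\<^esub> v) h \<cdot>\<^bsub>X\<^esub> n u)"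
        using Comp_eq_assoc[OF N'(5), of h] Comp_eq_assoc[OF M(5), of "n u"] N'(1-3) M(1-3) N(1-3)
          h(4,5) P(1-5)[OF pv(1,2)] by simp
    qed (use N' M(1-3) N h(4,5) in simp_all)
    then show "\<eta> v \<cdot>\<^bsub>slice X (Dom X p)\<^esub> FAr id_fun k =
        FAr (comp_fun G (slice_postcomp X p)) k \<cdot>\<^bsub>slice X (Dom X p)\<^esub> \<eta> u"
      unfolding h(1) by (simp add: \<eta>_def id_fun_def comp_fun_def)
  qed
  have nat_\<epsilon>: "nat_trans (slice X (Cod X p)) (slice X (Cod X p)) (comp_fun (slice_postcomp X p) G) id_fun \<epsilon>"
    unfolding nat_trans_def
  proof (intro conjI ballI allI)
    fix g assume "g \<in> Ob (slice X (Cod X p))"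
    then have g: "g \<in> Ar X" "Cod X g = Cod X p" by simp_all
    show "\<epsilon> g \<in> Hom (slice X (Cod X p)) (FOb (comp_fun (slice_postcomp X p) G) g) (FOb id_fun g)"
      using Hom_sliceI[OF g P(1,5)[OF g] P(6)[OF g, symmetric]]
      by (simp add: \<epsilon>_def id_fun_def comp_fun_def)
  next
    fix f g k assume "k \<in> Hom (slice X (Cod X p)) f g"
    then obtain h where h: "k = (f, g, h)" "g \<in> Ar X" "Cod X g = Cod X p" "h \<in> Ar X" "Cod X h = Dom X g"
      "f = g \<cdot>\<^bsub>X\<^esub> h" by (rule Hom_slice_elim)
    show "\<epsilon> g \<cdot>\<^bsub>slice X (Cod X p)\<^esub> FAr (comp_fun (slice_postcomp X p) G) k =
        FAr id_fun k \<cdot>\<^bsub>slice X (Cod X p)\<^esub> \<epsilon> f"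
      unfolding h(1) using m(5)[OF h(2-6)] by (simp add: \<epsilon>_def id_fun_def comp_fun_def)
  qed
  have triangle_F: "\<epsilon> (p \<cdot>\<^bsub>X\<^esub> u) \<cdot>\<^bsub>slice X (Cod X p)\<^esub> FAr (slice_postcomp X p) (\<eta> u) =
      Id (slice X (Cod X p)) (p \<cdot>\<^bsub>X\<^esub> u)" if "u \<in> Ob (slice X (Dom X p))" for u
    using that n(5)[of u] p by (simp add: \<epsilon>_def \<eta>_def)
  have triangle_G: "FAr G (\<epsilon> g) \<cdot>\<^bsub>slice X (Dom X p)\<^esub> \<eta> (b g) = Id (slice X (Dom X p)) (b g)"
    if "g \<in> Ob (slice X (Cod X p))" for g
  proof -
    have g: "g \<in> Ar X" "Cod X g = Cod X p" using that by simp_all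
    note Pg = P[OF g]
    have pg: "p \<cdot>\<^bsub>X\<^esub> b g \<in> Ar X" "Cod X (p \<cdot>\<^bsub>X\<^esub> b g) = Cod X p" "Dom X (p \<cdot>\<^bsub>X\<^esub> b g) = Dom X (b g)"
      using Pg p by simp_all
    note M = m[OF g Pg(1,5) Pg(6)[symmetric]] and N = n[OF Pg(2,4)]
    have "m (p \<cdot>\<^bsub>X\<^esub> b g) g (\<pi> g) \<cdot>\<^bsub>X\<^esub> n (b g) = Id X (Dom X (b g))"
    proof (rule eqI[OF g])
      show "b g \<cdot>\<^bsub>X\<^esub> (m (p \<cdot>\<^bsub>X\<^esub> b g) g (\<pi> g) \<cdot>\<^bsub>X\<^esub> n (b g)) = b g \<cdot>\<^bsub>X\<^esub> Id X (Dom X (b g))"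
        using Comp_eq_assoc[OF M(4), of "n (b g)"] M(1-3) N(1-4) Pg by simp
      have "(\<pi> g \<cdot>\<^bsub>X\<^esub> \<pi> (p \<cdot>\<^bsub>X\<^esub> b g)) \<cdot>\<^bsub>X\<^esub> n (b g) = \<pi> g"
        using N(1-3,5) P[OF pg(1,2)] pg(3) Pg by simp
      then show "\<pi> g \<cdot>\<^bsub>X\<^esub> (m (p \<cdot>\<^bsub>X\<^esub> b g) g (\<pi> g) \<cdot>\<^bsub>X\<^esub> n (b g)) = \<pi> g \<cdot>\<^bsub>X\<^esub> Id X (Dom X (b g))"
        using Comp_eq_assoc[OF M(5), of "n (b g)"] M(1-3) N(1-3) Pg by simp
    qed (use M(1-3) N Pg in simp_all)
    then show ?thesis by (simp add: \<epsilon>_def \<eta>_def)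
  qed
  have "adjunction (slice X (Dom X p)) (slice X (Cod X p)) (slice_postcomp X p) G \<eta> \<epsilon>"
    unfolding adjunction_def G(1) slice_postcomp_simps(1)
    using functor_F functor_G nat_\<eta> nat_\<epsilon> triangle_F triangle_G by blast
  then show thesis by (rule that) (simp_all add: \<epsilon>_def)
qed

theorem effective_descent_iff_elementwise:
  assumes "category X"
  shows "effective_descent X p \<longleftrightarrow> elementwise_descent X p"
proof
  interpret category X by fact
  assume eff: "effective_descent X p"
  then obtain G \<eta> \<epsilon> where p: "p \<in> Ar X" and mon: "monadic_adjunction (slice X (Dom X p))
      (slice X (Cod X p)) (slice_postcomp X p) G \<eta> \<epsilon>"
    unfolding effective_descent_def by blast
  interpret base_change X p G \<eta> \<epsilon>
    using p mon by unfold_locales (simp_all add: monadic_adjunction_def)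
  show "elementwise_descent X p"
    unfolding elementwise_descent_def using p mon[unfolded monadic_iff] pb_is_pullback by blast
next
  interpret category X by fact
  assume elt: "elementwise_descent X p"
  then have p: "p \<in> Ar X" by (simp add: elementwise_descent_def)
  have "\<forall>g. \<exists>p' g'. g \<in> Ar X \<longrightarrow> Cod X g = Cod X p \<longrightarrow> is_pullback X p g p' g' \<and> quotient_over X g p'"
    using elt unfolding elementwise_descent_def by blast
  then obtain \<pi> b where pull: "\<And>g. g \<in> Ar X \<Longrightarrow> Cod X g = Cod X p \<Longrightarrow> is_pullback X p g (\<pi> g) (b g)"
    and quot: "\<And>g. g \<in> Ar X \<Longrightarrow> Cod X g = Cod X p \<Longrightarrow> quotient_over X g (\<pi> g)"
    by metis
  obtain G \<eta> \<epsilon> where adj: "adjunction (slice X (Dom X p)) (slice X (Cod X p)) (slice_postcomp X p) G \<eta> \<epsilon>"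
    and \<epsilon>: "\<And>g. \<epsilon> g = (p \<cdot>\<^bsub>X\<^esub> b g, g, \<pi> g)"
    using adjunction_if_pullbacks[OF p pull] by metis
  interpret base_change X p G \<eta> \<epsilon>
    using p adj by unfold_locales simp_all
  have "pr g = \<pi> g" for g by (simp add: pr_def \<epsilon>)
  then have "monadic_adjunction (slice X (Dom X p)) (slice X (Cod X p)) (slice_postcomp X p) G \<eta> \<epsilon>"
    unfolding monadic_iff using quot elt by (simp add: elementwise_descent_def)
  then show "effective_descent X p"
    unfolding effective_descent_def using p pull by blast
qed

section \<open>Transfer along a functor with a coreflective sieve\<close>

text \<open>
  The functor \<open>P\<close> is bijective on arrows out of objects of \<open>I\<close>, and every object of \<open>B\<close> is the image of
  one of them. Choosing such an object for every \<open>x\<close> gives a left adjoint of \<open>P\<close> with identity unit;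
  the assumptions avoid the choice.
\<close>

locale coreflective_sieve = X: category X + B: category B + P: is_functor X B P
  for X :: "('o, 'm) cat_data" and B :: "('p, 'n) cat_data" and P :: "('o, 'm, 'p, 'n) fun_data" +
  fixes I :: "'o set"
  assumes sieve: "f \<in> Ar X \<Longrightarrow> Cod X f \<in> I \<Longrightarrow> Dom X f \<in> I"
    and bij: "c \<in> I \<Longrightarrow> d \<in> Ob X \<Longrightarrow> bij_betw (FAr P) (Hom X c d) (Hom B (FOb P c) (FOb P d))"
    and cover: "x \<in> Ob B \<Longrightarrow> \<exists>c \<in> I. c \<in> Ob X \<and> FOb P c = x"
begin

lemma P_simps [simp]:
  assumes "f \<in> Ar X"
  shows "FAr P f \<in> Ar B" "Dom B (FAr P f) = FOb P (Dom X f)" "Cod B (FAr P f) = FOb P (Cod X f)"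
  using P.FAr_Hom[of f "Dom X f" "Cod X f"] assms by (auto simp: Hom_iff)

lemma P_Comp [simp]:
  "f \<in> Ar X \<Longrightarrow> g \<in> Ar X \<Longrightarrow> Cod X f = Dom X g \<Longrightarrow>
    FAr P (g \<cdot>\<^bsub>X\<^esub> f) = FAr P g \<cdot>\<^bsub>B\<^esub> FAr P f"
  using P.FAr_Comp[of f "Dom X f" "Cod X f" g "Cod X g"] by (simp add: Hom_iff)

lemma lift:
  assumes "c \<in> I" "d \<in> Ob X" "f \<in> Ar B" "Dom B f = FOb P c" "Cod B f = FOb P d"
  obtains t where "t \<in> Ar X" "Dom X t = c" "Cod X t = d" "FAr P t = f"
proof -
  have "f \<in> FAr P ` Hom X c d"
    using bij[OF assms(1,2)] assms(3-5) by (simp add: bij_betw_def Hom_iff)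
  then show thesis using that by (auto simp: Hom_iff)
qed

lemma lift_unique:
  assumes "s \<in> Ar X" "t \<in> Ar X" "Dom X s \<in> I" "Dom X t = Dom X s" "Cod X s = Cod X t"
    "FAr P s = FAr P t"
  shows "s = t"
proof -
  have "inj_on (FAr P) (Hom X (Dom X s) (Cod X s))"
    using bij[OF assms(3), of "Cod X s"] assms(1) by (simp add: bij_betw_def)
  then show ?thesis using assms by (auto simp: inj_on_def Hom_iff)
qed

text \<open>As \<open>P\<close> is a right adjoint: every cone in \<open>B\<close> is the image of a unique cone with vertex in \<open>I\<close>.\<close>

lemma preserves_pullback:
  assumes "is_pullback X p g p' g'"
  shows "is_pullback B (FAr P p) (FAr P g) (FAr P p') (FAr P g')"
proof -
  note A = X.pullback_arrows[OF assms]
  have sq: "FAr P p \<cdot>\<^bsub>B\<^esub> FAr P g' = FAr P g \<cdot>\<^bsub>B\<^esub> FAr P p'"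
    using A P_Comp by metis
  have "\<exists>!t. t \<in> Hom B w (FOb P (Dom X p')) \<and> FAr P g' \<cdot>\<^bsub>B\<^esub> t = u \<and> FAr P p' \<cdot>\<^bsub>B\<^esub> t = v"
    if u: "u \<in> Hom B w (FOb P (Dom X p))" and v: "v \<in> Hom B w (FOb P (Dom X g))"
      and eq: "FAr P p \<cdot>\<^bsub>B\<^esub> u = FAr P g \<cdot>\<^bsub>B\<^esub> v" for w u v
  proof -
    have uv: "u \<in> Ar B" "Dom B u = w" "Cod B u = FOb P (Dom X p)"
      "v \<in> Ar B" "Dom B v = w" "Cod B v = FOb P (Dom X g)"
      using u v by (auto simp: Hom_iff)
    have "w \<in> Ob B" using uv(1,2) B.Ar_Ob(1) by blast
    then obtain c where c: "c \<in> I" "c \<in> Ob X" "FOb P c = w" using cover by blast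
    obtain u' where u': "u' \<in> Ar X" "Dom X u' = c" "Cod X u' = Dom X p" "FAr P u' = u"
      using lift[OF c(1) _ uv(1)] uv c(3) A(1) by (metis X.Ar_Ob(1))
    obtain v' where v': "v' \<in> Ar X" "Dom X v' = c" "Cod X v' = Dom X g" "FAr P v' = v"
      using lift[OF c(1) _ uv(4)] uv c(3) A(2) by (metis X.Ar_Ob(1))
    have "p \<cdot>\<^bsub>X\<^esub> u' = g \<cdot>\<^bsub>X\<^esub> v'"
      using u' v' A c(1) eq by (intro lift_unique) simp_all
    then obtain t where t: "t \<in> Ar X" "Dom X t = c" "Cod X t = Dom X p'" "g' \<cdot>\<^bsub>X\<^esub> t = u'" "p' \<cdot>\<^bsub>X\<^esub> t = v'"
      using X.pullback_pair[OF assms u'(1) v'(1) u'(3) v'(3)] u'(2) by metis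
    show ?thesis
    proof (rule ex1I[of _ "FAr P t"], intro conjI)
      show "FAr P t \<in> Hom B w (FOb P (Dom X p'))" using t(1-3) c(3) by (simp add: Hom_iff)
      show "FAr P g' \<cdot>\<^bsub>B\<^esub> FAr P t = u" using P_Comp[OF t(1) A(4)] t(3-4) A(5) u'(4) by simp
      show "FAr P p' \<cdot>\<^bsub>B\<^esub> FAr P t = v" using P_Comp[OF t(1) A(3)] t(3,5) v'(4) by simp
    next
      fix s assume s: "s \<in> Hom B w (FOb P (Dom X p')) \<and> FAr P g' \<cdot>\<^bsub>B\<^esub> s = u \<and> FAr P p' \<cdot>\<^bsub>B\<^esub> s = v"
      then have sA: "s \<in> Ar B" "Dom B s = FOb P c" "Cod B s = FOb P (Dom X p')"
        using c(3) by (auto simp: Hom_iff)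
      obtain s' where s': "s' \<in> Ar X" "Dom X s' = c" "Cod X s' = Dom X p'" "FAr P s' = s"
        using lift[OF c(1) X.Ar_Ob(1)[OF A(3)] sA] by metis
      have "g' \<cdot>\<^bsub>X\<^esub> s' = u'"
        using s s' A u' c(1) by (intro lift_unique) simp_all
      moreover have "p' \<cdot>\<^bsub>X\<^esub> s' = v'"
        using s s' A v' c(1) by (intro lift_unique) simp_all
      ultimately have "s' = t"
        using X.pullback_eqI[OF assms s'(1) t(1) s'(3) t(3)] t(4,5) by simp
      then show "s = FAr P t" using s'(4) by simp
    qed
  qed
  then show ?thesis unfolding is_pullback_def using A sq by simp
qed

text \<open>
  Since \<open>I\<close> is a sieve, \<open>q\<close> and all elements of its kernel pair have their domains in \<open>I\<close>. So a map
  \<open>h\<close> in \<open>B\<close> that respects the image of the kernel pair lifts to one that respects the kernel pair.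
\<close>

lemma quotient_over_image:
  assumes q: "quotient_over X g q" and g: "g \<in> Ar X" "Dom X g \<in> I" and qA: "q \<in> Ar X" "Cod X q = Dom X g"
  shows "quotient_over B (FAr P g) (FAr P q)"
  unfolding quotient_over_def
proof (intro allI impI, elim conjE)
  fix r h
  assume r: "r \<in> Ar B" "Cod B r = Cod B (FAr P g)" and h: "h \<in> Hom B (Dom B (FAr P q)) (Dom B r)"
    and eq: "r \<cdot>\<^bsub>B\<^esub> h = FAr P g \<cdot>\<^bsub>B\<^esub> FAr P q"
    and ker: "kernel_invariant B (FAr P q) h"
  have Dq: "Dom X q \<in> I" using sieve[OF qA(1)] qA(2) g(2) by simp
  have hA: "h \<in> Ar B" "Dom B h = FOb P (Dom X q)" "Cod B h = Dom B r" using h qA by (auto simp: Hom_iff)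
  obtain c where c: "c \<in> I" "c \<in> Ob X" "FOb P c = Dom B r" using cover[OF B.Ar_Ob(1)[OF r(1)]] by blast
  obtain r' where r': "r' \<in> Ar X" "Dom X r' = c" "Cod X r' = Cod X g" "FAr P r' = r"
    using lift[OF c(1) X.Ar_Ob(2)[OF g(1)] r(1) c(3)[symmetric]] r(2) g(1) by auto
  obtain h' where h': "h' \<in> Ar X" "Dom X h' = Dom X q" "Cod X h' = c" "FAr P h' = h"
    using lift[OF Dq c(2) hA(1,2)] hA(3) c(3) by auto
  have eq': "r' \<cdot>\<^bsub>X\<^esub> h' = g \<cdot>\<^bsub>X\<^esub> q"
    using r' h' g qA Dq eq by (intro lift_unique) simp_all
  have ker': "h' \<cdot>\<^bsub>X\<^esub> u = h' \<cdot>\<^bsub>X\<^esub> v"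
    if u: "u \<in> Hom X w (Dom X q)" and v: "v \<in> Hom X w (Dom X q)" and uv: "q \<cdot>\<^bsub>X\<^esub> u = q \<cdot>\<^bsub>X\<^esub> v" for w u v
  proof (rule lift_unique)
    have U: "u \<in> Ar X" "Dom X u = w" "Cod X u = Dom X q" "v \<in> Ar X" "Dom X v = w" "Cod X v = Dom X q"
      using u v by (auto simp: Hom_iff)
    have "w \<in> I" using sieve[OF U(1)] U(2,3) Dq by simp
    then show "Dom X (h' \<cdot>\<^bsub>X\<^esub> u) \<in> I" using U h' by simp
    show "h' \<cdot>\<^bsub>X\<^esub> u \<in> Ar X" "h' \<cdot>\<^bsub>X\<^esub> v \<in> Ar X" "Dom X (h' \<cdot>\<^bsub>X\<^esub> v) = Dom X (h' \<cdot>\<^bsub>X\<^esub> u)"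
      "Cod X (h' \<cdot>\<^bsub>X\<^esub> u) = Cod X (h' \<cdot>\<^bsub>X\<^esub> v)" using U h' by simp_all
    have "FAr P q \<cdot>\<^bsub>B\<^esub> FAr P u = FAr P q \<cdot>\<^bsub>B\<^esub> FAr P v"
      using P_Comp[OF U(1) qA(1) U(3)] P_Comp[OF U(4) qA(1) U(6)] uv by simp
    moreover have "FAr P u \<in> Hom B (FOb P w) (Dom B (FAr P q))" "FAr P v \<in> Hom B (FOb P w) (Dom B (FAr P q))"
      using U qA by (simp_all add: Hom_iff)
    ultimately have "h \<cdot>\<^bsub>B\<^esub> FAr P u = h \<cdot>\<^bsub>B\<^esub> FAr P v"
      using ker unfolding kernel_invariant_def by blast
    then show "FAr P (h' \<cdot>\<^bsub>X\<^esub> u) = FAr P (h' \<cdot>\<^bsub>X\<^esub> v)" using U h' by simp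
  qed
  then have ker'': "kernel_invariant X q h'" unfolding kernel_invariant_def by blast
  have "h' \<in> Hom X (Dom X q) (Dom X r')" using h' r' by (simp add: Hom_iff)
  then have "\<exists>!k. k \<in> Hom X (Dom X g) (Dom X r') \<and> r' \<cdot>\<^bsub>X\<^esub> k = g \<and> k \<cdot>\<^bsub>X\<^esub> q = h'"
    using q[unfolded quotient_over_def, rule_format, of r' h'] r'(1,3) eq' ker'' by blast
  then obtain k where k: "k \<in> Hom X (Dom X g) (Dom X r')" "r' \<cdot>\<^bsub>X\<^esub> k = g" "k \<cdot>\<^bsub>X\<^esub> q = h'"
    and k_unique: "\<And>l. l \<in> Hom X (Dom X g) (Dom X r') \<Longrightarrow> r' \<cdot>\<^bsub>X\<^esub> l = g \<Longrightarrow> l \<cdot>\<^bsub>X\<^esub> q = h' \<Longrightarrow> l = k"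
    by blast
  have kA: "k \<in> Ar X" "Dom X k = Dom X g" "Cod X k = c" using k(1) r'(2) by (auto simp: Hom_iff)
  show "\<exists>!k. k \<in> Hom B (Dom B (FAr P g)) (Dom B r) \<and> r \<cdot>\<^bsub>B\<^esub> k = FAr P g \<and> k \<cdot>\<^bsub>B\<^esub> FAr P q = h"
  proof (rule ex1I[of _ "FAr P k"], intro conjI)
    show "FAr P k \<in> Hom B (Dom B (FAr P g)) (Dom B r)" using kA c(3) g by (simp add: Hom_iff)
    show "r \<cdot>\<^bsub>B\<^esub> FAr P k = FAr P g" using P_Comp[OF kA(1) r'(1)] kA(3) r'(2,4) k(2) by simp
    show "FAr P k \<cdot>\<^bsub>B\<^esub> FAr P q = h" using P_Comp[OF qA(1) kA(1)] kA(2) qA(2) k(3) h'(4) by simp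
  next
    fix l assume l: "l \<in> Hom B (Dom B (FAr P g)) (Dom B r) \<and> r \<cdot>\<^bsub>B\<^esub> l = FAr P g \<and> l \<cdot>\<^bsub>B\<^esub> FAr P q = h"
    then have lA: "l \<in> Ar B" "Dom B l = FOb P (Dom X g)" "Cod B l = FOb P c"
      using g c(3) by (auto simp: Hom_iff)
    obtain l' where l': "l' \<in> Ar X" "Dom X l' = Dom X g" "Cod X l' = c" "FAr P l' = l"
      using lift[OF g(2) c(2) lA] by metis
    have "r' \<cdot>\<^bsub>X\<^esub> l' = g" using l l' r' g by (intro lift_unique) simp_all
    moreover have "l' \<cdot>\<^bsub>X\<^esub> q = h'" using l l' h' qA Dq by (intro lift_unique) simp_all
    ultimately have "l' = k" using k_unique l' r'(2) by (simp add: Hom_iff)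
    then show "l = FAr P k" using l'(4) by simp
  qed
qed

text \<open>
  Let \<open>C\<close> in \<open>I\<close> lie over the domain of \<open>\<gamma>\<close>. A generalised element \<open>c\<close> of \<open>C\<close> has its domain in the
  sieve \<open>I\<close>, hence \<open>\<xi> (P e) (P c)\<close> lifts to a unique arrow \<open>\<xi>' e c\<close>. This is a descent datum because
  the laws hold after applying \<open>P\<close>. If it comes from \<open>g\<close> and \<open>\<kappa>\<close>, then \<open>\<xi>\<close> comes from \<open>P g\<close> and
  \<open>P \<kappa>\<close>.
\<close>

lemma effective_datum_image:
  assumes p: "p \<in> Ar X" and eff: "\<And>\<gamma> \<xi>. descent_datum X p \<gamma> \<xi> \<Longrightarrow> effective_datum X p \<gamma> \<xi>"
    and datum: "descent_datum B (FAr P p) \<gamma> \<xi>"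
  shows "effective_datum B (FAr P p) \<gamma> \<xi>"
proof -
  have \<gamma>: "\<gamma> \<in> Ar B" "Cod B \<gamma> = FOb P (Dom X p)" using datum p by (simp_all add: descent_datum_def)
  obtain C where C: "C \<in> I" "C \<in> Ob X" "FOb P C = Dom B \<gamma>" using cover[OF B.Ar_Ob(1)[OF \<gamma>(1)]] by blast
  obtain \<gamma>' where \<gamma>': "\<gamma>' \<in> Ar X" "Dom X \<gamma>' = C" "Cod X \<gamma>' = Dom X p" "FAr P \<gamma>' = \<gamma>"
    using lift[OF C(1) X.Ar_Ob(1)[OF p] \<gamma>(1) C(3)[symmetric] \<gamma>(2)] by metis
  define \<xi>' where "\<xi>' e c = (SOME t. t \<in> Ar X \<and> Dom X t = Dom X e \<and> Cod X t = C \<and>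
    FAr P t = \<xi> (FAr P e) (FAr P c))" for e c
  have valid: "FAr P p \<cdot>\<^bsub>B\<^esub> FAr P e = (FAr P p \<cdot>\<^bsub>B\<^esub> \<gamma>) \<cdot>\<^bsub>B\<^esub> FAr P c"
    if "e \<in> Ar X" "c \<in> Ar X" "Cod X e = Dom X p" "Cod X c = C" "p \<cdot>\<^bsub>X\<^esub> e = (p \<cdot>\<^bsub>X\<^esub> \<gamma>') \<cdot>\<^bsub>X\<^esub> c" for e c
  proof -
    have "FAr P (p \<cdot>\<^bsub>X\<^esub> e) = FAr P ((p \<cdot>\<^bsub>X\<^esub> \<gamma>') \<cdot>\<^bsub>X\<^esub> c)" using that(5) by simp
    then show ?thesis
      using P_Comp[OF that(1) p that(3)] P_Comp[OF that(2), of "p \<cdot>\<^bsub>X\<^esub> \<gamma>'"] P_Comp[OF \<gamma>'(1) p \<gamma>'(3)]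
        that(4) \<gamma>' p by simp
  qed
  have DomI: "Dom X e = Dom X c \<and> Dom X c \<in> I \<and> Dom X e \<in> I"
    if "e \<in> Ar X" "c \<in> Ar X" "Cod X e = Dom X p" "Cod X c = C" "p \<cdot>\<^bsub>X\<^esub> e = (p \<cdot>\<^bsub>X\<^esub> \<gamma>') \<cdot>\<^bsub>X\<^esub> c" for e c
  proof -
    have "p \<cdot>\<^bsub>X\<^esub> \<gamma>' \<in> Ar X" "Dom X (p \<cdot>\<^bsub>X\<^esub> \<gamma>') = C" using p \<gamma>' by simp_all
    then have "Dom X e = Dom X c"
      using X.Comp_simps(2)[OF that(1) p that(3)] X.Comp_simps(2)[OF that(2), of "p \<cdot>\<^bsub>X\<^esub> \<gamma>'"] that(4,5) by simp
    then show ?thesis using sieve[OF that(2)] that(4) C(1) by simp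
  qed
  have \<xi>': "\<xi>' e c \<in> Ar X \<and> Dom X (\<xi>' e c) = Dom X e \<and> Cod X (\<xi>' e c) = C \<and>
      FAr P (\<xi>' e c) = \<xi> (FAr P e) (FAr P c)"
    if H: "e \<in> Ar X" "c \<in> Ar X" "Cod X e = Dom X p" "Cod X c = C" "p \<cdot>\<^bsub>X\<^esub> e = (p \<cdot>\<^bsub>X\<^esub> \<gamma>') \<cdot>\<^bsub>X\<^esub> c" for e c
  proof -
    have "\<xi> (FAr P e) (FAr P c) \<in> Hom B (Dom B (FAr P e)) (Dom B \<gamma>)"
      using descent_datumD(1)[OF datum _ _ _ _ valid[OF H]] H p C(3) by simp
    then have "\<xi> (FAr P e) (FAr P c) \<in> Ar B" "Dom B (\<xi> (FAr P e) (FAr P c)) = FOb P (Dom X e)"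
      "Cod B (\<xi> (FAr P e) (FAr P c)) = FOb P C" using H C(3) by (auto simp: Hom_iff)
    then obtain t where "t \<in> Ar X \<and> Dom X t = Dom X e \<and> Cod X t = C \<and> FAr P t = \<xi> (FAr P e) (FAr P c)"
      using lift[OF conjunct2[OF conjunct2[OF DomI[OF H]]] C(2)] by metis
    then show ?thesis unfolding \<xi>'_def by (rule someI)
  qed
  have "descent_datum X p \<gamma>' \<xi>'"
    unfolding descent_datum_def
  proof (intro conjI ballI impI)
    show "\<gamma>' \<in> Ar X" "Cod X \<gamma>' = Dom X p" by fact+
  next
    fix c assume c: "c \<in> Ar X" "Cod X c = Dom X \<gamma>'"
    have H: "\<gamma>' \<cdot>\<^bsub>X\<^esub> c \<in> Ar X" "c \<in> Ar X" "Cod X (\<gamma>' \<cdot>\<^bsub>X\<^esub> c) = Dom X p" "Cod X c = C"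
      "p \<cdot>\<^bsub>X\<^esub> (\<gamma>' \<cdot>\<^bsub>X\<^esub> c) = (p \<cdot>\<^bsub>X\<^esub> \<gamma>') \<cdot>\<^bsub>X\<^esub> c" using c \<gamma>' p by simp_all
    note x = \<xi>'[OF H] and d = DomI[OF H]
    show "\<xi>' (\<gamma>' \<cdot>\<^bsub>X\<^esub> c) c = c"
    proof (rule lift_unique)
      show "FAr P (\<xi>' (\<gamma>' \<cdot>\<^bsub>X\<^esub> c) c) = FAr P c"
        using x P_Comp[OF c(1) \<gamma>'(1) c(2)] descent_datum_unit[OF datum, of "FAr P c"] H(2,4) C(3) \<gamma>'(4)
        by simp
    qed (use x d H in simp_all)
  next
    fix e c assume e: "e \<in> Ar X" and c: "c \<in> Ar X"
      and ec: "Cod X e = Dom X p \<and> Cod X c = Dom X \<gamma>' \<and> p \<cdot>\<^bsub>X\<^esub> e = (p \<cdot>\<^bsub>X\<^esub> \<gamma>') \<cdot>\<^bsub>X\<^esub> c"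
    then have H: "e \<in> Ar X" "c \<in> Ar X" "Cod X e = Dom X p" "Cod X c = C" "p \<cdot>\<^bsub>X\<^esub> e = (p \<cdot>\<^bsub>X\<^esub> \<gamma>') \<cdot>\<^bsub>X\<^esub> c"
      using \<gamma>'(2) by simp_all
    have "FAr P e \<in> Ar B" "FAr P c \<in> Ar B" "Cod B (FAr P e) = Dom B (FAr P p)" "Cod B (FAr P c) = Dom B \<gamma>"
      using H(1-4) p C(3) by simp_all
    note D = descent_datumD[OF datum this valid[OF H]]
    note x = \<xi>'[OF H] and d = DomI[OF H]
    show "\<xi>' e c \<in> Hom X (Dom X e) (Dom X \<gamma>')" using x \<gamma>'(2) by (simp add: Hom_iff)
    show "\<gamma>' \<cdot>\<^bsub>X\<^esub> \<xi>' e c = e"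
      using x d D(2) \<gamma>' H by (intro lift_unique) simp_all
    {
      fix t assume t: "t \<in> Ar X" "Cod X t = Dom X e"
      have "p \<cdot>\<^bsub>X\<^esub> (e \<cdot>\<^bsub>X\<^esub> t) = (p \<cdot>\<^bsub>X\<^esub> \<gamma>') \<cdot>\<^bsub>X\<^esub> (c \<cdot>\<^bsub>X\<^esub> t)"
        using X.Comp_eq_assoc[OF H(5) H(1) p H(3) t] H(2,4) d t \<gamma>' p by simp
      then have H': "e \<cdot>\<^bsub>X\<^esub> t \<in> Ar X" "c \<cdot>\<^bsub>X\<^esub> t \<in> Ar X" "Cod X (e \<cdot>\<^bsub>X\<^esub> t) = Dom X p" "Cod X (c \<cdot>\<^bsub>X\<^esub> t) = C"
        "p \<cdot>\<^bsub>X\<^esub> (e \<cdot>\<^bsub>X\<^esub> t) = (p \<cdot>\<^bsub>X\<^esub> \<gamma>') \<cdot>\<^bsub>X\<^esub> (c \<cdot>\<^bsub>X\<^esub> t)" using H(1-4) d t by simp_all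
      note x' = \<xi>'[OF H'] and d' = DomI[OF H']
      show "\<xi>' (e \<cdot>\<^bsub>X\<^esub> t) (c \<cdot>\<^bsub>X\<^esub> t) = \<xi>' e c \<cdot>\<^bsub>X\<^esub> t"
      proof (rule lift_unique)
        show "FAr P (\<xi>' (e \<cdot>\<^bsub>X\<^esub> t) (c \<cdot>\<^bsub>X\<^esub> t)) = FAr P (\<xi>' e c \<cdot>\<^bsub>X\<^esub> t)"
          using x x' D(3)[of "FAr P t"] t H(1,2) d by simp
      qed (use x x' d' t H(1,2) d in simp_all)
    }
    fix e' assume e': "e' \<in> Ar X" and e'p: "Cod X e' = Dom X p \<and> p \<cdot>\<^bsub>X\<^esub> e' = p \<cdot>\<^bsub>X\<^esub> e"
    then have H': "e' \<in> Ar X" "c \<in> Ar X" "Cod X e' = Dom X p" "Cod X c = C" "p \<cdot>\<^bsub>X\<^esub> e' = (p \<cdot>\<^bsub>X\<^esub> \<gamma>') \<cdot>\<^bsub>X\<^esub> c"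
      using H by simp_all
    have "p \<cdot>\<^bsub>X\<^esub> e' = (p \<cdot>\<^bsub>X\<^esub> \<gamma>') \<cdot>\<^bsub>X\<^esub> \<xi>' e c"
      using e'p x p \<gamma>' \<open>\<gamma>' \<cdot>\<^bsub>X\<^esub> \<xi>' e c = e\<close> by simp
    then have H'': "e' \<in> Ar X" "\<xi>' e c \<in> Ar X" "Cod X e' = Dom X p" "Cod X (\<xi>' e c) = C"
      "p \<cdot>\<^bsub>X\<^esub> e' = (p \<cdot>\<^bsub>X\<^esub> \<gamma>') \<cdot>\<^bsub>X\<^esub> \<xi>' e c" using e' e'p x by simp_all
    note x' = \<xi>'[OF H'] and x'' = \<xi>'[OF H''] and d' = DomI[OF H']
    have "FAr P p \<cdot>\<^bsub>B\<^esub> FAr P e' = FAr P p \<cdot>\<^bsub>B\<^esub> FAr P e"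
      using P_Comp[OF H'(1) p H'(3)] P_Comp[OF H(1) p H(3)] e'p by simp
    then have "\<xi> (FAr P e') (\<xi> (FAr P e) (FAr P c)) = \<xi> (FAr P e') (FAr P c)"
      using D(4)[of "FAr P e'"] H' p by simp
    then show "\<xi>' e' (\<xi>' e c) = \<xi>' e' c"
      using x x' x'' d' by (intro lift_unique) simp_all
  qed
  then obtain g \<kappa> where pull: "is_pullback X p g \<kappa> \<gamma>'"
    and \<kappa>: "\<And>e c. \<lbrakk>e \<in> Ar X; c \<in> Ar X; Cod X e = Dom X p; Cod X c = C; p \<cdot>\<^bsub>X\<^esub> e = (p \<cdot>\<^bsub>X\<^esub> \<gamma>') \<cdot>\<^bsub>X\<^esub> c\<rbrakk> \<Longrightarrow>
      \<kappa> \<cdot>\<^bsub>X\<^esub> \<xi>' e c = \<kappa> \<cdot>\<^bsub>X\<^esub> c"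
    using eff \<gamma>'(2) unfolding effective_datum_def by metis
  have \<kappa>A: "\<kappa> \<in> Ar X" "Dom X \<kappa> = C" using pull \<gamma>'(2) by (simp_all add: is_pullback_def)
  have "FAr P \<kappa> \<cdot>\<^bsub>B\<^esub> \<xi> e c = FAr P \<kappa> \<cdot>\<^bsub>B\<^esub> c"
    if e: "e \<in> Ar B" "Cod B e = Dom B (FAr P p)" and c: "c \<in> Ar B" "Cod B c = Dom B \<gamma>"
      and eq: "FAr P p \<cdot>\<^bsub>B\<^esub> e = (FAr P p \<cdot>\<^bsub>B\<^esub> \<gamma>) \<cdot>\<^bsub>B\<^esub> c" for e c
  proof -
    have p\<gamma>: "FAr P p \<cdot>\<^bsub>B\<^esub> \<gamma> \<in> Ar B" "Dom B (FAr P p \<cdot>\<^bsub>B\<^esub> \<gamma>) = Dom B \<gamma>" using p \<gamma> by simp_all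
    have Dce: "Dom B c = Dom B e"
      using B.Comp_simps(2)[OF e(1) P_simps(1)[OF p] e(2)] B.Comp_simps(2)[OF c(1) p\<gamma>(1)] c(2) p\<gamma>(2) eq
      by simp
    obtain w where w: "w \<in> I" "w \<in> Ob X" "FOb P w = Dom B e" using cover[OF B.Ar_Ob(1)[OF e(1)]] by blast
    obtain e' where e': "e' \<in> Ar X" "Dom X e' = w" "Cod X e' = Dom X p" "FAr P e' = e"
      using lift[OF w(1) X.Ar_Ob(1)[OF p] e(1) w(3)[symmetric]] e(2) p by auto
    obtain c' where c': "c' \<in> Ar X" "Dom X c' = w" "Cod X c' = C" "FAr P c' = c"
      using lift[OF w(1) C(2) c(1)] c(2) w(3) Dce C(3) by auto
    have "p \<cdot>\<^bsub>X\<^esub> e' = (p \<cdot>\<^bsub>X\<^esub> \<gamma>') \<cdot>\<^bsub>X\<^esub> c'"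
    proof (rule lift_unique)
      show "FAr P (p \<cdot>\<^bsub>X\<^esub> e') = FAr P ((p \<cdot>\<^bsub>X\<^esub> \<gamma>') \<cdot>\<^bsub>X\<^esub> c')"
        using eq e' c' p \<gamma>' \<gamma> c by simp
    qed (use e' c' p \<gamma>' w in simp_all)
    note H = e'(1) c'(1) e'(3) c'(3) this
    have "FAr P (\<kappa> \<cdot>\<^bsub>X\<^esub> \<xi>' e' c') = FAr P (\<kappa> \<cdot>\<^bsub>X\<^esub> c')" using \<kappa>[OF H] by simp
    then show ?thesis using \<xi>'[OF H] \<kappa>A e'(4) c' by simp
  qed
  moreover have "is_pullback B (FAr P p) (FAr P g) (FAr P \<kappa>) \<gamma>"
    using preserves_pullback[OF pull] \<gamma>'(4) by simp
  ultimately show ?thesis unfolding effective_datum_def by blast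
qed

text \<open>
  Objects over the codomain of \<open>P p\<close> lift to \<open>r : c \<rightarrow> Cod X p\<close> with \<open>c\<close> in \<open>I\<close>; the pullback of \<open>p\<close>
  along \<open>r\<close> exists by assumption and is mapped to the required pullback.
\<close>

theorem preserves_elementwise_descent:
  assumes "elementwise_descent X p"
  shows "elementwise_descent B (FAr P p)"
  unfolding elementwise_descent_def
proof (intro conjI ballI impI allI)
  have p: "p \<in> Ar X" using assms by (simp add: elementwise_descent_def)
  then show "FAr P p \<in> Ar B" by simp
  show "effective_datum B (FAr P p) \<gamma> \<xi>" if "descent_datum B (FAr P p) \<gamma> \<xi>" for \<gamma> \<xi>
    using effective_datum_image[OF p _ that] assms unfolding elementwise_descent_def by blast
  fix g assume g: "g \<in> Ar B" "Cod B g = Cod B (FAr P p)"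
  obtain c where c: "c \<in> I" "c \<in> Ob X" "FOb P c = Dom B g" using cover[OF B.Ar_Ob(1)[OF g(1)]] by blast
  obtain r where r: "r \<in> Ar X" "Dom X r = c" "Cod X r = Cod X p" "FAr P r = g"
    using lift[OF c(1) X.Ar_Ob(2)[OF p] g(1) c(3)[symmetric]] g(2) p by auto
  obtain p' r' where pull: "is_pullback X p r p' r'" and quot: "quotient_over X r p'"
    using assms r(1,3) unfolding elementwise_descent_def by blast
  have "p' \<in> Ar X" "Cod X p' = Dom X r" using pull by (simp_all add: is_pullback_def)
  then have "quotient_over B g (FAr P p')"
    using quotient_over_image[OF quot r(1)] r(2,4) c(1) by simp
  moreover have "is_pullback B (FAr P p) g (FAr P p') (FAr P r')"
    using preserves_pullback[OF pull] r(4) by simp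
  ultimately show "\<exists>p' g'. is_pullback B (FAr P p) g p' g' \<and> quotient_over B g p'" by blast
qed

end

section \<open>Whiskering in a 2-category\<close>

context two_category
begin

abbreviation "U \<equiv> Und A"
abbreviation "V \<equiv> Vert A"

sublocale U: category U by (rule Und_category)
sublocale V: category V by (rule Vert_category)

definition cell where
  "cell x y f g \<sigma> \<longleftrightarrow> f \<in> Hom U x y \<and> g \<in> Hom U x y \<and> \<sigma> \<in> Hom V f g"

lemma cellI:
  assumes "f \<in> Hom U x y" "\<sigma> \<in> Hom V f g"
  shows "cell x y f g \<sigma>"
  using assms globular[of \<sigma>] by (auto simp: cell_def Hom_iff)

lemma cell_hcat: "cell x y f g \<sigma> \<Longrightarrow> \<sigma> \<in> Ar (hcat A x y)"
  by (auto simp: cell_def hcat_def Hom_iff)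

lemma cell_Hom: "cell x y f g \<sigma> \<Longrightarrow> \<sigma> \<in> Hom V f g"
  by (simp add: cell_def)

lemma Id_cell: "f \<in> Hom U x y \<Longrightarrow> cell x y f f (Id V f)"
  using V.Id_Hom[of f] Ob_Vert by (auto simp: cell_def Hom_iff)

lemma comp_cell: "cell x y f g \<sigma> \<Longrightarrow> cell x y g h \<tau> \<Longrightarrow> cell x y f h (\<tau> \<cdot>\<^bsub>V\<^esub> \<sigma>)"
  using V.Comp_Hom by (auto simp: cell_def)

lemma hcomp_cell:
  assumes "cell x y f f' \<sigma>" "cell y z g g' \<tau>"
  shows "cell x z (g \<cdot>\<^bsub>U\<^esub> f) (g' \<cdot>\<^bsub>U\<^esub> f') (\<tau> \<star>\<^bsub>A\<^esub> \<sigma>)"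
  using assms HComp_Hom[of f x y g z \<sigma> f' \<tau> g'] U.Comp_Hom by (auto simp: cell_def)

abbreviation "lw \<equiv> whisker_left A"
abbreviation "rw \<equiv> whisker_right A"

lemma lw_cell: "cell x y f g \<sigma> \<Longrightarrow> p \<in> Hom U y z \<Longrightarrow> cell x z (p \<cdot>\<^bsub>U\<^esub> f) (p \<cdot>\<^bsub>U\<^esub> g) (lw p \<sigma>)"
  unfolding whisker_left_def by (intro hcomp_cell Id_cell)

lemma rw_cell: "cell y z f g \<sigma> \<Longrightarrow> h \<in> Hom U x y \<Longrightarrow> cell x z (f \<cdot>\<^bsub>U\<^esub> h) (g \<cdot>\<^bsub>U\<^esub> h) (rw \<sigma> h)"
  unfolding whisker_right_def by (intro hcomp_cell Id_cell)

lemma Id_Id: "f \<in> Hom U x y \<Longrightarrow> Id V f \<cdot>\<^bsub>V\<^esub> Id V f = Id V f"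
  using Ob_Vert by (auto simp: Hom_iff)

lemma lw_comp:
  assumes "cell x y f g \<sigma>" "cell x y g h \<tau>" "p \<in> Hom U y z"
  shows "lw p (\<tau> \<cdot>\<^bsub>V\<^esub> \<sigma>) = lw p \<tau> \<cdot>\<^bsub>V\<^esub> lw p \<sigma>"
  using interchange[of f x y p z \<sigma> g \<tau> h "Id V p" p "Id V p" p] assms Id_Id[OF assms(3)] Id_cell[OF assms(3)]
  by (simp add: whisker_left_def cell_def)

lemma rw_comp:
  assumes "cell y z f g \<sigma>" "cell y z g h \<tau>" "k \<in> Hom U x y"
  shows "rw (\<tau> \<cdot>\<^bsub>V\<^esub> \<sigma>) k = rw \<tau> k \<cdot>\<^bsub>V\<^esub> rw \<sigma> k"
  using interchange[of k x y f z "Id V k" k "Id V k" k \<sigma> g \<tau> h] assms Id_Id[OF assms(3)] Id_cell[OF assms(3)]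
  by (simp add: whisker_right_def cell_def)

lemma lw_lw:
  assumes "cell x y f g \<sigma>" "q \<in> Hom U y z" "p \<in> Hom U z w"
  shows "lw (p \<cdot>\<^bsub>U\<^esub> q) \<sigma> = lw p (lw q \<sigma>)"
  using HComp_assoc[OF cell_hcat[OF assms(1)] cell_hcat[OF Id_cell[OF assms(2)]] cell_hcat[OF Id_cell[OF assms(3)]]]
    HComp_Id[OF assms(2,3)] by (simp add: whisker_left_def)

lemma rw_rw:
  assumes "cell y z f g \<sigma>" "k \<in> Hom U x y" "h \<in> Hom U w x"
  shows "rw \<sigma> (k \<cdot>\<^bsub>U\<^esub> h) = rw (rw \<sigma> k) h"
  using HComp_assoc[OF cell_hcat[OF Id_cell[OF assms(3)]] cell_hcat[OF Id_cell[OF assms(2)]] cell_hcat[OF assms(1)]]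
    HComp_Id[OF assms(3,2)] by (simp add: whisker_right_def)

lemma lw_rw:
  assumes "cell y z f g \<sigma>" "p \<in> Hom U z w" "h \<in> Hom U x y"
  shows "rw (lw p \<sigma>) h = lw p (rw \<sigma> h)"
  using HComp_assoc[OF cell_hcat[OF Id_cell[OF assms(3)]] cell_hcat[OF assms(1)] cell_hcat[OF Id_cell[OF assms(2)]]]
  by (simp add: whisker_left_def whisker_right_def)

lemma lw_Id: "cell x y f g \<sigma> \<Longrightarrow> lw (Id U y) \<sigma> = \<sigma>"
  using HComp_unit_left[OF cell_hcat] by (simp add: whisker_left_def)

lemma rw_Id: "cell x y f g \<sigma> \<Longrightarrow> rw \<sigma> (Id U x) = \<sigma>"
  using HComp_unit_right[OF cell_hcat] by (simp add: whisker_right_def)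

lemma lw_Id_cell: "f \<in> Hom U x y \<Longrightarrow> p \<in> Hom U y z \<Longrightarrow> lw p (Id V f) = Id V (p \<cdot>\<^bsub>U\<^esub> f)"
  using HComp_Id by (simp add: whisker_left_def)

lemma rw_Id_cell: "f \<in> Hom U y z \<Longrightarrow> h \<in> Hom U x y \<Longrightarrow> rw (Id V f) h = Id V (f \<cdot>\<^bsub>U\<^esub> h)"
  using HComp_Id by (simp add: whisker_right_def)

lemma cell_Id_comp: "cell x y f g \<sigma> \<Longrightarrow> Id V g \<cdot>\<^bsub>V\<^esub> \<sigma> = \<sigma>"
  by (simp add: cell_def Hom_iff)

lemma cell_comp_Id: "cell x y f g \<sigma> \<Longrightarrow> \<sigma> \<cdot>\<^bsub>V\<^esub> Id V f = \<sigma>"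
  by (simp add: cell_def Hom_iff)

lemma cell_assoc:
  "cell x y f g \<rho> \<Longrightarrow> cell x y g h \<sigma> \<Longrightarrow> cell x y h k \<tau> \<Longrightarrow>
    (\<tau> \<cdot>\<^bsub>V\<^esub> \<sigma>) \<cdot>\<^bsub>V\<^esub> \<rho> = \<tau> \<cdot>\<^bsub>V\<^esub> (\<sigma> \<cdot>\<^bsub>V\<^esub> \<rho>)"
  by (rule V.Comp_assoc[OF cell_Hom cell_Hom cell_Hom])

section \<open>The Grothendieck construction of the lax comma categories\<close>

abbreviation "Gr \<equiv> grothendieck (op_cat U) (lax_comma_pseudofun A)"

text \<open>
  The triples \<open>(p, h, \<pi>)\<close> with \<open>\<pi> : f \<Rightarrow> p g h\<close>, packaged as arrows from \<open>f\<close> to \<open>g\<close>. The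
  projection lands in the opposite category, so \<open>p\<close> goes from the codomain of \<open>g\<close> to that of \<open>f\<close>.
\<close>

definition "gr f g p h \<pi> = ((Cod U f, f), (Cod U g, g), (p, (f, p \<cdot>\<^bsub>U\<^esub> g, (h, \<pi>))))"

definition "gr_arrow f g p h \<pi> \<longleftrightarrow> f \<in> Ar U \<and> g \<in> Ar U \<and> p \<in> Hom U (Cod U g) (Cod U f) \<and>
  h \<in> Hom U (Dom U f) (Dom U g) \<and> cell (Dom U f) (Cod U f) f (p \<cdot>\<^bsub>U\<^esub> g \<cdot>\<^bsub>U\<^esub> h) \<pi>"

lemma Ob_Gr: "(x, f) \<in> Ob Gr \<longleftrightarrow> f \<in> Ar U \<and> Cod U f = x"
  by (auto simp: grothendieck_def op_cat_def lax_comma_pseudofun_def lax_comma_def Let_def)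

lemma Ar_Gr: "u \<in> Ar Gr \<longleftrightarrow> (\<exists>f g p h \<pi>. u = gr f g p h \<pi> \<and> gr_arrow f g p h \<pi>)"
proof
  assume "u \<in> Ar Gr"
  then obtain x f y g p \<phi> where u: "u = ((x, f), (y, g), (p, \<phi>))"
    and f: "f \<in> Ar U" "Cod U f = x" and g: "g \<in> Ar U" "Cod U g = y" and p: "p \<in> Hom U y x"
    and \<phi>: "\<phi> \<in> Hom (lax_comma A x) f (p \<cdot>\<^bsub>U\<^esub> g)"
    by (auto simp: grothendieck_def op_cat_def lax_comma_pseudofun_def lax_comma_def
      lax_comma_postcomp_def Let_def Hom_iff)
  obtain h \<pi> where h: "\<phi> = (f, p \<cdot>\<^bsub>U\<^esub> g, (h, \<pi>))" "h \<in> Hom U (Dom U f) (Dom U (p \<cdot>\<^bsub>U\<^esub> g))"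
    "\<pi> \<in> Hom V f (p \<cdot>\<^bsub>U\<^esub> g \<cdot>\<^bsub>U\<^esub> h)"
    using \<phi> by (auto simp: lax_comma_def Hom_iff)
  have "Dom U (p \<cdot>\<^bsub>U\<^esub> g) = Dom U g" using p g by (simp add: Hom_iff)
  then have "gr_arrow f g p h \<pi>"
    unfolding gr_arrow_def using f g p h cellI[of f "Dom U f" "Cod U f" \<pi>] by (simp add: Hom_iff)
  moreover have "u = gr f g p h \<pi>" using u f g h(1) by (simp add: gr_def)
  ultimately show "\<exists>f g p h \<pi>. u = gr f g p h \<pi> \<and> gr_arrow f g p h \<pi>" by blast
next
  assume "\<exists>f g p h \<pi>. u = gr f g p h \<pi> \<and> gr_arrow f g p h \<pi>"
  then obtain f g p h \<pi> where u: "u = gr f g p h \<pi>" and a: "gr_arrow f g p h \<pi>" by blast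
  have "f \<in> Ar U" "g \<in> Ar U" "p \<in> Ar U" "Dom U p = Cod U g" "Cod U p = Cod U f" "h \<in> Ar U"
    "Dom U h = Dom U f" "Cod U h = Dom U g" "\<pi> \<in> Ar V" "Dom V \<pi> = f" "Cod V \<pi> = p \<cdot>\<^bsub>U\<^esub> g \<cdot>\<^bsub>U\<^esub> h"
    using a by (simp_all add: gr_arrow_def cell_def Hom_iff)
  then show "u \<in> Ar Gr"
    unfolding u gr_def
    by (simp add: grothendieck_def op_cat_def lax_comma_pseudofun_def lax_comma_def
      lax_comma_postcomp_def Let_def Hom_def)
qed

lemma Dom_Gr [simp]: "Dom Gr (gr f g p h \<pi>) = (Cod U f, f)"
  and Cod_Gr [simp]: "Cod Gr (gr f g p h \<pi>) = (Cod U g, g)"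
  by (simp_all add: grothendieck_def gr_def Let_def)

lemma Id_Gr: "f \<in> Ar U \<Longrightarrow> Id Gr (Cod U f, f) = gr f f (Id U (Cod U f)) (Id U (Dom U f)) (Id V f)"
  by (simp add: grothendieck_def gr_def Let_def op_cat_def lax_comma_pseudofun_def lax_comma_def)

lemma Id_arrow: "f \<in> Ar U \<Longrightarrow> gr_arrow f f (Id U (Cod U f)) (Id U (Dom U f)) (Id V f)"
  using Id_cell[of f "Dom U f" "Cod U f"] by (simp add: gr_arrow_def Hom_iff)

lemma comp_arrow:
  assumes u: "gr_arrow f g p h \<pi>" and v: "gr_arrow g l q k \<chi>"
  shows "gr_arrow f l (p \<cdot>\<^bsub>U\<^esub> q) (k \<cdot>\<^bsub>U\<^esub> h) (rw (lw p \<chi>) h \<cdot>\<^bsub>V\<^esub> \<pi>)"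
    and "cell (Dom U f) (Cod U f) (p \<cdot>\<^bsub>U\<^esub> g \<cdot>\<^bsub>U\<^esub> h) (p \<cdot>\<^bsub>U\<^esub> q \<cdot>\<^bsub>U\<^esub> l \<cdot>\<^bsub>U\<^esub> (k \<cdot>\<^bsub>U\<^esub> h)) (rw (lw p \<chi>) h)"
proof -
  have c: "cell (Dom U f) (Cod U f) f (p \<cdot>\<^bsub>U\<^esub> g \<cdot>\<^bsub>U\<^esub> h) \<pi>" and p: "p \<in> Hom U (Cod U g) (Cod U f)"
    and h: "h \<in> Hom U (Dom U f) (Dom U g)" and f: "f \<in> Ar U" and g: "g \<in> Ar U"
    using u by (simp_all add: gr_arrow_def)
  have d: "cell (Dom U g) (Cod U g) g (q \<cdot>\<^bsub>U\<^esub> l \<cdot>\<^bsub>U\<^esub> k) \<chi>" and q: "q \<in> Hom U (Cod U l) (Cod U g)"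
    and k: "k \<in> Hom U (Dom U g) (Dom U l)" and l: "l \<in> Ar U"
    using v by (simp_all add: gr_arrow_def)
  have "p \<cdot>\<^bsub>U\<^esub> (q \<cdot>\<^bsub>U\<^esub> l \<cdot>\<^bsub>U\<^esub> k) \<cdot>\<^bsub>U\<^esub> h = p \<cdot>\<^bsub>U\<^esub> q \<cdot>\<^bsub>U\<^esub> l \<cdot>\<^bsub>U\<^esub> (k \<cdot>\<^bsub>U\<^esub> h)"
    using p q k h l by (simp add: Hom_iff)
  then show *: "cell (Dom U f) (Cod U f) (p \<cdot>\<^bsub>U\<^esub> g \<cdot>\<^bsub>U\<^esub> h) (p \<cdot>\<^bsub>U\<^esub> q \<cdot>\<^bsub>U\<^esub> l \<cdot>\<^bsub>U\<^esub> (k \<cdot>\<^bsub>U\<^esub> h)) (rw (lw p \<chi>) h)"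
    using rw_cell[OF lw_cell[OF d p] h] by simp
  show "gr_arrow f l (p \<cdot>\<^bsub>U\<^esub> q) (k \<cdot>\<^bsub>U\<^esub> h) (rw (lw p \<chi>) h \<cdot>\<^bsub>V\<^esub> \<pi>)"
    unfolding gr_arrow_def using comp_cell[OF c *] f l p q h k by (simp add: Hom_iff)
qed

text \<open>
  The coherence isomorphism in the definition of composition is an identity of the lax comma category
  and drops out.
\<close>

lemma Comp_Gr:
  assumes u: "gr_arrow f g p h \<pi>" and v: "gr_arrow g l q k \<chi>"
  shows "gr g l q k \<chi> \<cdot>\<^bsub>Gr\<^esub> gr f g p h \<pi> = gr f l (p \<cdot>\<^bsub>U\<^esub> q) (k \<cdot>\<^bsub>U\<^esub> h) (rw (lw p \<chi>) h \<cdot>\<^bsub>V\<^esub> \<pi>)"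
proof -
  let ?r = "p \<cdot>\<^bsub>U\<^esub> q \<cdot>\<^bsub>U\<^esub> l" and ?m = "k \<cdot>\<^bsub>U\<^esub> h" and ?\<sigma> = "rw (lw p \<chi>) h \<cdot>\<^bsub>V\<^esub> \<pi>"
  have a: "gr_arrow f l (p \<cdot>\<^bsub>U\<^esub> q) ?m ?\<sigma>" using comp_arrow[OF u v] by simp
  have A: "p \<in> Ar U" "q \<in> Ar U" "l \<in> Ar U" "Dom U p = Cod U q" "Dom U q = Cod U l"
    using u v by (simp_all add: gr_arrow_def Hom_iff)
  have m: "?m \<in> Hom U (Dom U f) (Dom U l)" and c: "cell (Dom U f) (Cod U f) f (?r \<cdot>\<^bsub>U\<^esub> ?m) ?\<sigma>"
    using a by (simp_all add: gr_arrow_def)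
  have r: "?r \<in> Hom U (Dom U l) (Cod U p)" using A by (simp add: Hom_iff)
  have "Id U (Dom U ?r) \<cdot>\<^bsub>U\<^esub> ?m = ?m"
    using m r by (simp add: Hom_iff)
  moreover have "rw (Id V ?r) ?m \<cdot>\<^bsub>V\<^esub> ?\<sigma> = ?\<sigma>"
    using rw_Id_cell[OF r m] cell_Id_comp[OF c] by simp
  ultimately show ?thesis
    by (simp add: gr_def grothendieck_def Let_def op_cat_def lax_comma_pseudofun_def lax_comma_def
      lax_comma_postcomp_def)
qed

lemma Comp_Gr_assoc:
  assumes u: "gr_arrow f g p h \<pi>" and v: "gr_arrow g l q k \<chi>" and w: "gr_arrow l n r m \<omega>"
  shows "rw (lw p (rw (lw q \<omega>) k \<cdot>\<^bsub>V\<^esub> \<chi>)) h \<cdot>\<^bsub>V\<^esub> \<pi> =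
    rw (lw (p \<cdot>\<^bsub>U\<^esub> q) \<omega>) (k \<cdot>\<^bsub>U\<^esub> h) \<cdot>\<^bsub>V\<^esub> (rw (lw p \<chi>) h \<cdot>\<^bsub>V\<^esub> \<pi>)"
proof -
  have c\<pi>: "cell (Dom U f) (Cod U f) f (p \<cdot>\<^bsub>U\<^esub> g \<cdot>\<^bsub>U\<^esub> h) \<pi>" and p: "p \<in> Hom U (Cod U g) (Cod U f)"
    and h: "h \<in> Hom U (Dom U f) (Dom U g)" and g: "g \<in> Ar U"
    using u by (simp_all add: gr_arrow_def)
  have c\<chi>: "cell (Dom U g) (Cod U g) g (q \<cdot>\<^bsub>U\<^esub> l \<cdot>\<^bsub>U\<^esub> k) \<chi>" and q: "q \<in> Hom U (Cod U l) (Cod U g)"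
    and k: "k \<in> Hom U (Dom U g) (Dom U l)" and l: "l \<in> Ar U"
    using v by (simp_all add: gr_arrow_def)
  have c\<omega>: "cell (Dom U l) (Cod U l) l (r \<cdot>\<^bsub>U\<^esub> n \<cdot>\<^bsub>U\<^esub> m) \<omega>" using w by (simp add: gr_arrow_def)
  note q\<omega>k = comp_arrow(2)[OF v w] and p\<chi>h = comp_arrow(2)[OF u v]
  have "rw (lw p (rw (lw q \<omega>) k \<cdot>\<^bsub>V\<^esub> \<chi>)) h =
      rw (lw p (rw (lw q \<omega>) k)) h \<cdot>\<^bsub>V\<^esub> rw (lw p \<chi>) h"
    using lw_comp[OF c\<chi> q\<omega>k p] rw_comp[OF lw_cell[OF c\<chi> p] lw_cell[OF q\<omega>k p] h] by simp
  moreover have "rw (lw p (rw (lw q \<omega>) k)) h = rw (lw (p \<cdot>\<^bsub>U\<^esub> q) \<omega>) (k \<cdot>\<^bsub>U\<^esub> h)"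
    using rw_rw[OF lw_cell[OF c\<omega> U.Comp_Hom[OF q p]] k h] lw_lw[OF c\<omega> q p]
      lw_rw[OF lw_cell[OF c\<omega> q] p k] by simp
  moreover have "(rw (lw p (rw (lw q \<omega>) k)) h \<cdot>\<^bsub>V\<^esub> rw (lw p \<chi>) h) \<cdot>\<^bsub>V\<^esub> \<pi> =
      rw (lw p (rw (lw q \<omega>) k)) h \<cdot>\<^bsub>V\<^esub> (rw (lw p \<chi>) h \<cdot>\<^bsub>V\<^esub> \<pi>)"
  proof (rule cell_assoc[OF c\<pi> p\<chi>h])
    have "p \<cdot>\<^bsub>U\<^esub> (q \<cdot>\<^bsub>U\<^esub> l \<cdot>\<^bsub>U\<^esub> k) \<cdot>\<^bsub>U\<^esub> h = p \<cdot>\<^bsub>U\<^esub> q \<cdot>\<^bsub>U\<^esub> l \<cdot>\<^bsub>U\<^esub> (k \<cdot>\<^bsub>U\<^esub> h)"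
      using p q k h l by (simp add: Hom_iff)
    then show "cell (Dom U f) (Cod U f) (p \<cdot>\<^bsub>U\<^esub> q \<cdot>\<^bsub>U\<^esub> l \<cdot>\<^bsub>U\<^esub> (k \<cdot>\<^bsub>U\<^esub> h))
      (p \<cdot>\<^bsub>U\<^esub> (q \<cdot>\<^bsub>U\<^esub> r \<cdot>\<^bsub>U\<^esub> n \<cdot>\<^bsub>U\<^esub> (m \<cdot>\<^bsub>U\<^esub> k)) \<cdot>\<^bsub>U\<^esub> h) (rw (lw p (rw (lw q \<omega>) k)) h)"
      using rw_cell[OF lw_cell[OF q\<omega>k p] h] by simp
  qed
  ultimately show ?thesis by simp
qed

lemma Hom_Gr_elim:
  assumes "u \<in> Hom Gr a b"
  obtains f g p h \<pi> where "u = gr f g p h \<pi>" "gr_arrow f g p h \<pi>" "a = (Cod U f, f)" "b = (Cod U g, g)"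
  using assms Ar_Gr by (fastforce simp: Hom_iff)

text \<open>
  Used on the second arrow of a composable pair, whose source is known in the form \<open>(Cod U g, g)\<close>.
\<close>

lemma Hom_Gr_from:
  assumes "v \<in> Hom Gr (Cod U g, g) c"
  obtains l q k \<chi> where "v = gr g l q k \<chi>" "gr_arrow g l q k \<chi>" "c = (Cod U l, l)"
  using Hom_Gr_elim[OF assms] by (metis prod.inject)

lemma gr_Hom: "gr_arrow f g p h \<pi> \<Longrightarrow> gr f g p h \<pi> \<in> Hom Gr (Cod U f, f) (Cod U g, g)"
  unfolding Hom_iff Ar_Gr Dom_Gr Cod_Gr by blast

lemma category_Gr: "category Gr"
proof
  fix u assume "u \<in> Ar Gr"
  then obtain f g p h \<pi> where u: "u = gr f g p h \<pi>" and a: "gr_arrow f g p h \<pi>" using Ar_Gr by blast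
  have fg: "f \<in> Ar U" "g \<in> Ar U" using a by (simp_all add: gr_arrow_def)
  then show "Dom Gr u \<in> Ob Gr" "Cod Gr u \<in> Ob Gr" by (simp_all add: u Ob_Gr)
  have p: "p \<in> Hom U (Cod U g) (Cod U f)" and h: "h \<in> Hom U (Dom U f) (Dom U g)"
    and c: "cell (Dom U f) (Cod U f) f (p \<cdot>\<^bsub>U\<^esub> g \<cdot>\<^bsub>U\<^esub> h) \<pi>"
    using a by (simp_all add: gr_arrow_def)
  show "u \<cdot>\<^bsub>Gr\<^esub> Id Gr (Dom Gr u) = u"
    unfolding u Dom_Gr Id_Gr[OF fg(1)] Comp_Gr[OF Id_arrow[OF fg(1)] a]
    using p h lw_Id[OF c] rw_Id[OF c] cell_comp_Id[OF c] by (simp add: Hom_iff)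
  have g: "g \<in> Hom U (Dom U g) (Cod U g)" using fg by (simp add: Hom_iff)
  show "Id Gr (Cod Gr u) \<cdot>\<^bsub>Gr\<^esub> u = u"
    unfolding u Cod_Gr Id_Gr[OF fg(2)] Comp_Gr[OF a Id_arrow[OF fg(2)]]
    using p h lw_Id_cell[OF g p] rw_Id_cell[OF U.Comp_Hom[OF g p] h] cell_Id_comp[OF c]
    by (simp add: Hom_iff)
next
  fix a assume "a \<in> Ob Gr"
  then obtain f where "a = (Cod U f, f)" "f \<in> Ar U" using Ob_Gr by (cases a) auto
  then show "Id Gr a \<in> Hom Gr a a" using Id_Gr gr_Hom[OF Id_arrow] by simp
next
  fix u v a b c assume uH: "u \<in> Hom Gr a b" and vH: "v \<in> Hom Gr b c"
  obtain f g p h \<pi> where u: "u = gr f g p h \<pi>" "gr_arrow f g p h \<pi>" and a: "a = (Cod U f, f)"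
    and b: "b = (Cod U g, g)" using uH by (rule Hom_Gr_elim)
  obtain l q k \<chi> where v: "v = gr g l q k \<chi>" "gr_arrow g l q k \<chi>" and c: "c = (Cod U l, l)"
    using vH unfolding b by (rule Hom_Gr_from)
  show "v \<cdot>\<^bsub>Gr\<^esub> u \<in> Hom Gr a c"
    unfolding u(1) v(1) a c Comp_Gr[OF u(2) v(2)] by (rule gr_Hom[OF comp_arrow(1)[OF u(2) v(2)]])
next
  fix u v w a b c d assume uH: "u \<in> Hom Gr a b" and vH: "v \<in> Hom Gr b c" and wH: "w \<in> Hom Gr c d"
  obtain f g p h \<pi> where u: "u = gr f g p h \<pi>" "gr_arrow f g p h \<pi>" and b: "b = (Cod U g, g)"
    using uH by (rule Hom_Gr_elim)
  obtain l q k \<chi> where v: "v = gr g l q k \<chi>" "gr_arrow g l q k \<chi>" and c: "c = (Cod U l, l)"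
    using vH unfolding b by (rule Hom_Gr_from)
  obtain n r m \<omega> where w: "w = gr l n r m \<omega>" "gr_arrow l n r m \<omega>"
    using wH unfolding c by (rule Hom_Gr_from)
  have "(p \<cdot>\<^bsub>U\<^esub> q) \<cdot>\<^bsub>U\<^esub> r = p \<cdot>\<^bsub>U\<^esub> (q \<cdot>\<^bsub>U\<^esub> r)" "(m \<cdot>\<^bsub>U\<^esub> k) \<cdot>\<^bsub>U\<^esub> h = m \<cdot>\<^bsub>U\<^esub> (k \<cdot>\<^bsub>U\<^esub> h)"
    using u(2) v(2) w(2) by (simp_all add: gr_arrow_def Hom_iff)
  then show "(w \<cdot>\<^bsub>Gr\<^esub> v) \<cdot>\<^bsub>Gr\<^esub> u = w \<cdot>\<^bsub>Gr\<^esub> (v \<cdot>\<^bsub>Gr\<^esub> u)"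
    unfolding u(1) v(1) w(1) Comp_Gr[OF u(2) v(2)] Comp_Gr[OF v(2) w(2)]
      Comp_Gr[OF comp_arrow(1)[OF u(2) v(2)] w(2)] Comp_Gr[OF u(2) comp_arrow(1)[OF v(2) w(2)]]
      Comp_Gr_assoc[OF u(2) v(2) w(2)] by simp
qed

text \<open>
  The object part of the projection leaves the types of arrows undetermined; fixing them lets
  facts about its object part and its arrow part be combined.
\<close>

abbreviation proj :: "('o \<times> 'm, ('o \<times> 'm) \<times> ('o \<times> 'm) \<times> ('m \<times> ('m \<times> 'm \<times> ('m \<times> 'c))), 'o, 'm) fun_data"
  where "proj \<equiv> grothendieck_proj"

lemma proj_simps [simp]:
  "FOb proj (x, f) = x" "FAr proj (gr f g p h \<pi>) = p"
  by (simp_all add: grothendieck_proj_def gr_def)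

lemma functor_proj: "is_functor Gr (op_cat U) proj"
proof
  fix a assume "a \<in> Ob Gr"
  then obtain f where a: "a = (Cod U f, f)" "f \<in> Ar U" using Ob_Gr by (cases a) auto
  then show "FOb proj a \<in> Ob (op_cat U)" by simp
  show "FAr proj (Id Gr a) = Id (op_cat U) (FOb proj a)"
    using a Id_Gr by simp
next
  fix u a b assume "u \<in> Hom Gr a b"
  then obtain f g p h \<pi> where "u = gr f g p h \<pi>" "gr_arrow f g p h \<pi>" "a = (Cod U f, f)" "b = (Cod U g, g)"
    by (rule Hom_Gr_elim)
  then show "FAr proj u \<in> Hom (op_cat U) (FOb proj a) (FOb proj b)"
    by (simp add: Hom_op gr_arrow_def)
next
  fix u v a b c assume uH: "u \<in> Hom Gr a b" and vH: "v \<in> Hom Gr b c"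
  obtain f g p h \<pi> where u: "u = gr f g p h \<pi>" "gr_arrow f g p h \<pi>" and b: "b = (Cod U g, g)"
    using uH by (rule Hom_Gr_elim)
  obtain l q k \<chi> where v: "v = gr g l q k \<chi>" "gr_arrow g l q k \<chi>"
    using vH unfolding b by (rule Hom_Gr_from)
  show "FAr proj (v \<cdot>\<^bsub>Gr\<^esub> u) = FAr proj v \<cdot>\<^bsub>op_cat U\<^esub> FAr proj u"
    unfolding u(1) v(1) Comp_Gr[OF u(2) v(2)] by simp
qed

section \<open>Strict initial objects\<close>

lemma initial_unique:
  assumes z: "strict_initial A z" and x: "x \<in> Ob U"
  shows "\<exists>u. Hom U z x = {u}"
    and "\<sigma> \<in> Ar (hcat A z x) \<Longrightarrow> \<tau> \<in> Ar (hcat A z x) \<Longrightarrow> \<sigma> = \<tau>"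
proof -
  have iso: "isomorphic_cats (hcat A z x) terminal_cat" using z x by (simp add: strict_initial_def)
  obtain F :: "('m, 'c, unit, unit) fun_data" and G where G: "is_functor terminal_cat (hcat A z x) G"
    and ob: "\<forall>u \<in> Ob (hcat A z x). FOb G (FOb F u) = u"
    and ar: "\<forall>\<sigma> \<in> Ar (hcat A z x). FAr G (FAr F \<sigma>) = \<sigma>"
    using iso unfolding isomorphic_cats_def by blast
  have "FOb G () \<in> Ob (hcat A z x)" using is_functor.FOb_Ob[OF G] by (simp add: terminal_cat_def)
  moreover have "u = FOb G ()" if "u \<in> Ob (hcat A z x)" for u
    using bspec[OF ob that] by simp
  ultimately have "Ob (hcat A z x) = {FOb G ()}" by blast
  then show "\<exists>u. Hom U z x = {u}" by (simp add: hcat_def)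
  show "\<sigma> = \<tau>" if "\<sigma> \<in> Ar (hcat A z x)" "\<tau> \<in> Ar (hcat A z x)"
    using bspec[OF ar that(1)] bspec[OF ar that(2)] by simp
qed

text \<open>
  An object \<open>b\<close> with a 1-cell to \<open>z\<close> is isomorphic to \<open>z\<close> by strictness, so it has the same universal
  property: whiskering with the isomorphism moves 1-cells and 2-cells out of \<open>b\<close> to ones out of \<open>z\<close>
  and back.
\<close>

lemma over_initial_unique:
  assumes z: "strict_initial A z" and b: "Hom U b z \<noteq> {}" and x: "x \<in> Ob U"
  shows "\<exists>u. Hom U b x = {u}" and "cell b x f g \<sigma> \<Longrightarrow> cell b x f g \<tau> \<Longrightarrow> \<sigma> = \<tau>"
proof -
  have bO: "b \<in> Ob U" using b by (auto simp: Hom_iff)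
  then have "iso_objects U b z" using z b by (auto simp: strict_initial_def)
  then obtain i where i: "i \<in> Hom U b z" "iso_arrow U i" unfolding iso_objects_def by blast
  obtain j where j: "j \<in> Hom U z b" "j \<cdot>\<^bsub>U\<^esub> i = Id U b" using iso_arrowE[OF i(2,1)] .
  obtain e where e: "Hom U z x = {e}" using initial_unique(1)[OF z x] by blast
  have u: "u = e \<cdot>\<^bsub>U\<^esub> i" if "u \<in> Hom U b x" for u
  proof -
    have "u = (u \<cdot>\<^bsub>U\<^esub> j) \<cdot>\<^bsub>U\<^esub> i" using that i(1) j by (simp add: Hom_iff)
    moreover have "u \<cdot>\<^bsub>U\<^esub> j = e" using U.Comp_Hom[OF j(1) that] e by simp
    ultimately show ?thesis by simp
  qed
  have "e \<cdot>\<^bsub>U\<^esub> i \<in> Hom U b x" using U.Comp_Hom[OF i(1), of e x] e by simp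
  then have "Hom U b x = {e \<cdot>\<^bsub>U\<^esub> i}" using u by blast
  then show "\<exists>u. Hom U b x = {u}" by blast
  show "\<sigma> = \<tau>" if \<sigma>: "cell b x f g \<sigma>" and \<tau>: "cell b x f g \<tau>"
  proof -
    have "\<sigma> = rw (rw \<sigma> j) i" "\<tau> = rw (rw \<tau> j) i"
      using rw_rw[OF \<sigma> j(1) i(1)] rw_rw[OF \<tau> j(1) i(1)] rw_Id[OF \<sigma>] rw_Id[OF \<tau>] j(2) by simp_all
    moreover have "rw \<sigma> j = rw \<tau> j"
      using initial_unique(2)[OF z x cell_hcat[OF rw_cell[OF \<sigma> j(1)]] cell_hcat[OF rw_cell[OF \<tau> j(1)]]] .
    ultimately show ?thesis by simp
  qed
qed

text \<open>
  Let \<open>f\<close> have a domain with a 1-cell to \<open>z\<close>. In a morphism \<open>(p, h, \<pi>)\<close> from \<open>f\<close> to \<open>g\<close>, the 1-cell \<open>h\<close> and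
  the 2-cell \<open>\<pi>\<close> are then unique. They exist for every \<open>p\<close>, because \<open>p g h = f\<close> as parallel 1-cells
  out of that domain, so \<open>\<pi>\<close> can be the identity.
\<close>

lemma coreflective_sieve_Gr:
  assumes z: "strict_initial A z"
  shows "coreflective_sieve Gr (op_cat U) proj {(x, f). f \<in> Ar U \<and> Cod U f = x \<and> Hom U (Dom U f) z \<noteq> {}}"
    (is "coreflective_sieve _ _ _ ?I")
proof -
  interpret Gr: category Gr by (rule category_Gr)
  interpret op: category "op_cat U" by (rule U.category_op)
  interpret proj_functor: is_functor Gr "op_cat U" proj by (rule functor_proj)
  show ?thesis
  proof
    fix u assume uA: "u \<in> Ar Gr" and cod: "Cod Gr u \<in> ?I"
    obtain f g p h \<pi> where u: "u = gr f g p h \<pi>" "gr_arrow f g p h \<pi>" using uA Ar_Gr by blast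
    obtain k where k: "k \<in> Hom U (Dom U g) z" using cod unfolding u(1) by auto
    have "h \<in> Hom U (Dom U f) (Dom U g)" using u(2) by (simp add: gr_arrow_def)
    then have "k \<cdot>\<^bsub>U\<^esub> h \<in> Hom U (Dom U f) z" using k by (rule U.Comp_Hom)
    then show "Dom Gr u \<in> ?I" using u by (auto simp: gr_arrow_def)
  next
    fix c d assume "c \<in> ?I" "d \<in> Ob Gr"
    then obtain f g where c: "c = (Cod U f, f)" "f \<in> Ar U" "Hom U (Dom U f) z \<noteq> {}"
      and d: "d = (Cod U g, g)" "g \<in> Ar U"
      using Ob_Gr by (cases c, cases d) auto
    obtain h where h: "Hom U (Dom U f) (Dom U g) = {h}"
      using over_initial_unique(1)[OF z c(3) U.Ar_Ob(1)[OF d(2)]] by blast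
    obtain e where e: "Hom U (Dom U f) (Cod U f) = {e}"
      using over_initial_unique(1)[OF z c(3) U.Ar_Ob(2)[OF c(2)]] by blast
    note cells = over_initial_unique(2)[OF z c(3) U.Ar_Ob(2)[OF c(2)]]
    show "bij_betw (FAr proj) (Hom Gr c d)
        (Hom (op_cat U) (FOb proj c) (FOb proj d))"
      unfolding bij_betw_def
    proof
      show "inj_on (FAr proj) (Hom Gr c d)"
      proof (rule inj_onI)
        fix u v assume uH: "u \<in> Hom Gr c d" and vH: "v \<in> Hom Gr c d"
          and eq: "FAr proj u = FAr proj v"
        obtain p k \<pi> where u: "u = gr f g p k \<pi>" "gr_arrow f g p k \<pi>"
          using Hom_Gr_from[OF uH[unfolded c(1)]] unfolding d(1) by (metis prod.inject)
        obtain q l \<chi> where v: "v = gr f g q l \<chi>" "gr_arrow f g q l \<chi>"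
          using Hom_Gr_from[OF vH[unfolded c(1)]] unfolding d(1) by (metis prod.inject)
        have "p = q" using eq u(1) v(1) by simp
        moreover have "k = l" using u(2) v(2) h by (simp add: gr_arrow_def)
        ultimately have "\<pi> = \<chi>" using u(2) v(2) cells by (auto simp: gr_arrow_def)
        with \<open>p = q\<close> \<open>k = l\<close> show "u = v" using u(1) v(1) by simp
      qed
      show "FAr proj ` Hom Gr c d =
          Hom (op_cat U) (FOb proj c) (FOb proj d)"
      proof
        show "FAr proj ` Hom Gr c d \<subseteq>
            Hom (op_cat U) (FOb proj c) (FOb proj d)"
          by (intro image_subsetI proj_functor.FAr_Hom)
        show "Hom (op_cat U) (FOb proj c) (FOb proj d) \<subseteq>
            FAr proj ` Hom Gr c d"
        proof
          fix p assume "p \<in> Hom (op_cat U) (FOb proj c) (FOb proj d)"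
          then have p: "p \<in> Hom U (Cod U g) (Cod U f)" using c(1) d(1) by (simp add: Hom_op)
          have hH: "h \<in> Hom U (Dom U f) (Dom U g)" using h by simp
          have "p \<cdot>\<^bsub>U\<^esub> g \<cdot>\<^bsub>U\<^esub> h \<in> Hom U (Dom U f) (Cod U f)"
            using p hH d(2) by (simp add: Hom_iff)
          moreover have fH: "f \<in> Hom U (Dom U f) (Cod U f)" using c(2) by (simp add: Hom_iff)
          ultimately have "p \<cdot>\<^bsub>U\<^esub> g \<cdot>\<^bsub>U\<^esub> h = f" using e by (metis singletonD)
          then have "gr_arrow f g p h (Id V f)"
            unfolding gr_arrow_def using Id_cell[OF fH] c(2) d(2) p hH by simp
          then have "gr f g p h (Id V f) \<in> Hom Gr c d" unfolding c(1) d(1) by (rule gr_Hom)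
          moreover have "p = FAr proj (gr f g p h (Id V f))" by simp
          ultimately show "p \<in> FAr proj ` Hom Gr c d" by blast
        qed
      qed
    qed
  next
    fix x assume "x \<in> Ob (op_cat U)"
    then have x: "x \<in> Ob U" by simp
    obtain e where "Hom U z x = {e}" using initial_unique(1)[OF z x] by blast
    then have e: "e \<in> Ar U" "Dom U e = z" "Cod U e = x" by (auto simp: Hom_def)
    have "Id U z \<in> Hom U z z" using z U.Id_Hom by (simp add: strict_initial_def)
    then have "(x, e) \<in> ?I" using e by auto
    moreover have "(x, e) \<in> Ob Gr" using e Ob_Gr by simp
    ultimately show "\<exists>c \<in> ?I. c \<in> Ob Gr \<and> FOb proj c = x" by force
  qed
qed

end

theorem lemma31:
  fixes A :: "('o, 'm, 'c) two_cat_data"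
  assumes "two_category A"
    and "\<exists>z. strict_initial A z"
  shows "preserves_effective_descent
    (grothendieck (op_cat (Und A)) (lax_comma_pseudofun A)) (op_cat (Und A)) grothendieck_proj"
proof -
  interpret two_category A by fact
  obtain z where "strict_initial A z" using assms(2) by blast
  then interpret coreflective_sieve Gr "op_cat (Und A)" proj
    "{(x, f). f \<in> Ar U \<and> Cod U f = x \<and> Hom U (Dom U f) z \<noteq> {}}"
    by (rule coreflective_sieve_Gr)
  show ?thesis
    unfolding preserves_effective_descent_def effective_descent_iff_elementwise[OF category_Gr]
      effective_descent_iff_elementwise[OF U.category_op]
    using preserves_elementwise_descent by blast
qed

end
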